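(* Let $\beta \in [0,1]$ be a real parameter. There is an algorithm that, given $n\in \mathbb{Z}_+$ and an instance of the Tripartite Negative Triangle problem with part sizes at most $n$, $n$, and $n^{\beta / 2}$, in $\mathcal{O}(n^2)$ time produces an alphabet $\Sigma$ of size $\mathcal{O}(n)$, a normalized weight function $w:\overline{\Sigma}^2\to \mathbb{R}_{\ge 0}$, strings $X,Y\in \Sigma^{\mathcal{O}(n^{1+\beta})}$ such that $\mathsf{ed}(X,Y) \le 4$, and a threshold $k =\mathcal{O}(n)$ such that the answer to the Tripartite Negative Triangle instance is ``YES'' if and only if $\mathsf{ed}^w(X, Y) \le k$.
   Context: Tripartite Negative Triangle problem: given a complete tripartite graph with vertex set $P\cup Q\cup R$ of size $N$ and a weight function $w_G:(P\times Q)\cup(Q\times R)\cup(R\times P)\to[-N^{\mathcal{O}(1)}.\,.N^{\mathcal{O}(1)}]$ (integers), decide whether there exists $(p,q,r)\in P\times Q\times R$ with $w_G(p,q)+w_G(q,r)+w_G(r,p)<0$. $\overline{\Sigma}=\Sigma\cup\{\varepsilon\}$; a weight function $w$ is normalized if $w(a,a)=0$ and $w(a,b)\ge1$ for distinct $a,b\in\overline\Sigma$. $\mathsf{ed}^w(X,Y)$ is the minimum total cost of edits transforming $X$ into $Y$ (insert $b$: $w(\varepsilon,b)$; delete $a$: $w(a,\varepsilon)$; substitute $a$ by $b$: $w(a,b)$), and $\mathsf{ed}$ is the unweighted edit distance. *)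

theory Defs
  imports Complex_Main
begin

section \<open>Weighted edit distance\<close>

text \<open>
  The empty string symbol is \<open>None\<close>, so \<open>\<Sigma> \<union> {\<epsilon>}\<close> becomes \<open>ext \<Sigma>\<close> and a weight function has type
  \<open>'a option \<Rightarrow> 'a option \<Rightarrow> real\<close>; only its values on \<open>ext \<Sigma>\<close> matter.
\<close>

definition ext :: "'a set \<Rightarrow> 'a option set" where
  "ext S = insert None (Some ` S)"

definition normalized :: "'a set \<Rightarrow> ('a option \<Rightarrow> 'a option \<Rightarrow> real) \<Rightarrow> bool" where
  "normalized S w \<longleftrightarrow>
     (\<forall>a \<in> ext S. \<forall>b \<in> ext S. 0 \<le> w a b) \<and>
     (\<forall>a \<in> ext S. w a a = 0) \<and>
     (\<forall>a \<in> ext S. \<forall>b \<in> ext S. a \<noteq> b \<longrightarrow> 1 \<le> w a b)"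

text \<open>
  A way of editing \<open>X\<close> into \<open>Y\<close> is an alignment: a list of columns in which \<open>(Some a, None)\<close> deletes
  \<open>a\<close>, \<open>(None, Some b)\<close> inserts \<open>b\<close>, and \<open>(Some a, Some b)\<close> substitutes \<open>a\<close> by \<open>b\<close> (or keeps \<open>a\<close>,
  free of charge, if \<open>a = b\<close>). Every character takes part in exactly one column. Weights need not
  satisfy the triangle inequality, so a character cannot be edited via a cheaper intermediate one.
\<close>

definition alignments :: "'a list \<Rightarrow> 'a list \<Rightarrow> ('a option \<times> 'a option) list set" where
  "alignments X Y =
     {A. (None, None) \<notin> set A \<and> List.map_filter fst A = X \<and> List.map_filter snd A = Y}"

definition alignment_cost ::
    "('a option \<Rightarrow> 'a option \<Rightarrow> real) \<Rightarrow> ('a option \<times> 'a option) list \<Rightarrow> real" where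
  "alignment_cost w A = (\<Sum>(a, b)\<leftarrow>A. w a b)"

definition weighted_ed ::
    "('a option \<Rightarrow> 'a option \<Rightarrow> real) \<Rightarrow> 'a list \<Rightarrow> 'a list \<Rightarrow> real" where
  "weighted_ed w X Y = Min (alignment_cost w ` alignments X Y)"

definition ed :: "'a list \<Rightarrow> 'a list \<Rightarrow> real" where
  "ed = weighted_ed (\<lambda>a b. if a = b then 0 else 1)"

text \<open>The minimum is taken over a finite nonempty set.\<close>

lemma alignments_nonempty: "alignments X Y \<noteq> {}"
proof -
  have "List.map_filter fst (map (\<lambda>x. (Some x, None)) X @ map (\<lambda>y. (None, Some y)) Y) = X"
    by (simp add: List.map_filter_def comp_def)
  moreover have "List.map_filter snd (map (\<lambda>x. (Some x, None)) X @ map (\<lambda>y. (None, Some y)) Y) = Y"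
    by (simp add: List.map_filter_def comp_def)
  ultimately have "map (\<lambda>x. (Some x, None)) X @ map (\<lambda>y. (None, Some y)) Y \<in> alignments X Y"
    by (auto simp: alignments_def)
  then show ?thesis by blast
qed

lemma finite_alignments: "finite (alignments X Y)"
proof (rule finite_subset)
  have len: "length A \<le> length (List.map_filter fst A) + length (List.map_filter snd A) \<and>
      set A \<subseteq> ext (set (List.map_filter fst A)) \<times> ext (set (List.map_filter snd A))"
    if "(None, None) \<notin> set A" for A :: "('a option \<times> 'a option) list"
    using that
  proof (induction A)
    case (Cons p A)
    obtain a b where "p = (a, b)" by (cases p)
    with Cons show ?case
      by (cases a; cases b) (auto simp: List.map_filter_def ext_def)
  qed (simp add: List.map_filter_def)
  show "alignments X Y \<subseteq>
      {A. set A \<subseteq> ext (set X) \<times> ext (set Y) \<and> length A \<le> length X + length Y}"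
    using len by (auto simp: alignments_def)
  show "finite {A. set A \<subseteq> ext (set X) \<times> ext (set Y) \<and> length A \<le> length X + length Y}"
    by (rule finite_lists_length_le) (simp add: ext_def)
qed


section \<open>Tripartite Negative Triangle\<close>

text \<open>
  The parts are \<open>P = {..<size_P}\<close>, \<open>Q = {..<size_Q}\<close>, \<open>R = {..<size_R}\<close> (disjoint copies); the
  weights are only relevant on these ranges.
\<close>

record tripartite =
  size_P :: nat
  size_Q :: nat
  size_R :: nat
  wt_PQ :: "nat \<Rightarrow> nat \<Rightarrow> int"
  wt_QR :: "nat \<Rightarrow> nat \<Rightarrow> int"
  wt_RP :: "nat \<Rightarrow> nat \<Rightarrow> int"

definition num_vertices :: "tripartite \<Rightarrow> nat" where
  "num_vertices G = size_P G + size_Q G + size_R G"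

text \<open>The exponent \<open>c\<close> is the constant hidden in the weight range \<open>[-N^O(1)..N^O(1)]\<close>.\<close>

definition weights_within :: "nat \<Rightarrow> tripartite \<Rightarrow> bool" where
  "weights_within c G \<longleftrightarrow>
     (\<forall>p < size_P G. \<forall>q < size_Q G. \<bar>wt_PQ G p q\<bar> \<le> int (num_vertices G) ^ c) \<and>
     (\<forall>q < size_Q G. \<forall>r < size_R G. \<bar>wt_QR G q r\<bar> \<le> int (num_vertices G) ^ c) \<and>
     (\<forall>r < size_R G. \<forall>p < size_P G. \<bar>wt_RP G r p\<bar> \<le> int (num_vertices G) ^ c)"

definition has_negative_triangle :: "tripartite \<Rightarrow> bool" where
  "has_negative_triangle G \<longleftrightarrow>
     (\<exists>p < size_P G. \<exists>q < size_Q G. \<exists>r < size_R G. wt_PQ G p q + wt_QR G q r + wt_RP G r p < 0)"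


section \<open>Word RAM\<close>

text \<open>
  A structured random access machine with integer registers and integer arrays (a program names
  finitely many of each). Every operation takes one time unit and may only produce numbers of
  absolute value at most \<open>B\<close>; otherwise the machine is stuck and has no final state. With \<open>B\<close>
  polynomial in the input size this is the usual word RAM with words of logarithmic length.
\<close>

datatype arith_op = Add | Sub | Mul | Div

fun apply_op :: "arith_op \<Rightarrow> int \<Rightarrow> int \<Rightarrow> int" where
  "apply_op Add x y = x + y"
| "apply_op Sub x y = x - y"
| "apply_op Mul x y = x * y"
| "apply_op Div x y = x div y"

record ram_state =
  regs :: "nat \<Rightarrow> int"
  arrs :: "nat \<Rightarrow> int \<Rightarrow> int"

datatype com =
    Skip
  | Const nat int              \<comment> \<open>\<open>Const x v\<close>: register \<open>x\<close> := \<open>v\<close>\<close>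
  | Arith arith_op nat nat nat \<comment> \<open>\<open>Arith f x y z\<close>: register \<open>x\<close> := \<open>f\<close> of registers \<open>y\<close> and \<open>z\<close>\<close>
  | Load nat nat nat           \<comment> \<open>\<open>Load x a y\<close>: register \<open>x\<close> := array \<open>a\<close> at index register \<open>y\<close>\<close>
  | Store nat nat nat          \<comment> \<open>\<open>Store a y z\<close>: array \<open>a\<close> at index register \<open>y\<close> := register \<open>z\<close>\<close>
  | Seq com com
  | IfLess nat nat com com     \<comment> \<open>tests register \<open>x\<close> < register \<open>y\<close>\<close>
  | WhileLess nat nat com

definition set_reg :: "nat \<Rightarrow> int \<Rightarrow> ram_state \<Rightarrow> ram_state" where
  "set_reg x v s = s\<lparr>regs := (regs s)(x := v)\<rparr>"

definition set_arr :: "nat \<Rightarrow> int \<Rightarrow> int \<Rightarrow> ram_state \<Rightarrow> ram_state" where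
  "set_arr a i v s = s\<lparr>arrs := (arrs s)(a := (arrs s a)(i := v))\<rparr>"

text \<open>\<open>exec B c s t s'\<close>: started in \<open>s\<close>, program \<open>c\<close> halts after \<open>t\<close> steps in \<open>s'\<close>.\<close>

inductive exec :: "int \<Rightarrow> com \<Rightarrow> ram_state \<Rightarrow> nat \<Rightarrow> ram_state \<Rightarrow> bool" for B :: int where
  Skip: "exec B Skip s 1 s"
| Const: "\<bar>v\<bar> \<le> B \<Longrightarrow> exec B (Const x v) s 1 (set_reg x v s)"
| Arith: "v = apply_op f (regs s y) (regs s z) \<Longrightarrow> \<bar>v\<bar> \<le> B \<Longrightarrow>
    exec B (Arith f x y z) s 1 (set_reg x v s)"
| Load: "v = arrs s a (regs s y) \<Longrightarrow> \<bar>v\<bar> \<le> B \<Longrightarrow> exec B (Load x a y) s 1 (set_reg x v s)"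
| Store: "v = regs s z \<Longrightarrow> \<bar>v\<bar> \<le> B \<Longrightarrow> exec B (Store a y z) s 1 (set_arr a (regs s y) v s)"
| Seq: "exec B c1 s t1 s1 \<Longrightarrow> exec B c2 s1 t2 s2 \<Longrightarrow> exec B (Seq c1 c2) s (t1 + t2) s2"
| IfTrue: "regs s x < regs s y \<Longrightarrow> exec B c1 s t s1 \<Longrightarrow> exec B (IfLess x y c1 c2) s (1 + t) s1"
| IfFalse: "\<not> regs s x < regs s y \<Longrightarrow> exec B c2 s t s1 \<Longrightarrow>
    exec B (IfLess x y c1 c2) s (1 + t) s1"
| WhileFalse: "\<not> regs s x < regs s y \<Longrightarrow> exec B (WhileLess x y c) s 1 s"
| WhileTrue: "regs s x < regs s y \<Longrightarrow> exec B c s t1 s1 \<Longrightarrow> exec B (WhileLess x y c) s1 t2 s2 \<Longrightarrow>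
    exec B (WhileLess x y c) s (1 + t1 + t2) s2"

inductive_cases exec_SkipE: "exec B Skip s t s'"
inductive_cases exec_ConstE: "exec B (Const x v) s t s'"
inductive_cases exec_ArithE: "exec B (Arith f x y z) s t s'"
inductive_cases exec_LoadE: "exec B (Load x a y) s t s'"
inductive_cases exec_StoreE: "exec B (Store a y z) s t s'"
inductive_cases exec_SeqE: "exec B (Seq c1 c2) s t s'"
inductive_cases exec_IfE: "exec B (IfLess x y c1 c2) s t s'"
inductive_cases exec_WhileE: "exec B (WhileLess x y c) s t s'"

lemma exec_deterministic:
  "exec B c s t s1 \<Longrightarrow> exec B c s t' s2 \<Longrightarrow> t' = t \<and> s2 = s1"
proof (induction arbitrary: t' s2 rule: exec.induct)
  case (Seq c1 s t1 s1 c2 t2 s3)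
  obtain t1' s1' t2' where *: "exec B c1 s t1' s1'" "exec B c2 s1' t2' s2" "t' = t1' + t2'"
    using Seq.prems by (rule exec_SeqE)
  have 1: "t1' = t1 \<and> s1' = s1" using Seq.IH(1) *(1) .
  then have "exec B c2 s1 t2' s2" using *(2) by simp
  then have "t2' = t2 \<and> s2 = s3" by (rule Seq.IH(2))
  with 1 *(3) show ?case by simp
next
  case (IfTrue s x y c1 t s1 c2)
  obtain u where *: "exec B c1 s u s2" "t' = 1 + u"
    using IfTrue.prems by (rule exec_IfE) (use IfTrue.hyps(1) in simp_all)
  from IfTrue.IH[OF *(1)] *(2) show ?case by simp
next
  case (IfFalse s x y c2 t s1 c1)
  obtain u where *: "exec B c2 s u s2" "t' = 1 + u"
    using IfFalse.prems by (rule exec_IfE) (use IfFalse.hyps(1) in simp_all)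
  from IfFalse.IH[OF *(1)] *(2) show ?case by simp
next
  case (WhileFalse s x y c)
  from WhileFalse.prems show ?case by (rule exec_WhileE) (use WhileFalse.hyps in simp_all)
next
  case (WhileTrue s x y c t1 s1 t2 s3)
  obtain t1' s1' t2' where *: "exec B c s t1' s1'" "exec B (WhileLess x y c) s1' t2' s2"
      "t' = 1 + t1' + t2'"
    using WhileTrue.prems by (rule exec_WhileE) (use WhileTrue.hyps(1) in simp_all)
  have 1: "t1' = t1 \<and> s1' = s1" using WhileTrue.IH(1) *(1) .
  then have "exec B (WhileLess x y c) s1 t2' s2" using *(2) by simp
  then have "t2' = t2 \<and> s2 = s3" by (rule WhileTrue.IH(2))
  with 1 *(3) show ?case by simp
qed (erule exec_SkipE exec_ConstE exec_ArithE exec_LoadE exec_StoreE; simp)+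


section \<open>Input and output conventions\<close>

definition row_major :: "nat \<Rightarrow> nat \<Rightarrow> (nat \<Rightarrow> nat \<Rightarrow> int) \<Rightarrow> int \<Rightarrow> int" where
  "row_major rows cols M i =
     (if 0 \<le> i \<and> i < int rows * int cols then M (nat i div cols) (nat i mod cols) else 0)"

text \<open>
  Registers 0 to 3 hold \<open>n\<close> and the part sizes, arrays 0 to 2 the three weight matrices; all other
  registers and cells are 0.
\<close>

definition input_state :: "nat \<Rightarrow> tripartite \<Rightarrow> ram_state" where
  "input_state n G = \<lparr>
     regs = (\<lambda>_. 0)(0 := int n, 1 := int (size_P G), 2 := int (size_Q G), 3 := int (size_R G)),
     arrs = (\<lambda>_ _. 0)
       (0 := row_major (size_P G) (size_Q G) (wt_PQ G),
        1 := row_major (size_Q G) (size_R G) (wt_QR G),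
        2 := row_major (size_R G) (size_P G) (wt_RP G))\<rparr>"

text \<open>
  The output alphabet is \<open>{..<\<sigma>}\<close>. Register 0 holds \<open>\<sigma>\<close>, registers 1 and 2 the lengths of \<open>X\<close> and
  \<open>Y\<close>, registers 3 and 4 numerator and denominator of the threshold \<open>k\<close>; arrays 0 and 1 hold \<open>X\<close> and
  \<open>Y\<close>, and arrays 2 and 3 the numerators and denominators of the \<open>(\<sigma> + 1) \<times> (\<sigma> + 1)\<close> weight matrix,
  whose row and column 0 belong to \<open>\<epsilon>\<close>. The real numbers output are thus rationals.
\<close>

fun sym_code :: "nat option \<Rightarrow> nat" where
  "sym_code None = 0"
| "sym_code (Some a) = a + 1"

definition outputs ::
    "ram_state \<Rightarrow> nat \<Rightarrow> (nat option \<Rightarrow> nat option \<Rightarrow> real) \<Rightarrow> nat list \<Rightarrow> nat list \<Rightarrow> real \<Rightarrow> bool" where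
  "outputs s \<sigma> w X Y k \<longleftrightarrow>
     regs s 0 = int \<sigma> \<and>
     regs s 1 = int (length X) \<and> (\<forall>i < length X. arrs s 0 (int i) = int (X ! i)) \<and>
     regs s 2 = int (length Y) \<and> (\<forall>i < length Y. arrs s 1 (int i) = int (Y ! i)) \<and>
     0 < regs s 4 \<and> k = of_int (regs s 3) / of_int (regs s 4) \<and>
     (\<forall>a \<in> ext {..<\<sigma>}. \<forall>b \<in> ext {..<\<sigma>}.
        let i = int (sym_code a * (\<sigma> + 1) + sym_code b)
        in 0 < arrs s 3 i \<and> w a b = of_int (arrs s 2 i) / of_int (arrs s 3 i))"

end

theory Submission
  imports Defs
begin

text \<open>
  Write \<open>T\<close> for the square of the size \<open>r\<close> of \<open>R\<close>. The set \<open>P\<close> is cut into about \<open>r\<close> groups of size \<open>h\<close>,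
  and \<open>t < T\<close> stands for a group together with a vertex \<open>\<rho>\<close> of \<open>R\<close>. Both strings begin with
  \<open>Z = V\<^sub>0 U\<^sub>0 V\<^sub>1 U\<^sub>1 \<dots> V\<^sub>T\<close>; then \<open>X\<close> has junk followed by an end marker and \<open>Y\<close> the marker followed by
  the junk, where the junk is as long as one period \<open>V\<^sub>t U\<^sub>t\<close>. Since the markers must be matched, a cheap
  alignment starts on the main diagonal and ends shifted by exactly one period, and costs away from
  these two diagonals are such that it turns at a single \<open>t\<close>, where \<open>U\<^sub>t\<close> in \<open>X\<close> faces \<open>V\<^sub>t\<close> in \<open>Y\<close>.

  The string \<open>V\<^sub>t\<close> lists the candidates for \<open>q\<close> between two symbols that can only be reached from
  symbols numbered \<open>\<rho>\<close>, and \<open>U\<^sub>t\<close> has a slot \<open>\<sigma>\<^sub>0 \<dots> \<sigma>\<^sub>r p \<tau>\<^sub>r \<dots> \<tau>\<^sub>0\<close> for every \<open>p\<close> in the group. So the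
  alignment selects a slot, and \<open>\<sigma>\<^bsub>\<rho>+1\<^esub> \<dots> \<sigma>\<^sub>r p \<tau>\<^sub>r \<dots> \<tau>\<^bsub>\<rho>+1\<^esub>\<close> is substituted by candidates. A potential \<open>\<Delta>\<close>, larger
  than all weights of the graph, makes it optimal to use consecutive candidates; substituting \<open>\<sigma>\<^sub>a\<close>
  costs the difference of the weights of \<open>(q, a - 1)\<close> and \<open>(q, a)\<close> up to the potential, and these telescope to the weight
  of \<open>(q, \<rho>)\<close>, where \<open>q\<close> is the candidate opposite to \<open>p\<close>. The weights of \<open>(p, q)\<close> and \<open>(\<rho>, p)\<close> are paid by
  \<open>p\<close> and by \<open>\<tau>\<^sub>\<rho>\<close>.
\<close>

section \<open>Alignments\<close>

text \<open>A weight sees one pair of symbols, and an alphabet of size linear in \<open>n\<close>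
  cannot spend a symbol on each pair of vertices. The symbols \<open>sg a\<close> and
  \<open>qq b\<close> are therefore shared by all periods, and a column of these two looks the same
  for every vertex of \<open>R\<close> numbered below \<open>a\<close>. So the weight of
  \<open>(q, \<rho>)\<close> cannot be paid in one column; it is spread over the columns with
  \<open>a > \<rho>\<close>. These agree on \<open>q\<close> only if the candidates are consecutive,
  which is why a potential is needed. Grouping \<open>P\<close> keeps the strings short: a period
  holds about \<open>n / r\<close> slots of length \<open>2 * r + 3\<close>, which is linear in
  \<open>n\<close>, and there are \<open>r * r\<close> periods.

  All weights are integers over the denominator \<open>Den\<close>. The number of whole units
  \<open>Den\<close> is the same for every correct turn and equals the budget \<open>K\<close>, so
  the sign of the triangle sum decides whether the cost lies below \<open>K * Den\<close>. The
  threshold is \<open>K - 1 / Den\<close>.\<close>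

definition icost :: "('a option \<Rightarrow> 'a option \<Rightarrow> int) \<Rightarrow> ('a option \<times> 'a option) list \<Rightarrow> int" where
  "icost f A = (\<Sum>(a, b)\<leftarrow>A. f a b)"

lemma icost_simps [simp]:
  "icost f [] = 0" "icost f (p # A) = f (fst p) (snd p) + icost f A" "icost f (A @ B) = icost f A + icost f B"
  by (simp_all add: icost_def split_beta)

lemma alignment_cost_rational:
  assumes "\<And>p. p \<in> set A \<Longrightarrow> w (fst p) (snd p) = of_int (f (fst p) (snd p)) / d"
  shows "alignment_cost w A = of_int (icost f A) / d"
  using assms by (induction A) (auto simp: alignment_cost_def add_divide_distrib split_beta)

lemma map_filter_append: "List.map_filter f (xs @ ys) = List.map_filter f xs @ List.map_filter f ys"
  by (simp add: List.map_filter_def)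

lemma alignments_append:
  "A \<in> alignments X Y \<Longrightarrow> B \<in> alignments X' Y' \<Longrightarrow> A @ B \<in> alignments (X @ X') (Y @ Y')"
  by (auto simp: alignments_def map_filter_append)

lemma weighted_ed_le_iff:
  "weighted_ed w X Y \<le> k \<longleftrightarrow> (\<exists>A \<in> alignments X Y. alignment_cost w A \<le> k)"
  by (simp add: weighted_ed_def Min_le_iff finite_alignments alignments_nonempty)

text \<open>An upper bound instead of the minimum, because bounds compose along concatenations; the
  turn is assembled from segments in this way.\<close>

definition cheap :: "('a option \<Rightarrow> 'a option \<Rightarrow> int) \<Rightarrow> 'a list \<Rightarrow> 'a list \<Rightarrow> int \<Rightarrow> bool" where
  "cheap f X Y c \<longleftrightarrow> (\<exists>A \<in> alignments X Y. icost f A \<le> c)"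

lemma cheap_append:
  assumes "cheap f X Y c" "cheap f X' Y' c'" "d = c + c'"
  shows "cheap f (X @ X') (Y @ Y') d"
proof -
  obtain A B where "A \<in> alignments X Y" "icost f A \<le> c" "B \<in> alignments X' Y'" "icost f B \<le> c'"
    using assms(1,2) by (auto simp: cheap_def)
  then show ?thesis
    unfolding cheap_def assms(3) by (intro bexI[of _ "A @ B"]) (auto intro: alignments_append)
qed

lemma cheap_delete: "(\<And>x. x \<in> set X \<Longrightarrow> f (Some x) None \<le> c) \<Longrightarrow> cheap f X [] (c * int (length X))"
proof (induction X)
  case Nil
  then show ?case by (auto simp: cheap_def alignments_def List.map_filter_def intro!: exI[of _ "[]"])
next
  case (Cons x X)
  have 1: "cheap f [x] [] c"
    using Cons.prems by (auto simp: cheap_def alignments_def List.map_filter_def intro!: exI[of _ "[(Some x, None)]"])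
  have 2: "cheap f X [] (c * int (length X))" using Cons by simp
  show ?case using cheap_append[OF 1 2] by (simp add: algebra_simps)
qed

lemma cheap_insert: "(\<And>y. y \<in> set Y \<Longrightarrow> f None (Some y) \<le> c) \<Longrightarrow> cheap f [] Y (c * int (length Y))"
proof (induction Y)
  case Nil
  then show ?case by (auto simp: cheap_def alignments_def List.map_filter_def intro!: exI[of _ "[]"])
next
  case (Cons y Y)
  have 1: "cheap f [] [y] c"
    using Cons.prems by (auto simp: cheap_def alignments_def List.map_filter_def intro!: exI[of _ "[(None, Some y)]"])
  have 2: "cheap f [] Y (c * int (length Y))" using Cons by simp
  show ?case using cheap_append[OF 1 2] by (simp add: algebra_simps)
qed

lemma cheap_substitute:
  assumes "length X = length Y"
  shows "cheap f X Y (\<Sum>i<length X. f (Some (X ! i)) (Some (Y ! i)))"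
  using assms
proof (induction X Y rule: list_induct2)
  case Nil
  then show ?case by (auto simp: cheap_def alignments_def List.map_filter_def intro!: exI[of _ "[]"])
next
  case (Cons x X y Y)
  have 1: "cheap f [x] [y] (f (Some x) (Some y))"
    by (auto simp: cheap_def alignments_def List.map_filter_def intro!: exI[of _ "[(Some x, Some y)]"])
  show ?case using cheap_append[OF 1 Cons.IH] by (simp add: sum.lessThan_Suc_shift del: sum.lessThan_Suc)
qed

lemma cheap_mono: "cheap f X Y c \<Longrightarrow> c \<le> d \<Longrightarrow> cheap f X Y d"
  unfolding cheap_def by (meson order_trans)

lemma cheap_refl: "(\<And>x. f (Some x) (Some x) = 0) \<Longrightarrow> cheap f X X 0"
  using cheap_substitute[of X X f] by simp

text \<open>The alignment seen from \<open>Y\<close>, with \<open>None\<close> for an insertion.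
  Positions replace columns because the lower bound argues about where certain symbols can
  go.\<close>

definition matching :: "nat \<Rightarrow> nat \<Rightarrow> (nat \<Rightarrow> nat option) \<Rightarrow> bool" where
  "matching m l g \<longleftrightarrow> (\<forall>y x. g y = Some x \<longrightarrow> y < l \<and> x < m) \<and>
     (\<forall>y y' x x'. g y = Some x \<longrightarrow> g y' = Some x' \<longrightarrow> y < y' \<longrightarrow> x < x')"

definition deleted :: "nat \<Rightarrow> (nat \<Rightarrow> nat option) \<Rightarrow> nat set" where
  "deleted m g = {x. x < m \<and> Some x \<notin> range g}"

definition column :: "('a option \<Rightarrow> 'a option \<Rightarrow> int) \<Rightarrow> 'a list \<Rightarrow> 'a list \<Rightarrow> (nat \<Rightarrow> nat option) \<Rightarrow> nat \<Rightarrow> int" where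
  "column f X Y g y = f (map_option (nth X) (g y)) (Some (Y ! y))"

text \<open>Induction from the right: a new last column only adds a last position, so the indices of
  all earlier positions keep their meaning.\<close>

lemma matching_of_alignment:
  assumes "A \<in> alignments X Y"
  shows "\<exists>g. matching (length X) (length Y) g \<and>
    icost f A = (\<Sum>y<length Y. column f X Y g y) + (\<Sum>x\<in>deleted (length X) g. f (Some (X ! x)) None)"
  using assms
proof (induction A arbitrary: X Y rule: rev_induct)
  case Nil
  then have "X = []" "Y = []" by (auto simp: alignments_def List.map_filter_def)
  then show ?case by (intro exI[of _ "\<lambda>_. None"]) (auto simp: matching_def deleted_def)
next
  case (snoc p A)
  obtain a b where p: "p = (a, b)" by (cases p)
  let ?X = "List.map_filter fst A" and ?Y = "List.map_filter snd A"
  have mem: "A \<in> alignments ?X ?Y" and ab: "\<not> (a = None \<and> b = None)"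
    and X: "X = ?X @ (case a of None \<Rightarrow> [] | Some x \<Rightarrow> [x])"
    and Y: "Y = ?Y @ (case b of None \<Rightarrow> [] | Some y \<Rightarrow> [y])"
    using snoc.prems unfolding p
    by (auto simp: alignments_def map_filter_append List.map_filter_def split: option.splits)
  obtain g where g: "matching (length ?X) (length ?Y) g"
    and cost: "icost f A = (\<Sum>y<length ?Y. column f ?X ?Y g y) +
      (\<Sum>x\<in>deleted (length ?X) g. f (Some (?X ! x)) None)"
    using snoc.IH[OF mem] by blast
  define m where "m = length ?X"
  define l where "l = length ?Y"
  have gb: "y < l \<and> x < m" if "g y = Some x" for y x
    using g that by (auto simp: matching_def m_def l_def)
  have fin: "finite (deleted m g)" by (simp add: deleted_def)
  have nth_X: "X ! x = ?X ! x" if "x < m" for x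
    using that by (subst X) (auto simp: nth_append m_def)
  have nth_Y: "Y ! y = ?Y ! y" if "y < l" for y
    using that by (subst Y) (auto simp: nth_append l_def)
  \<comment> \<open>Only a substitution creates a pair; for an insertion \<open>g\<close> already
    has the right value \<open>None\<close> at \<open>l\<close>.\<close>
  define g' where "g' = (if a \<noteq> None \<and> b \<noteq> None then g(l := Some m) else g)"
  have g'_old: "g' y = g y" if "y < l" for y using that by (auto simp: g'_def)
  have g'_mat: "matching (length X) (length Y) g'"
  proof -
    have "length X = (if a = None then m else m + 1)" "length Y = (if b = None then l else l + 1)"
      by (subst X; simp add: m_def split: option.split) (subst Y; simp add: l_def split: option.split)
    then show ?thesis
      using g gb unfolding matching_def g'_def m_def[symmetric] l_def[symmetric]
      by (auto split: if_splits dest: less_SucI) (fastforce+)?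
  qed
  have col: "(\<Sum>y<l. column f X Y g' y) = (\<Sum>y<l. column f ?X ?Y g y)"
  proof (rule sum.cong[OF refl])
    fix y assume "y \<in> {..<l}"
    then have y: "y < l" by simp
    have "map_option (nth X) (g y) = map_option (nth ?X) (g y)"
      using gb nth_X by (cases "g y") auto
    then show "column f X Y g' y = column f ?X ?Y g y"
      using nth_Y[OF y] by (simp add: column_def g'_old[OF y])
  qed
  have del: "(\<Sum>x\<in>deleted m g. f (Some (X ! x)) None) = (\<Sum>x\<in>deleted m g. f (Some (?X ! x)) None)"
    by (rule sum.cong) (auto simp: deleted_def nth_X)
  show ?case
  proof (intro exI conjI)
    show "matching (length X) (length Y) g'" by (fact g'_mat)
    show "icost f (A @ [p]) = (\<Sum>y<length Y. column f X Y g' y) +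
        (\<Sum>x\<in>deleted (length X) g'. f (Some (X ! x)) None)"
    proof (cases a)
      case None
      then obtain y where b: "b = Some y" using ab by auto
      have gl: "g l = None" using gb by (metis less_irrefl option.exhaust)
      have LX: "length X = m" by (subst X) (simp add: None m_def)
      have LY: "length Y = Suc l" by (subst Y) (simp add: b l_def)
      have "Y ! l = y" by (subst Y) (simp add: b l_def)
      then have "column f X Y g' l = f None (Some y)" by (simp add: column_def g'_def None gl)
      moreover have "g' = g" by (simp add: g'_def None)
      ultimately show ?thesis using cost col del by (simp add: LX LY p None b m_def l_def)
    next
      case (Some x)
      have LX: "length X = Suc m" by (subst X) (simp add: Some m_def)
      have Xm: "X ! m = x" by (subst X) (simp add: Some m_def)
      show ?thesis
      proof (cases b)
        case None
        have LY: "length Y = l" by (subst Y) (simp add: None l_def)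
        have g': "g' = g" by (simp add: g'_def None)
        have "Some m \<notin> range g" using gb by (metis less_irrefl imageE)
        then have "deleted (Suc m) g = insert m (deleted m g)" by (auto simp: deleted_def less_Suc_eq)
        moreover have "m \<notin> deleted m g" by (simp add: deleted_def)
        ultimately show ?thesis using cost col del fin Xm
          by (simp add: LX LY p None Some m_def l_def g')
      next
        case (Some y)
        have LY: "length Y = Suc l" by (subst Y) (simp add: Some l_def)
        have Yl: "Y ! l = y" by (subst Y) (simp add: Some l_def)
        have g': "g' = g(l := Some m)" by (simp add: g'_def Some \<open>a = Some x\<close>)
        have gl: "g l = None" using gb by (metis less_irrefl option.exhaust)
        have "Some z \<in> range g' \<longleftrightarrow> z = m \<or> Some z \<in> range g" for z
          unfolding g' using gl by (auto simp: image_iff) (metis option.distinct(1))+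
        then have "deleted (Suc m) g' = deleted m g" by (auto simp: deleted_def less_Suc_eq)
        moreover have "column f X Y g' l = f (Some x) (Some y)" by (simp add: column_def g' Xm Yl)
        ultimately show ?thesis using cost col del
          by (simp add: LX LY p Some \<open>a = Some x\<close> m_def l_def)
      qed
    qed
  qed
qed

section \<open>Strings and weights\<close>

locale gadget =
  fixes n r sP sQ :: nat and PQ QR RP :: "nat \<Rightarrow> nat \<Rightarrow> int" and W :: int
  assumes n: "1 \<le> n" and rr: "r * r \<le> n" and sP: "sP \<le> n" and sQ: "sQ \<le> n" and W: "1 \<le> W"
    and PQ: "\<And>p q. p < sP \<Longrightarrow> q < sQ \<Longrightarrow> \<bar>PQ p q\<bar> \<le> W"
    and QR: "\<And>q v. q < sQ \<Longrightarrow> v < r \<Longrightarrow> \<bar>QR q v\<bar> \<le> W"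
    and RP: "\<And>v p. v < r \<Longrightarrow> p < sP \<Longrightarrow> \<bar>RP v p\<bar> \<le> W"
begin

text \<open>Rounded up strictly, so that \<open>r\<close> groups of this size cover \<open>P\<close>
  whatever the remainder.\<close>

definition "h = n div r + 1"
definition "sl = 2 * r + 3"
definition "u = 1 + h * sl"
definition "nq = n + 2 * r"
text \<open>One less than \<open>u\<close>: the symbols of \<open>U t\<close> on either side of the
  chosen slot part always fit into the fillers on that side, but all of \<open>U t\<close> does not
  fit into one block of fillers.\<close>

definition "N = h * sl"
definition "vl = 2 * N + 2 + nq"
definition "wsz = vl + u"
definition "T = r * r"
text \<open>Room for every payload; the largest bound is that of the pairs \<open>(i, a)\<close> in
  \<open>ta\<close>, below \<open>h * (r + 1) \<le> 2 * n + r + 1\<close>.\<close>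

definition "S = 3 * n + 4"
text \<open>The budget in units of \<open>Den\<close>. One \<open>wsz\<close> each is for inserting
  junk into \<open>Y\<close>, for substituting junk of \<open>X\<close> by the last period, and for
  the turn, which also pays \<open>u + 2 * nq\<close>. The surcharges add up to
  \<open>3 * T + h * r\<close>.\<close>

definition "K = int (3 * wsz + u + 2 * nq + 3 * T + h * r)"
text \<open>The potential must beat \<open>2 * W\<close> for the column of \<open>p\<close>,
  \<open>W\<close> for that of \<open>ee\<close>, and \<open>2 * W\<close> for each of at most
  \<open>r\<close> differences, hence \<open>2 * r + 3\<close> times \<open>W\<close>.\<close>

definition "\<Delta> = W * int (2 * r + 4)"
text \<open>The factors multiplied by \<open>\<Delta>\<close> have absolute value at most
  \<open>2 * S\<close>, so a potential term stays within one unit.\<close>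

definition "Den = \<Delta> * int (2 * S)"

lemma r: "r \<le> n"
  using rr by (cases r) auto

lemma hr: "n < r * h" if "0 < r"
  unfolding h_def using that by (metis add.commute dividend_less_div_times mult.commute mult_Suc_right plus_1_eq_Suc)

lemma hr_le: "r * h \<le> n + r"
  by (simp add: h_def)

lemma \<Delta>: "W * (2 * int r + 3) < \<Delta>" "1 \<le> \<Delta>"
proof -
  show "W * (2 * int r + 3) < \<Delta>" unfolding \<Delta>_def using W by (simp add: algebra_simps)
  moreover have "0 \<le> W * (2 * int r + 3)" using W by simp
  ultimately show "1 \<le> \<Delta>" by linarith
qed

lemma Den: "\<Delta> \<le> Den" "1 \<le> Den" "W * 2 \<le> Den"
proof -
  have "\<Delta> * 1 \<le> \<Delta> * int (2 * S)"
    by (rule mult_left_mono) (use \<Delta> in \<open>auto simp: S_def\<close>)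
  then show "\<Delta> \<le> Den" by (simp add: Den_def)
  then show "1 \<le> Den" using \<Delta> by linarith
  have "W * 2 \<le> W * (2 * int r + 3)" using W by (intro mult_left_mono) auto
  then show "W * 2 \<le> Den" using \<Delta> \<open>\<Delta> \<le> Den\<close> by linarith
qed

text \<open>The default \<open>2 * W\<close> outweighs the other two graph weights even if both are
  \<open>- W\<close>, so neither a dummy candidate nor a number outside \<open>P\<close> can belong
  to a negative sum.\<close>

definition PQx :: "int \<Rightarrow> int \<Rightarrow> int" where
  "PQx x b = (if x < int sP \<and> int r \<le> b \<and> b < int r + int sQ then PQ (nat x) (nat (b - int r)) else 2 * W)"

text \<open>The default 0 at \<open>a = r\<close> ends the telescoping sum.\<close>

definition QRx :: "int \<Rightarrow> int \<Rightarrow> int" where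
  "QRx a g = (if a < int r \<and> int r \<le> g \<and> g < int r + int sQ then QR (nat (g - int r)) (nat a) else 0)"

definition RPx :: "int \<Rightarrow> int \<Rightarrow> int" where
  "RPx v x = (if v < int r \<and> x < int sP then RP (nat v) (nat x) else 0)"

lemma PQx: "0 \<le> x \<Longrightarrow> \<bar>PQx x b\<bar> \<le> 2 * W"
proof -
  assume x: "0 \<le> x"
  have "\<bar>PQ (nat x) (nat (b - int r))\<bar> \<le> W" if "x < int sP" "int r \<le> b" "b < int r + int sQ"
    by (rule PQ) (use that x in auto)
  then show ?thesis using W unfolding PQx_def by auto
qed

lemma QRx: "0 \<le> a \<Longrightarrow> \<bar>QRx a g\<bar> \<le> W"
proof -
  assume x: "0 \<le> a"
  have "\<bar>QR (nat (g - int r)) (nat a)\<bar> \<le> W" if "a < int r" "int r \<le> g" "g < int r + int sQ"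
    by (rule QR) (use that x in auto)
  then show ?thesis using W unfolding QRx_def by auto
qed

lemma RPx: "0 \<le> v \<Longrightarrow> 0 \<le> x \<Longrightarrow> \<bar>RPx v x\<bar> \<le> W"
proof -
  assume x: "0 \<le> v" "0 \<le> x"
  have "\<bar>RP (nat v) (nat x)\<bar> \<le> W" if "v < int r" "x < int sP"
    by (rule RP) (use that x in auto)
  then show ?thesis using W unfolding RPx_def by auto
qed

text \<open>Equal to the budget: one column or deletion of this weight already makes an alignment
  too expensive.\<close>

definition "BIG = K * Den"

text \<open>
  A symbol is coded as \<open>kind * S + payload\<close>, and kind \<open>-1\<close> is the empty string. In the notation above the kinds are:
  0 filler, 1 junk, 2 end marker, 3 first symbol of \<open>U\<^sub>t\<close>, 4 \<open>\<sigma>\<^sub>a\<close>, 5 \<open>p\<close>, 6 \<open>\<tau>\<^sub>a\<close>, 7 candidates for \<open>q\<close>, 8 and 9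
  the two symbols of \<open>V\<^sub>t\<close> that fix \<open>\<rho>\<close>. Candidate \<open>b\<close> stands for \<open>q = b - r\<close>; \<open>r\<close> dummies on either side make room
  for the substitutes of the neighbours of \<open>p\<close>. Every period after the turn costs 3, and \<open>h\<close> more where the
  group changes; the summands \<open>3 * (q + 1)\<close> and \<open>h * (q div r + 1)\<close> make the total independent of the turn.
\<close>

definition wn :: "int \<Rightarrow> int \<Rightarrow> int \<Rightarrow> int \<Rightarrow> int" where
  "wn k p l q =
    (if l = -1 then if k = 0 \<or> 7 \<le> k then Den else BIG
     else if k = -1 then if l = 1 \<or> l = 7 then Den else BIG
     else if k = 1 then if l = 3 \<and> q \<noteq> int T - 1 then BIG else Den
     else if l = 0 then if 3 \<le> k \<and> k \<le> 6 then Den else BIG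
     else if k = l then if k = 3 \<or> k = 5 \<or> 8 \<le> k then Den else BIG
     else if l = 8 then
       if k = 4 \<and> p = q mod int r then Den * (1 + 3 * (q + 1) + int h * (q div int r + 1)) else BIG
     else if l = 9 then
       if k = 6 \<and> p mod (int r + 1) = q mod int r
       then 2 * Den + RPx (q mod int r) (q div int r * int h + p div (int r + 1)) else BIG
     else if l = 7 then
       if k = 4 \<and> 1 \<le> p then
         4 * Den - \<Delta> * (q + int r + 1 - p)
           + (QRx (p - 1) (q + int r + 1 - p) - QRx p (q + int r + 1 - p))
       else if k = 5 then 2 * Den + PQx p q
       else if k = 6 \<and> 1 \<le> p mod (int r + 1) then
         2 * Den + \<Delta> * (q - (int r + 1 - p mod (int r + 1)))
       else BIG
     else BIG)"

text \<open>Subtracting 1 from the code sends the empty string to kind -1 with payload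
  \<open>S - 1\<close>, so one formula serves insertions, deletions and substitutions.\<close>

definition wi :: "nat option \<Rightarrow> nat option \<Rightarrow> int" where
  "wi a b = (if a = b then 0 else
     wn ((int (sym_code a) - 1) div int S) ((int (sym_code a) - 1) mod int S)
        ((int (sym_code b) - 1) div int S) ((int (sym_code b) - 1) mod int S))"

lemma S_pos: "0 < S" by (simp add: S_def)

lemma K_pos: "1 \<le> K"
  unfolding K_def u_def by simp

lemma BIG: "Den \<le> BIG" "BIG = K * Den"
proof -
  have "1 * Den \<le> K * Den" by (rule mult_right_mono) (use K_pos Den in auto)
  then show "Den \<le> BIG" by (simp add: BIG_def)
qed (simp add: BIG_def)

lemma wi_refl [simp]: "wi a a = 0"
  by (simp add: wi_def)

text \<open>Potential terms are within one unit and graph terms within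
  \<open>2 * W \<le> Den\<close>; the leading multiples 2 and 4 of \<open>Den\<close> absorb them.
  Payloads that no string contains are included because the whole alphabet must satisfy the
  normalization.\<close>

lemma wn_ge:
  assumes "-1 \<le> k" "-1 \<le> l" "0 \<le> p" "p < int S" "0 \<le> q" "q < int S"
  shows "Den \<le> wn k p l q"
proof -
  have D: "\<Delta> * x \<le> Den" "- Den \<le> \<Delta> * x" if "\<bar>x\<bar> \<le> 2 * int S" for x
  proof -
    have "\<Delta> * x \<le> \<Delta> * int (2 * S)" by (rule mult_left_mono) (use that \<Delta> in auto)
    then show "\<Delta> * x \<le> Den" by (simp add: Den_def)
    have "\<Delta> * (- int (2 * S)) \<le> \<Delta> * x" by (rule mult_left_mono) (use that \<Delta> in auto)
    then show "- Den \<le> \<Delta> * x" by (simp add: Den_def)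
  qed
  have rS: "int r + 1 < int S" using r by (simp add: S_def)
  have 1: "Den \<le> Den * (1 + 3 * (q + 1) + int h * (q div int r + 1))"
  proof -
    have "0 \<le> q div int r" using assms by (cases "r = 0") (auto intro: pos_imp_zdiv_nonneg_iff[THEN iffD2])
    then have "0 \<le> 3 * (q + 1) + int h * (q div int r + 1)" using assms by simp
    then have "Den * 1 \<le> Den * (1 + (3 * (q + 1) + int h * (q div int r + 1)))"
      by (intro mult_left_mono) (use Den in auto)
    then show ?thesis by (simp add: add.assoc)
  qed
  have 2: "Den \<le> 2 * Den + RPx (q mod int r) (q div int r * int h + p div (int r + 1))"
  proof -
    have "0 \<le> q div int r" using assms by (cases "r = 0") (auto intro: pos_imp_zdiv_nonneg_iff[THEN iffD2])
    moreover have "0 \<le> p div (int r + 1)" using assms by (intro pos_imp_zdiv_nonneg_iff[THEN iffD2]) auto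
    moreover have "0 \<le> q mod int r" using assms by (cases "r = 0") auto
    ultimately show ?thesis using RPx[of "q mod int r" "q div int r * int h + p div (int r + 1)"] Den W by simp
  qed
  have 3: "Den \<le> 4 * Den - \<Delta> * (q + int r + 1 - p)
           + (QRx (p - 1) (q + int r + 1 - p) - QRx p (q + int r + 1 - p))" if "1 \<le> p"
    using QRx[of "p - 1" "q + int r + 1 - p"] QRx[of p "q + int r + 1 - p"]
      D[of "q + int r + 1 - p"] that assms rS Den by force
  have 4: "Den \<le> 2 * Den + PQx p q"
    using PQx[of p q] assms Den by linarith
  have 5: "Den \<le> 2 * Den + \<Delta> * (q - (int r + 1 - p mod (int r + 1)))"
  proof -
    have "0 \<le> p mod (int r + 1)" "p mod (int r + 1) < int r + 1"
      using pos_mod_sign[of "int r + 1" p] pos_mod_bound[of "int r + 1" p] by linarith+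
    then have "\<bar>q - (int r + 1 - p mod (int r + 1))\<bar> \<le> 2 * int S" using assms rS by linarith
    from D[OF this] show ?thesis by linarith
  qed
  show ?thesis
  proof (cases "1 \<le> p")
    case True
    show ?thesis unfolding wn_def
      by (simp only: 1 2 3[OF True] 4 5 BIG(1) order_refl simp_thms split: if_split)
  next
    case False
    then show ?thesis unfolding wn_def
      by (simp only: 1 2 4 5 BIG(1) order_refl simp_thms split: if_split)
  qed
qed

lemma wi_ge: "a \<noteq> b \<Longrightarrow> Den \<le> wi a b"
proof -
  have "-1 \<le> (int x - 1) div int S" for x
    using zdiv_mono1[of "-1" "int x - 1" "int S"] S_pos by (simp add: div_eq_minus1)
  then show "a \<noteq> b \<Longrightarrow> Den \<le> wi a b"
    unfolding wi_def using S_pos by (simp, intro wn_ge) auto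
qed

lemma wi_nonneg: "0 \<le> wi a b"
  using wi_ge[of a b] Den by (cases "a = b") auto

section \<open>Symbols and strings\<close>

abbreviation "zz \<equiv> (0::nat)"
abbreviation "jj \<equiv> S"
abbreviation "hh \<equiv> 2 * S"
definition "al t = 3 * S + t"
definition "sg a = 4 * S + a"
definition "pp x = 5 * S + x"
text \<open>The slot number \<open>i\<close> is included because \<open>ee t\<close> only knows the
  group: both together identify \<open>p\<close> in the column that pays for
  \<open>(\<rho>, p)\<close>.\<close>

definition "ta i a = 6 * S + (i * (r + 1) + a)"
definition "qq b = 7 * S + b"
definition "mm t = 8 * S + t"
definition "ee t = 9 * S + t"

lemma wi_Some_Some:
  assumes "p < S" "q < S"
  shows "wi (Some (k * S + p)) (Some (l * S + q)) =
    (if k = l \<and> p = q then 0 else wn (int k) (int p) (int l) (int q))"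
proof -
  have d: "(int (k' * S + p') + 1 - 1) div int S = int k'" "(int (k' * S + p') + 1 - 1) mod int S = int p'" if "p' < S" for k' p'
    using that S_pos by auto
  have "k * S + p = l * S + q \<longleftrightarrow> k = l \<and> p = q"
    using assms by (metis div_mult_self3 mod_mult_self3 mod_less div_less add.commute add_cancel_right_right not_less_zero)
  then show ?thesis
    unfolding wi_def sym_code.simps using d[OF assms(1), of k] d[OF assms(2), of l]
    by (simp add: algebra_simps)
qed

lemma wi_None_Some:
  assumes "q < S"
  shows "wi None (Some (l * S + q)) = wn (-1) (int S - 1) (int l) (int q)"
  using assms S_pos by (simp add: wi_def zmod_minus1 div_eq_minus1)

lemma wi_Some_None:
  assumes "p < S"
  shows "wi (Some (k * S + p)) None = wn (int k) (int p) (-1) (int S - 1)"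
  using assms S_pos by (simp add: wi_def zmod_minus1 div_eq_minus1)

definition "slot t i = map sg [0..<r+1] @ [pp (t div r * h + i)] @ rev (map (ta i) [0..<r+1])"
definition "U t = al t # concat (map (slot t) [0..<h])"
definition "V t = replicate N zz @ [mm t] @ map qq [0..<nq] @ [ee t] @ replicate N zz"
definition "Z = concat (map (\<lambda>t. V t @ U t) [0..<T]) @ V T"
definition "X = Z @ replicate wsz jj @ [hh]"
definition "Y = Z @ [hh] @ replicate wsz jj"

lemma length_concat_uniform: "(\<And>i. length (f i) = w) \<Longrightarrow> length (concat (map f [0..<m])) = m * w"
  by (induction m) auto

lemma nth_concat_uniform:
  assumes "\<And>i. length (f i) = w" "i < m" "j < w"
  shows "concat (map f [0..<m]) ! (i * w + j) = f i ! j"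
  using assms(2)
proof (induction m)
  case (Suc m)
  have len: "length (concat (map f [0..<m])) = m * w"
    by (rule length_concat_uniform) (fact assms(1))
  show ?case
  proof (cases "i = m")
    case True
    then show ?thesis using len by (simp add: nth_append)
  next
    case False
    then have "i < m" using Suc.prems by simp
    have "i * w + j < (i + 1) * w" using assms(3) by simp
    also have "\<dots> \<le> m * w" using \<open>i < m\<close> by (intro mult_le_mono1) simp
    finally show ?thesis using Suc.IH[OF \<open>i < m\<close>] len by (simp add: nth_append)
  qed
qed simp

lemma length_slot [simp]: "length (slot t i) = sl"
  by (simp add: slot_def sl_def)

lemma length_U [simp]: "length (U t) = u"
  by (simp add: U_def u_def length_concat_uniform)

lemma length_V [simp]: "length (V t) = vl"
  by (simp add: V_def vl_def)

lemma length_Z: "length Z = T * wsz + vl"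
  by (simp add: Z_def length_concat_uniform[where w = wsz] wsz_def)

lemma length_X: "length X = T * wsz + vl + wsz + 1"
  and length_Y: "length Y = T * wsz + vl + wsz + 1"
  by (simp_all add: X_def Y_def length_Z)

lemma nth_slot:
  shows "a \<le> r \<Longrightarrow> slot t i ! a = sg a"
    and "slot t i ! (r + 1) = pp (t div r * h + i)"
    and "a \<le> r \<Longrightarrow> slot t i ! (2 * r + 2 - a) = ta i a"
proof -
  show "a \<le> r \<Longrightarrow> slot t i ! a = sg a"
    unfolding slot_def by (subst nth_append) (simp add: nth_append del: upt_Suc)
  show "slot t i ! (r + 1) = pp (t div r * h + i)"
    unfolding slot_def by (subst nth_append) (simp del: upt_Suc)
  assume a: "a \<le> r"
  then have "2 * r + 2 - a - (r + 1) = Suc (r - a)" "\<not> 2 * r + 2 - a < r + 1" by auto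
  then show "slot t i ! (2 * r + 2 - a) = ta i a"
    unfolding slot_def using a by (subst nth_append) (simp add: rev_nth del: upt_Suc)
qed

lemma nth_U:
  shows "U t ! 0 = al t"
    and "i < h \<Longrightarrow> j < sl \<Longrightarrow> U t ! (1 + (i * sl + j)) = slot t i ! j"
  by (simp_all add: U_def nth_concat_uniform)

lemma nth_V:
  shows "j < N \<Longrightarrow> V t ! j = zz"
    and "V t ! N = mm t"
    and "b < nq \<Longrightarrow> V t ! (N + 1 + b) = qq b"
    and "V t ! (N + 1 + nq) = ee t"
    and "j < N \<Longrightarrow> V t ! (N + 2 + nq + j) = zz"
  by (simp_all add: V_def nth_append)

lemma nth_Z:
  shows "t \<le> T \<Longrightarrow> j < vl \<Longrightarrow> Z ! (t * wsz + j) = V t ! j"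
    and "t < T \<Longrightarrow> j < u \<Longrightarrow> Z ! (t * wsz + vl + j) = U t ! j"
proof -
  have len: "length (concat (map (\<lambda>t. V t @ U t) [0..<T])) = T * wsz"
    by (rule length_concat_uniform) (simp add: wsz_def)
  have *: "Z ! (t * wsz + j) = (V t @ U t) ! j" if "t < T" "j < wsz" for t j
  proof -
    have "t * wsz + j < (t + 1) * wsz" using that(2) by simp
    also have "\<dots> \<le> T * wsz" using that(1) by (intro mult_le_mono1) simp
    finally have "Z ! (t * wsz + j) = concat (map (\<lambda>t. V t @ U t) [0..<T]) ! (t * wsz + j)"
      unfolding Z_def using len by (simp add: nth_append)
    then show ?thesis using that by (subst (asm) nth_concat_uniform) (auto simp: wsz_def)
  qed
  show "Z ! (t * wsz + j) = V t ! j" if "t \<le> T" "j < vl" for t j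
  proof (cases "t = T")
    case True
    then show ?thesis using len by (simp add: Z_def nth_append)
  next
    case False
    then show ?thesis using *[of t j] that by (simp add: wsz_def nth_append)
  qed
  show "Z ! (t * wsz + vl + j) = U t ! j" if "t < T" "j < u" for t j
    using *[of t "vl + j"] that by (simp add: wsz_def nth_append add.assoc)
qed

lemma payload:
  shows "t \<le> T \<Longrightarrow> t < S" "a \<le> r \<Longrightarrow> a < S" "t < T \<Longrightarrow> i < h \<Longrightarrow> t div r * h + i < r * h"
    "x < r * h \<Longrightarrow> x < S" "i < h \<Longrightarrow> a \<le> r \<Longrightarrow> i * (r + 1) + a < S" "b < nq \<Longrightarrow> b < S"
proof -
  show "t \<le> T \<Longrightarrow> t < S" using rr by (simp add: S_def T_def)
  show "a \<le> r \<Longrightarrow> a < S" using r by (simp add: S_def)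
  show "x < r * h \<Longrightarrow> x < S" using hr_le r by (simp add: S_def)
  show "b < nq \<Longrightarrow> b < S" using r by (simp add: S_def nq_def)
  show "t div r * h + i < r * h" if "t < T" "i < h"
  proof -
    have "t div r < r" using that(1) by (simp add: T_def less_mult_imp_div_less)
    then have "(t div r + 1) * h \<le> r * h" by (intro mult_le_mono1) simp
    then show ?thesis using that(2) by simp
  qed
  show "i * (r + 1) + a < S" if "i < h" "a \<le> r"
  proof -
    have "i * (r + 1) + a < (i + 1) * (r + 1)" using that by simp
    also have "\<dots> \<le> h * (r + 1)" using that by (intro mult_le_mono1) simp
    finally have "i * (r + 1) + a < r * h + h" by (simp add: algebra_simps)
    moreover have "h \<le> n + 1" by (simp add: h_def)
    ultimately show ?thesis using hr_le r by (simp add: S_def)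
  qed
qed

lemma kind:
  "zz div S = 0" "jj div S = 1" "hh div S = 2" "t \<le> T \<Longrightarrow> al t div S = 3" "a \<le> r \<Longrightarrow> sg a div S = 4"
  "x < r * h \<Longrightarrow> pp x div S = 5" "i < h \<Longrightarrow> a \<le> r \<Longrightarrow> ta i a div S = 6" "b < nq \<Longrightarrow> qq b div S = 7"
  "t \<le> T \<Longrightarrow> mm t div S = 8" "t \<le> T \<Longrightarrow> ee t div S = 9"
  using payload(1)[of t] payload(2)[of a] payload(4)[of x] payload(5)[of i a] payload(6)[of b] S_pos
  by (simp_all add: al_def sg_def pp_def ta_def qq_def mm_def ee_def)

lemma set_slot: "t < T \<Longrightarrow> i < h \<Longrightarrow> x \<in> set (slot t i) \<Longrightarrow> 4 \<le> x div S \<and> x div S \<le> 6"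
  using payload(3)[of t i] by (auto simp: slot_def kind simp del: upt_Suc)

lemma set_U: "t < T \<Longrightarrow> x \<in> set (U t) \<Longrightarrow> 3 \<le> x div S \<and> x div S \<le> 6"
  by (auto simp: U_def kind dest: set_slot)

lemma set_V: "t \<le> T \<Longrightarrow> x \<in> set (V t) \<Longrightarrow> x div S \<in> {0, 7, 8, 9}"
  by (auto simp: V_def kind)

lemma set_Z: "x \<in> set Z \<Longrightarrow> x div S \<le> 9 \<and> x div S \<noteq> 1 \<and> x div S \<noteq> 2"
proof -
  assume "x \<in> set Z"
  then consider t where "t \<le> T" "x \<in> set (V t)" | t where "t < T" "x \<in> set (U t)"
    by (auto simp: Z_def) (meson less_imp_le_nat)
  then show ?thesis
  proof cases
    case 1
    then show ?thesis using set_V[of t x] by auto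
  next
    case 2
    then show ?thesis using set_U[of t x] by auto
  qed
qed

lemma set_XY: "set X \<subseteq> {..<10 * S}" "set Y \<subseteq> {..<10 * S}"
proof -
  have "x < 10 * S" if "x \<in> set Z" for x
  proof -
    have "x div S < 10" using set_Z[OF that] by simp
    then show ?thesis using S_pos by (metis div_less_iff_less_mult mult.commute)
  qed
  then show "set X \<subseteq> {..<10 * S}" "set Y \<subseteq> {..<10 * S}" using S_pos by (auto simp: X_def Y_def)
qed

section \<open>Weights of the symbols in use\<close>

lemma wi_div_mod:
  "x \<noteq> y \<Longrightarrow> wi (Some x) (Some y) = wn (int (x div S)) (int (x mod S)) (int (y div S)) (int (y mod S))"
  by (auto simp: wi_def zdiv_int zmod_int)

lemma wi_delete: "wi (Some x) None = (if x div S = 0 \<or> 7 \<le> x div S then Den else BIG)"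
proof -
  have "wi (Some x) None = wn (int (x div S)) (int (x mod S)) (-1) (int S - 1)"
    using wi_Some_None[of "x mod S" "x div S"] S_pos by simp
  then show ?thesis using S_pos by (simp add: wn_def flip: zdiv_int)
qed

lemma wi_insert: "wi None (Some y) = (if y div S = 1 \<or> y div S = 7 then Den else BIG)"
proof -
  have "wi None (Some y) = wn (-1) (int S - 1) (int (y div S)) (int (y mod S))"
    using wi_None_Some[of "y mod S" "y div S"] S_pos by simp
  moreover have "int (y div S) \<noteq> -1" "int (y div S) = 1 \<longleftrightarrow> y div S = 1" "int (y div S) = 7 \<longleftrightarrow> y div S = 7" by linarith+
  ultimately show ?thesis by (simp add: wn_def)
qed

text \<open>A necessary condition on the kinds of two distinct symbols whose weight is below
  \<open>BIG\<close>; conditions on payloads are left to the lemmas on particular kinds.\<close>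

definition "allowed k l \<longleftrightarrow> k = 1 \<or> l = 0 \<and> k \<in> {3..6} \<or> k = l \<and> k \<in> {3, 5, 8, 9} \<or> k = 4 \<and> l = 8
   \<or> k = 6 \<and> l = 9 \<or> l = 7 \<and> k \<in> {4, 5, (6::nat)}"

lemma allowed:
  assumes "wi (Some x) (Some y) < BIG" "x div S \<le> 9" "x \<noteq> y"
  shows "allowed (x div S) (y div S)"
proof -
  have "wn (int k) p (int l) q = BIG" if "\<not> allowed k l" "k \<le> 9" for k l p q
  proof -
    have l: "int l \<noteq> -1" "int l = 0 \<longleftrightarrow> l = 0" "int l = 1 \<longleftrightarrow> l = 1" "int l = 3 \<longleftrightarrow> l = 3" "int l = 4 \<longleftrightarrow> l = 4"
      "int l = 5 \<longleftrightarrow> l = 5" "int l = 6 \<longleftrightarrow> l = 6" "int l = 7 \<longleftrightarrow> l = 7" "int l = 8 \<longleftrightarrow> l = 8" "int l = 9 \<longleftrightarrow> l = 9"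
      by linarith+
    have "k = 0 \<or> k = 1 \<or> k = 2 \<or> k = 3 \<or> k = 4 \<or> k = 5 \<or> k = 6 \<or> k = 7 \<or> k = 8 \<or> k = 9"
      using that(2) by presburger
    then show ?thesis using that(1)
      by (elim disjE) (simp_all add: wn_def allowed_def l del: of_nat_eq_iff)
  qed
  then show ?thesis using assms unfolding wi_div_mod[OF assms(3)] by force
qed

lemma wi_J:
  assumes "y div S \<noteq> 1" "y div S = 3 \<Longrightarrow> y mod S + 1 = T"
  shows "wi (Some jj) (Some y) = Den"
proof -
  have "jj \<noteq> y" using assms(1) S_pos by auto
  moreover have "int (y div S) \<noteq> -1" "int (y div S) = 3 \<longleftrightarrow> y div S = 3" by linarith+
  moreover have "y div S = 3 \<Longrightarrow> int (y mod S) = int T - 1" using assms(2) by linarith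
  ultimately show ?thesis using S_pos by (auto simp: wi_div_mod wn_def simp del: of_nat_div of_nat_mod)
qed

text \<open>This makes every \<open>al t\<close> of \<open>Y\<close> except the last one face
  another \<open>al\<close> in a cheap alignment. The last is exempt since the junk has to face the
  last period.\<close>

lemma wi_J_al: "t \<le> T \<Longrightarrow> t + 1 \<noteq> T \<Longrightarrow> wi (Some jj) (Some (al t)) = BIG"
  using wi_Some_Some[of 0 t 1 3] payload(1)[of t] S_pos by (simp add: al_def wn_def)

lemma wi_zz: "x div S \<in> {3..6} \<Longrightarrow> wi (Some x) (Some zz) = Den"
proof -
  assume x: "x div S \<in> {3..6}"
  then have "x \<noteq> zz" by (intro notI) simp
  moreover have "int (x div S) \<noteq> 1" "int (x div S) \<noteq> -1" "3 \<le> int (x div S)" "int (x div S) \<le> 6" using x by auto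
  ultimately show ?thesis by (simp add: wi_div_mod wn_def del: of_nat_div of_nat_mod)
qed

lemma wi_same:
  "t < S \<Longrightarrow> t' < S \<Longrightarrow> wi (Some (al t)) (Some (al t')) = (if t = t' then 0 else Den)"
  "t < S \<Longrightarrow> t' < S \<Longrightarrow> wi (Some (pp t)) (Some (pp t')) = (if t = t' then 0 else Den)"
  "t < S \<Longrightarrow> t' < S \<Longrightarrow> wi (Some (mm t)) (Some (mm t')) = (if t = t' then 0 else Den)"
  "t < S \<Longrightarrow> t' < S \<Longrightarrow> wi (Some (ee t)) (Some (ee t')) = (if t = t' then 0 else Den)"
  unfolding al_def pp_def mm_def ee_def by (simp_all add: wi_Some_Some wn_def)

lemma wi_sg_mm:
  "a \<le> r \<Longrightarrow> t \<le> T \<Longrightarrow> wi (Some (sg a)) (Some (mm t)) =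
     (if a = t mod r then Den * (1 + 3 * (int t + 1) + int h * (int (t div r) + 1)) else BIG)"
  using payload(1)[of t] payload(2)[of a] unfolding sg_def mm_def
  by (simp add: wi_Some_Some wn_def flip: zmod_int zdiv_int)

lemma wi_ta_ee:
  "i < h \<Longrightarrow> a \<le> r \<Longrightarrow> t \<le> T \<Longrightarrow> wi (Some (ta i a)) (Some (ee t)) =
     (if a = t mod r then 2 * Den + RPx (int (t mod r)) (int (t div r * h + i)) else BIG)"
proof -
  assume a: "i < h" "a \<le> r" "t \<le> T"
  define P where "P = i * (r + 1) + a"
  have "P mod (r + 1) = a" "P div (r + 1) = i"
    using a(2) mod_mult_self3[of i "r + 1" a] div_mult_self3[of "r + 1" i a] by (simp_all only: P_def) simp_all
  then have *: "int P mod (int r + 1) = int a" "int P div (int r + 1) = int i"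
    by (metis of_nat_Suc Suc_eq_plus1 add.commute zmod_int zdiv_int)+
  show ?thesis
    using payload(1)[of t] payload(5)[of i a] a unfolding ta_def ee_def P_def[symmetric]
    by (simp add: wi_Some_Some wn_def * flip: zmod_int zdiv_int)
qed

lemma wi_sg_qq:
  "a \<le> r \<Longrightarrow> b < nq \<Longrightarrow> wi (Some (sg a)) (Some (qq b)) =
     (if 1 \<le> a then 4 * Den - \<Delta> * (int b + int r + 1 - int a)
        + (QRx (int a - 1) (int b + int r + 1 - int a) - QRx (int a) (int b + int r + 1 - int a)) else BIG)"
  using payload(6)[of b] payload(2)[of a] unfolding sg_def qq_def
  by (simp add: wi_Some_Some wn_def)

lemma wi_pp_qq:
  "x < r * h \<Longrightarrow> b < nq \<Longrightarrow> wi (Some (pp x)) (Some (qq b)) = 2 * Den + PQx (int x) (int b)"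
  using payload(6)[of b] payload(4)[of x] unfolding pp_def qq_def
  by (simp add: wi_Some_Some wn_def)

lemma wi_ta_qq:
  "i < h \<Longrightarrow> a \<le> r \<Longrightarrow> b < nq \<Longrightarrow> wi (Some (ta i a)) (Some (qq b)) =
     (if 1 \<le> a then 2 * Den + \<Delta> * (int b - (int r + 1 - int a)) else BIG)"
proof -
  assume a: "i < h" "a \<le> r" "b < nq"
  define P where "P = i * (r + 1) + a"
  have "P mod (r + 1) = a" using a(2) mod_mult_self3[of i "r + 1" a] by (simp only: P_def) simp
  then have *: "int P mod (int r + 1) = int a"
    by (metis of_nat_Suc Suc_eq_plus1 add.commute zmod_int)
  show ?thesis
    using payload(6)[of b] payload(5)[of i a] a unfolding ta_def qq_def P_def[symmetric]
    by (simp add: wi_Some_Some wn_def *)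
qed

lemma wi_ta_mm: "i < h \<Longrightarrow> a \<le> r \<Longrightarrow> t \<le> T \<Longrightarrow> wi (Some (ta i a)) (Some (mm t)) = BIG"
  using payload(1)[of t] payload(5)[of i a] unfolding ta_def mm_def
  by (simp add: wi_Some_Some wn_def)

end

section \<open>Cheap alignments from negative triangles\<close>

context gadget begin

text \<open>The other parsing of \<open>Z\<close>: behind the turn the strings are out of step by
  one period, and \<open>B (t + 1)\<close> in \<open>X\<close> faces \<open>B t\<close> in
  \<open>Y\<close>.\<close>

definition "B t = U t @ V (t + 1)"
text \<open>The units paid for such a period: \<open>al\<close>, \<open>mm\<close> and
  \<open>ee\<close> always change, the \<open>h\<close> symbols \<open>pp\<close> only where the
  group changes.\<close>

definition "D t = 3 + int h * (int ((t + 1) div r) - int (t div r))"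

lemma windows_shift: "concat (map (\<lambda>t. V t @ U t) [0..<m]) @ V m = V 0 @ concat (map B [0..<m])"
  by (induction m) (auto simp: B_def)

lemma cheap_V: "t + 1 \<le> T \<Longrightarrow> cheap wi (V (t + 1)) (V t) (2 * Den)"
proof -
  assume t: "t + 1 \<le> T"
  have same: "cheap wi xs xs 0" for xs by (rule cheap_refl) simp
  have one: "cheap wi [x] [y] (wi (Some x) (Some y))" for x y
    using cheap_substitute[of "[x]" "[y]" wi] by simp
  have m: "cheap wi [mm (t + 1)] [mm t] Den"
    using one[of "mm (t + 1)" "mm t"] payload(1)[of t] payload(1)[of "t + 1"] t by (simp add: wi_same)
  have e: "cheap wi [ee (t + 1)] [ee t] Den"
    using one[of "ee (t + 1)" "ee t"] payload(1)[of t] payload(1)[of "t + 1"] t by (simp add: wi_same)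
  show ?thesis unfolding V_def
    by (rule cheap_append[OF same cheap_append[OF m cheap_append[OF same cheap_append[OF e same refl] refl] refl]]) simp
qed

lemma cheap_slot:
  assumes "t + 1 < T" "i < h"
  shows "cheap wi (slot (t + 1) i) (slot t i) (Den * (int ((t + 1) div r) - int (t div r)))"
proof (cases "(t + 1) div r = t div r")
  case True
  then have "slot (t + 1) i = slot t i" by (simp add: slot_def)
  then show ?thesis using True cheap_refl[of wi "slot t i"] by simp
next
  case False
  then have *: "1 \<le> int ((t + 1) div r) - int (t div r)"
    using div_le_mono[of t "t + 1" r] by linarith
  have same: "cheap wi xs xs 0" for xs by (rule cheap_refl) simp
  let ?x = "(t + 1) div r * h + i" and ?y = "t div r * h + i"
  have xy: "?x < S" "?y < S" using payload(3)[of "t + 1" i] payload(3)[of t i] payload(4) assms by auto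
  have "cheap wi [pp ?x] [pp ?y] (wi (Some (pp ?x)) (Some (pp ?y)))"
    using cheap_substitute[of "[pp ?x]" "[pp ?y]" wi] by simp
  moreover have "wi (Some (pp ?x)) (Some (pp ?y)) \<le> Den * 1"
    using xy Den by (simp add: wi_same)
  moreover have "Den * 1 \<le> Den * (int ((t + 1) div r) - int (t div r))"
    by (rule mult_left_mono[OF *]) (use Den in auto)
  ultimately have "cheap wi [pp ?x] [pp ?y] (Den * (int ((t + 1) div r) - int (t div r)))"
    using cheap_mono by (meson order_trans)
  then show ?thesis unfolding slot_def
    by (rule cheap_append[OF same cheap_append[OF _ same refl]]) simp
qed

lemma cheap_B:
  assumes t: "t + 1 < T"
  shows "cheap wi (B (t + 1)) (B t) (Den * D t)"
proof -
  let ?d = "Den * (int ((t + 1) div r) - int (t div r))"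
  have "cheap wi (concat (map (slot (t + 1)) [0..<m])) (concat (map (slot t) [0..<m])) (int m * ?d)" if "m \<le> h" for m
    using that
  proof (induction m)
    case 0
    then show ?case using cheap_refl[of wi "[]"] by simp
  next
    case (Suc m)
    then have "cheap wi (slot (t + 1) m) (slot t m) ?d" by (intro cheap_slot) (use t in auto)
    from cheap_append[OF Suc.IH this refl] Suc.prems show ?case
      by (simp add: distrib_right add.commute)
  qed
  from this[of h] have s: "cheap wi (concat (map (slot (t + 1)) [0..<h])) (concat (map (slot t) [0..<h])) (int h * ?d)" by simp
  have a: "cheap wi [al (t + 1)] [al t] Den"
    using cheap_substitute[of "[al (t + 1)]" "[al t]" wi] payload(1)[of t] payload(1)[of "t + 1"] t by (simp add: wi_same)
  have "cheap wi (U (t + 1)) (U t) (Den + int h * ?d)"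
    using cheap_append[OF a s refl] by (simp add: U_def)
  from cheap_append[OF this cheap_V[of "t + 1"] refl] show ?thesis
    using t by (simp add: B_def D_def algebra_simps)
qed

text \<open>The only \<open>al\<close> in this block is \<open>al (T - 1)\<close>, the one that junk
  may become.\<close>

lemma cheap_tail:
  assumes "0 < T"
  shows "cheap wi (replicate wsz jj) (B (T - 1)) (int wsz * Den)"
proof -
  have len: "length (B (T - 1)) = wsz" by (simp add: B_def wsz_def)
  have "wi (Some jj) (Some y) = Den" if "y \<in> set (B (T - 1))" for y
  proof (rule wi_J)
    have "y \<in> set (U (T - 1)) \<or> y \<in> set (V T)" using that assms by (auto simp: B_def)
    then show "y div S \<noteq> 1" using set_U[of "T - 1" y] set_V[of T y] assms by auto
    assume k: "y div S = 3"
    then have "y \<in> set (U (T - 1))" using \<open>y \<in> set (U (T - 1)) \<or> y \<in> set (V T)\<close> set_V[of T y] by auto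
    moreover have "y \<notin> set (slot (T - 1) i)" if "i < h" for i
      using set_slot[of "T - 1" i y] that k assms by auto
    ultimately have "y = 3 * S + (T - 1)" by (auto simp: U_def al_def)
    then show "y mod S + 1 = T" using payload(1)[of "T - 1"] assms by (simp only: mod_mult_self3) simp
  qed
  then have "(\<Sum>i<wsz. wi (Some (replicate wsz jj ! i)) (Some (B (T - 1) ! i))) = int wsz * Den"
    using len by simp
  then show ?thesis using cheap_substitute[of "replicate wsz jj" "B (T - 1)" wi] len by simp
qed

lemma cheap_blocks:
  assumes "m < T"
  shows "t \<le> m \<Longrightarrow> cheap wi (concat (map B [t+1..<m+1])) (concat (map B [t..<m])) (Den * (\<Sum>s=t..<m. D s))"
  using assms
proof (induction m)
  case 0
  then show ?case using cheap_refl[of wi "[]"] by simp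
next
  case (Suc m)
  show ?case
  proof (cases "t = Suc m")
    case True
    then show ?thesis using cheap_refl[of wi "[]"] by simp
  next
    case False
    then have "t \<le> m" using Suc.prems by simp
    then have "cheap wi (concat (map B [t+1..<m+1]) @ B (m + 1)) (concat (map B [t..<m]) @ B m) (Den * (\<Sum>s=t..<Suc m. D s))"
      by (intro cheap_append[OF Suc.IH cheap_B]) (use Suc.prems in \<open>auto simp: algebra_simps\<close>)
    then show ?thesis using \<open>t \<le> m\<close> by simp
  qed
qed

lemma sum_D: "t \<le> m \<Longrightarrow> (\<Sum>s=t..<m. D s) = 3 * (int m - int t) + int h * (int (m div r) - int (t div r))"
proof (induction m)
  case (Suc m)
  then show ?case by (cases "t = Suc m") (auto simp: D_def algebra_simps)
qed simp

text \<open>The units do not depend on \<open>v\<close>. Each pair of \<open>sg\<close> and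
  \<open>ta\<close> facing candidates saves two filler substitutions, two insertions and two
  deletions, and is charged \<open>4 + 2\<close> units instead. Likewise \<open>sg v\<close>,
  \<open>pp p\<close> and \<open>ta i v\<close> are charged \<open>1 + 2 + 2\<close>, apart from the
  surcharge, for three filler substitutions, one insertion and one deletion.\<close>

lemma cheap_turn:
  assumes v: "v < r" and p: "p < sP" and q: "q < sQ" and i: "i < h" and t: "t div r * h + i = p" "t mod r = v" "t < T"
  shows "cheap wi (V t @ U t @ V (t + 1)) (V t)
    (Den * (int wsz + int u + 2 * int nq + 3 * (int t + 1) + int h * (int (t div r) + 1))
      + PQ p q + QR q v + RP v p)"
proof -
  \<comment> \<open>The number of \<open>sg\<close> symbols behind \<open>sg v\<close> in the slot,
    and so the number of candidates used on either side of \<open>q\<close>.\<close>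
  define L where "L = r - v"
  define \<beta> where "\<beta> = r + q"
  have \<beta>: "L \<le> \<beta>" "\<beta> + L + 1 \<le> nq" using v q sQ by (auto simp: L_def \<beta>_def nq_def)
  have ph: "p < r * h" using payload(3)[of t i] i t by simp
  define Ua where "Ua = al t # concat (map (slot t) [0..<i]) @ map sg [0..<v]"
  define Ub where "Ub = rev (map (ta i) [0..<v]) @ concat (map (slot t) [i+1..<h])"
  define Ca where "Ca = map sg [v+1..<r+1]"
  define Cb where "Cb = rev (map (ta i) [v+1..<r+1])"
  have up: "[0..<h] = [0..<i] @ i # [i+1..<h]" "[0..<r+1] = [0..<v] @ v # [v+1..<r+1]"
    using i v upt_add_eq_append[of 0 i "h - i"] upt_conv_Cons[of i h] upt_add_eq_append[of 0 v "r + 1 - v"] upt_conv_Cons[of v "r+1"]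
    by (auto simp del: upt_Suc)
  have sl: "slot t i = map sg [0..<v] @ [sg v] @ Ca @ [pp p] @ Cb @ [ta i v] @ rev (map (ta i) [0..<v])"
    by (simp only: slot_def up(2) Ca_def Cb_def map_append list.map rev_append rev.simps append_assoc append.simps t)
  have Ut: "U t = Ua @ [sg v] @ Ca @ [pp p] @ Cb @ [ta i v] @ Ub"
    unfolding U_def up(1) Ua_def Ub_def by (simp add: sl del: upt_Suc)
  have lenC: "length Ca = L" "length Cb = L" using v by (auto simp: Ca_def Cb_def L_def simp del: upt_Suc)
  have "length (U t) = length Ua + length Ub + 2 * L + 3" unfolding Ut using lenC by simp
  then have lenU: "length Ua + length Ub + 2 * L + 3 = u" by simp
  then have lenN: "length Ua \<le> N" "length Ub \<le> N" by (auto simp: N_def u_def)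
  have del: "cheap wi xs [] (Den * int (length xs))" if "\<And>x. x \<in> set xs \<Longrightarrow> x div S = 0 \<or> 7 \<le> x div S" for xs
    by (rule cheap_delete) (use that in \<open>simp add: wi_delete\<close>)
  have ins: "cheap wi [] (map qq bs) (Den * int (length bs))" if "\<And>b. b \<in> set bs \<Longrightarrow> b < nq" for bs
  proof -
    have "wi None (Some y) \<le> Den" if "y \<in> set (map qq bs)" for y
      using that \<open>\<And>b. b \<in> set bs \<Longrightarrow> b < nq\<close> by (auto simp: wi_insert kind)
    from cheap_insert[of "map qq bs" wi Den, OF this] show ?thesis by simp
  qed
  have zs: "cheap wi xs (replicate (length xs) zz) (Den * int (length xs))" if "\<And>x. x \<in> set xs \<Longrightarrow> x div S \<in> {3..6}" for xs
  proof -
    have "(\<Sum>j<length xs. wi (Some (xs ! j)) (Some (replicate (length xs) zz ! j))) = (\<Sum>j<length xs. Den)"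
      by (rule sum.cong) (use that in \<open>auto simp: wi_zz\<close>)
    then show ?thesis using cheap_substitute[of xs "replicate (length xs) zz" wi] by (simp add: mult.commute)
  qed
  have same: "cheap wi xs xs 0" for xs by (rule cheap_refl) simp
  have one: "cheap wi [x] [y] (wi (Some x) (Some y))" for x y
    using cheap_substitute[of "[x]" "[y]" wi] by simp

  have kU: "x div S \<in> {3..6}" if "x \<in> set (U t)" for x using set_U[OF t(3) that] by simp
  have za: "cheap wi Ua (replicate (length Ua) zz) (Den * int (length Ua))"
    by (rule zs) (rule kU, simp add: Ut)
  have zb: "cheap wi Ub (replicate (length Ub) zz) (Den * int (length Ub))"
    by (rule zs) (rule kU, simp add: Ut)
  have m: "cheap wi [sg v] [mm t] (Den * (1 + 3 * (int t + 1) + int h * (int (t div r) + 1)))"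
    using one[of "sg v" "mm t"] v t by (simp add: wi_sg_mm)
  have e: "cheap wi [ta i v] [ee t] (2 * Den + RP v p)"
    using one[of "ta i v" "ee t"] v t i p by (simp add: wi_ta_ee RPx_def)
  have pq: "cheap wi [pp p] [qq \<beta>] (2 * Den + PQ p q)"
    using one[of "pp p" "qq \<beta>"] \<beta> ph p q by (simp add: wi_pp_qq PQx_def \<beta>_def)
  \<comment> \<open>The potential refers each \<open>sg a\<close> to the candidate that
    \<open>p\<close> would face; here this is \<open>\<beta>\<close> throughout, so the differences
    telescope from \<open>v\<close> to \<open>r\<close>.\<close>
  have ca: "cheap wi Ca (map qq [\<beta>-L..<\<beta>]) (int L * (4 * Den - \<Delta> * int \<beta>) + QR q v)"
  proof -
    have "(\<Sum>l<L. wi (Some (Ca ! l)) (Some (map qq [\<beta>-L..<\<beta>] ! l))) =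
        (\<Sum>l<L. (4 * Den - \<Delta> * int \<beta>) + (QRx (int (v + l)) (int \<beta>) - QRx (int (v + Suc l)) (int \<beta>)))"
    proof (rule sum.cong[OF refl])
      fix l assume "l \<in> {..<L}"
      then have l: "l < L" by simp
      have g: "int (\<beta> - L + l) + int r + 1 - int (v + 1 + l) = int \<beta>" "int (v + 1 + l) - 1 = int (v + l)"
        using \<beta> v by (auto simp: L_def of_nat_diff)
      have "Ca ! l = sg (v + 1 + l)" "map qq [\<beta>-L..<\<beta>] ! l = qq (\<beta> - L + l)"
        using l \<beta> by (auto simp: Ca_def L_def simp del: upt_Suc)
      moreover have "v + 1 + l \<le> r" "\<beta> - L + l < nq" using l \<beta> v by (auto simp: L_def)
      ultimately show "wi (Some (Ca ! l)) (Some (map qq [\<beta>-L..<\<beta>] ! l)) =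
          (4 * Den - \<Delta> * int \<beta>) + (QRx (int (v + l)) (int \<beta>) - QRx (int (v + Suc l)) (int \<beta>))"
        by (simp only: wi_sg_qq g) simp
    qed
    also have "\<dots> = int L * (4 * Den - \<Delta> * int \<beta>) + (QRx (int v) (int \<beta>) - QRx (int (v + L)) (int \<beta>))"
      using sum_lessThan_telescope'[of "\<lambda>l. QRx (int (v + l)) (int \<beta>)" L] by (simp add: sum.distrib)
    also have "QRx (int v) (int \<beta>) = QR q v" using v q by (simp add: QRx_def \<beta>_def)
    also have "QRx (int (v + L)) (int \<beta>) = 0" using v by (simp add: QRx_def L_def)
    finally show ?thesis using cheap_substitute[of Ca "map qq [\<beta>-L..<\<beta>]" wi] lenC \<beta> by simp
  qed
  have cb: "cheap wi Cb (map qq [\<beta>+1..<\<beta>+L+1]) (int L * (2 * Den + \<Delta> * int \<beta>))"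
  proof -
    have "(\<Sum>l<L. wi (Some (Cb ! l)) (Some (map qq [\<beta>+1..<\<beta>+L+1] ! l))) = (\<Sum>l<L. 2 * Den + \<Delta> * int \<beta>)"
    proof (rule sum.cong[OF refl])
      fix l assume "l \<in> {..<L}"
      then have l: "l < L" by simp
      have g: "int (\<beta> + 1 + l) - (int r + 1 - int (r - l)) = int \<beta>" "1 \<le> r - l" "r - l \<le> r" "\<beta> + 1 + l < nq"
        using \<beta> v l by (auto simp: L_def of_nat_diff)
      have "Cb ! l = ta i (r - l)" "map qq [\<beta>+1..<\<beta>+L+1] ! l = qq (\<beta> + 1 + l)"
        using l \<beta> by (auto simp: Cb_def L_def rev_nth Suc_diff_Suc simp del: upt_Suc)
      then show "wi (Some (Cb ! l)) (Some (map qq [\<beta>+1..<\<beta>+L+1] ! l)) = 2 * Den + \<Delta> * int \<beta>"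
        using wi_ta_qq[OF i g(3) g(4)] g(1,2) by simp
    qed
    then show ?thesis using cheap_substitute[of Cb "map qq [\<beta>+1..<\<beta>+L+1]" wi] lenC \<beta> by simp
  qed
  have i1: "cheap wi [] (map qq [0..<\<beta>-L]) (Den * int (\<beta> - L))"
    using ins[of "[0..<\<beta>-L]"] \<beta> by simp
  have i2: "cheap wi [] (map qq [\<beta>+L+1..<nq]) (Den * int (nq - (\<beta> + L + 1)))"
    using ins[of "[\<beta>+L+1..<nq]"] by (simp del: upt_Suc)

  define a b where "a = length Ua" and "b = length Ub"
  have Qs: "map qq [0..<nq] = map qq [0..<\<beta>-L] @ map qq [\<beta>-L..<\<beta>] @ [qq \<beta>] @ map qq [\<beta>+1..<\<beta>+L+1] @ map qq [\<beta>+L+1..<nq]"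
  proof -
    have "[0..<nq] = [0..<\<beta>-L] @ [\<beta>-L..<\<beta>] @ [\<beta>] @ [\<beta>+1..<\<beta>+L+1] @ [\<beta>+L+1..<nq]"
    proof -
      have split: "[i..<k] = [i..<j] @ [j..<k]" if "i \<le> j" "j \<le> k" for i j k :: nat
        using upt_add_eq_append[of i j "k - j"] that by simp
      have "[0..<nq] = [0..<\<beta>-L] @ [\<beta>-L..<nq]" "[\<beta>-L..<nq] = [\<beta>-L..<\<beta>] @ [\<beta>..<nq]" "[\<beta>..<nq] = [\<beta>..<\<beta>+1] @ [\<beta>+1..<nq]"
        "[\<beta>+1..<nq] = [\<beta>+1..<\<beta>+L+1] @ [\<beta>+L+1..<nq]" "[\<beta>..<\<beta>+1] = [\<beta>]"
        by (rule split; use \<beta> in simp)+ simp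
      then show ?thesis by (simp only:)
    qed
    then show ?thesis by (metis map_append list.simps(8,9))
  qed
  \<comment> \<open>Of \<open>V t\<close> in \<open>X\<close> only \<open>N - a\<close> leading
    fillers are kept; the other \<open>a\<close> leading fillers of \<open>Y\<close> take the
    symbols before \<open>sg v\<close>. At the right end \<open>D2\<close> mirrors this in
    \<open>V (t + 1)\<close>.\<close>
  define D1 where "D1 = replicate a zz @ [mm t] @ map qq [0..<nq] @ [ee t] @ replicate N zz"
  define D2 where "D2 = replicate N zz @ [mm (t + 1)] @ map qq [0..<nq] @ [ee (t + 1)] @ replicate b zz"
  have d1: "cheap wi D1 [] (Den * int (length D1))" and d2: "cheap wi D2 [] (Den * int (length D2))"
    by (rule del; use t in \<open>auto simp: D1_def D2_def kind simp del: upt_Suc\<close>)+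
  have rep: "replicate N zz = replicate (N - a) zz @ replicate a zz" "replicate N zz = replicate b zz @ replicate (N - b) zz"
    using lenN by (simp_all add: a_def b_def flip: replicate_add)
  \<comment> \<open>The empty lists mark the places where only the other string has a
    segment.\<close>
  have X: "V t @ U t @ V (t + 1) = replicate (N - a) zz @ D1 @ Ua @ [sg v] @ [] @ Ca @ [pp p] @ Cb @ [] @ [ta i v] @ Ub
      @ D2 @ replicate (N - b) zz"
  proof -
    have "V t = replicate (N - a) zz @ D1"
      unfolding V_def D1_def by (subst (1) rep(1)) (simp only: append_assoc)
    moreover have "V (t + 1) = D2 @ replicate (N - b) zz"
      unfolding V_def D2_def by (subst (2) rep(2)) (simp only: append_assoc)
    ultimately show ?thesis unfolding Ut by simp
  qed
  have Y: "V t = replicate (N - a) zz @ [] @ replicate a zz @ [mm t] @ map qq [0..<\<beta>-L] @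
      map qq [\<beta>-L..<\<beta>] @ [qq \<beta>] @ map qq [\<beta>+1..<\<beta>+L+1] @ map qq [\<beta>+L+1..<nq] @ [ee t] @ replicate b zz
      @ [] @ replicate (N - b) zz"
    unfolding V_def Qs by (subst (1) rep(1), subst (1) rep(2)) (simp only: append_assoc append.simps)
  have len: "int (length D1) + int (length D2) = int wsz + int nq - (2 * int L + 1)"
  proof -
    have "length D1 + length D2 + 2 * L + 1 = wsz + nq"
      using lenU unfolding D1_def D2_def wsz_def vl_def a_def b_def by (simp add: N_def u_def)
    then show ?thesis by linarith
  qed
  have lab: "int a + int b = int u - 2 * int L - 3" using lenU by (simp add: a_def b_def)
  have lq: "int (\<beta> - L) + int (nq - (\<beta> + L + 1)) = int nq - (2 * int L + 1)" using \<beta> by simp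
  have "Den * int (length D1) + Den * int a + Den * int (\<beta> - L) + Den * int (nq - (\<beta> + L + 1)) + Den * int b + Den * int (length D2)
     = Den * ((int (length D1) + int (length D2)) + (int a + int b) + (int (\<beta> - L) + int (nq - (\<beta> + L + 1))))"
    by (simp only: distrib_left)
  also have "\<dots> = Den * (int wsz + int u + 2 * int nq - 6 * int L - 5)"
    unfolding len lab lq by (simp add: algebra_simps)
  finally have tot: "Den * int (length D1) + Den * int a + Den * int (\<beta> - L) + Den * int (nq - (\<beta> + L + 1)) + Den * int b + Den * int (length D2)
     = Den * (int wsz + int u + 2 * int nq - 6 * int L - 5)" .
  show ?thesis
    unfolding X unfolding Y
    apply (rule cheap_append[OF same cheap_append[OF d1 cheap_append[OF za[folded a_def] cheap_append[OF m
      cheap_append[OF i1 cheap_append[OF ca cheap_append[OF pq cheap_append[OF cb cheap_append[OF i2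
      cheap_append[OF e cheap_append[OF zb[folded b_def] cheap_append[OF d2 same refl] refl] refl]
      refl] refl] refl] refl] refl] refl] refl] refl]])
    using tot by (simp add: algebra_simps)
qed

lemma cheap_negative:
  assumes p: "p < sP" and q: "q < sQ" and v: "v < r" and neg: "PQ p q + QR q v + RP v p < 0"
  shows "cheap wi X Y (K * Den - 1)"
proof -
  \<comment> \<open>Division by \<open>h\<close> yields the group of \<open>p\<close> and its slot;
    period \<open>t\<close> pairs this group with \<open>v\<close>.\<close>
  define c where "c = p div h"
  define i where "i = p mod h"
  define t where "t = c * r + v"
  have h0: "0 < h" by (simp add: h_def)
  have r0: "0 < r" using v by simp
  have c: "c < r"
  proof -
    have "p < r * h" using p sP hr[OF r0] by simp
    then show ?thesis unfolding c_def using less_mult_imp_div_less by blast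
  qed
  have i: "i < h" using h0 by (simp add: i_def)
  have td: "t div r = c" "t mod r = v" using v by (simp_all add: t_def)
  have pi: "c * h + i = p" by (simp only: c_def i_def div_mult_mod_eq)
  have "t < (c + 1) * r" using v by (simp add: t_def)
  also have "\<dots> \<le> T" unfolding T_def using c by (intro mult_le_mono1) simp
  finally have t: "t < T" .
  define P where "P = concat (map (\<lambda>t. V t @ U t) [0..<t])"
  define R where "R = concat (map B [t+1..<T])"
  have Z: "Z = P @ V t @ B t @ R"
  proof -
    have "Z = V 0 @ concat (map B [0..<T])" unfolding Z_def by (rule windows_shift)
    also have "[0..<T] = [0..<t] @ t # [t+1..<T]" using t upt_add_eq_append[of 0 t "T - t"] upt_conv_Cons[of t T] by simp
    also have "V 0 @ concat (map B ([0..<t] @ t # [t+1..<T])) = (V 0 @ concat (map B [0..<t])) @ B t @ R"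
      by (simp add: R_def)
    also have "V 0 @ concat (map B [0..<t]) = P @ V t" unfolding P_def by (rule windows_shift[symmetric])
    finally show ?thesis by simp
  qed
  have BR: "B t @ R = concat (map B [t..<T-1]) @ B (T - 1)"
  proof -
    have "[t..<T] = t # [t+1..<T]" using t upt_conv_Cons[of t T] by simp
    moreover have "[t..<T] = [t..<T-1] @ [T-1]" using t by (metis Suc_diff_1 upt_Suc_append less_imp_Suc_add Suc_pred' gr_implies_not0 le_Suc_eq less_Suc_eq_le not_gr_zero nat_neq_iff)
    ultimately have "concat (map B (t # [t+1..<T])) = concat (map B ([t..<T-1] @ [T-1]))" by simp
    then show ?thesis by (simp add: R_def)
  qed
  have same: "cheap wi xs xs 0" for xs by (rule cheap_refl) simp
  have turn: "cheap wi (V t @ U t @ V (t + 1)) (V t)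
    (Den * (int wsz + int u + 2 * int nq + 3 * (int t + 1) + int h * (int (t div r) + 1)) + PQ p q + QR q v + RP v p)"
    by (rule cheap_turn) (use p q v i t td pi in auto)
  have R1: "cheap wi R (concat (map B [t..<T-1])) (Den * (\<Sum>s=t..<T-1. D s))"
    using cheap_blocks[of "T - 1" t] t by (simp add: R_def)
  have ins: "cheap wi [] (replicate wsz jj) (Den * int wsz)"
    using cheap_insert[of "replicate wsz jj" wi Den] S_pos by (simp add: wi_insert)
  have sD: "(\<Sum>s=t..<T-1. D s) = 3 * (int T - 1 - int t) + int h * (int r - 1 - int c)"
  proof -
    have "(T - 1) div r = r - 1"
    proof -
      have "T - 1 = (r - 1) * r + (r - 1)" unfolding T_def using r0 by (cases r) simp_all
      then show ?thesis using r0 div_mult_self3[of r "r - 1" "r - 1"] by (simp only:) simp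
    qed
    then show ?thesis using sum_D[of t "T - 1"] t r0 td by (simp add: of_nat_diff)
  qed
  have X: "X = P @ (V t @ U t @ V (t + 1)) @ R @ replicate wsz jj @ [hh] @ []"
    by (simp add: X_def Z B_def)
  have Y: "Y = P @ V t @ concat (map B [t..<T-1]) @ B (T - 1) @ [hh] @ replicate wsz jj"
    using BR by (simp add: Y_def Z)
  have "cheap wi X Y ((Den * (int wsz + int u + 2 * int nq + 3 * (int t + 1) + int h * (int (t div r) + 1)) + PQ p q + QR q v + RP v p)
     + (Den * (\<Sum>s=t..<T-1. D s) + (int wsz * Den + Den * int wsz)))"
    unfolding X Y
    by (rule cheap_append[OF same cheap_append[OF turn cheap_append[OF R1 cheap_append[OF cheap_tail cheap_append[OF same ins refl] refl] refl] refl]])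
      (use t in auto)
  then show ?thesis
  proof (rule cheap_mono)
    show "(Den * (int wsz + int u + 2 * int nq + 3 * (int t + 1) + int h * (int (t div r) + 1)) + PQ p q + QR q v + RP v p)
     + (Den * (\<Sum>s=t..<T-1. D s) + (int wsz * Den + Den * int wsz)) \<le> K * Den - 1"
      \<comment> \<open>The surcharge paid at the turn and the cost of the later periods complement
        each other to \<open>3 * T + h * r\<close>; the negative sum provides the final
        \<open>- 1\<close>.\<close>
      unfolding sD td K_def using neg by (simp add: algebra_simps)
  qed
qed

end

section \<open>Negative triangles from cheap alignments\<close>

context gadget begin

text \<open>The position of \<open>al t\<close> in \<open>Z\<close>, which serves as landmark of
  period \<open>t\<close> in both strings.\<close>

definition "A t = t * wsz + vl"

lemma vu: "vl < wsz" "0 < u" "u \<le> wsz" "u = N + 1" "N < vl" "N + 1 + nq < vl" "vl = N + 2 + nq + N" "wsz = vl + u"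
  by (auto simp: wsz_def u_def vl_def N_def)

lemma A_less [simp]: "A t < A t' \<longleftrightarrow> t < t'" and A_inj [simp]: "A t = A t' \<longleftrightarrow> t = t'"
proof -
  have "0 < wsz" using vu by simp
  then show "A t < A t' \<longleftrightarrow> t < t'" "A t = A t' \<longleftrightarrow> t = t'" by (simp_all add: A_def)
qed

lemma A_T: "A T = length Z" "A (t + 1) = A t + wsz"
  by (simp_all add: A_def length_Z)

lemma nth_Z_A: "t < T \<Longrightarrow> j < u \<Longrightarrow> Z ! (A t + j) = U t ! j"
  using nth_Z(2)[of t j] by (simp add: A_def)

lemma A_bound: "t < T \<Longrightarrow> A t + wsz \<le> length Z"
proof -
  assume "t < T"
  then have "(t + 1) * wsz \<le> T * wsz" by (intro mult_le_mono1) simp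
  then show ?thesis by (simp add: A_def length_Z)
qed

lemma Z_position:
  assumes "x < length Z"
  obtains (V) t j where "t \<le> T" "j < vl" "x = t * wsz + j" "Z ! x = V t ! j"
    | (U) t j where "t < T" "j < u" "x = A t + j" "Z ! x = U t ! j"
proof -
  define t where "t = x div wsz"
  define j where "j = x mod wsz"
  have w: "0 < wsz" using vu by simp
  have x: "x = t * wsz + j" "j < wsz" using w by (simp_all only: t_def j_def div_mult_mod_eq mod_less_divisor)
  have tT: "t \<le> T"
  proof (rule ccontr)
    assume "\<not> t \<le> T"
    then have "(T + 1) * wsz \<le> t * wsz" by (intro mult_le_mono1) simp
    then show False using assms x vu by (simp add: length_Z)
  qed
  show thesis
  proof (cases "j < vl")
    case True
    then show thesis using V[of t j] nth_Z(1)[of t j] tT x by simp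
  next
    case False
    have "t \<noteq> T" using assms False x by (auto simp: length_Z)
    then show thesis using U[of t "j - vl"] nth_Z_A[of t "j - vl"] False tT x vu by (simp add: A_def)
  qed
qed

lemma U_position:
  assumes "j < u"
  obtains (al) "j = 0" "U t ! j = al t"
    | (sg) i a where "i < h" "a \<le> r" "j = 1 + (i * sl + a)" "U t ! j = sg a"
    | (pp) i where "i < h" "j = 1 + (i * sl + (r + 1))" "U t ! j = pp (t div r * h + i)"
    | (ta) i a where "i < h" "a \<le> r" "j = 1 + (i * sl + (2 * r + 2 - a))" "U t ! j = ta i a"
proof (cases "j = 0")
  case True
  then show thesis using al nth_U(1) by simp
next
  case False
  define i where "i = (j - 1) div sl"
  define k where "k = (j - 1) mod sl"
  have sl: "0 < sl" by (simp add: sl_def)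
  have j: "j = 1 + (i * sl + k)" "k < sl" using False sl by (simp_all add: i_def k_def)
  have i: "i < h"
  proof (rule ccontr)
    assume "\<not> i < h"
    then have "h * sl \<le> i * sl" by (intro mult_le_mono1) simp
    then show False using assms j unfolding u_def by linarith
  qed
  have Uj: "U t ! j = slot t i ! k" using nth_U(2)[of i k t] i j by simp
  consider "k \<le> r" | "k = r + 1" | "r + 2 \<le> k" by linarith
  then show thesis
  proof cases
    case 1
    then show thesis using sg[of i k] i j Uj nth_slot(1)[of k t i] by simp
  next
    case 2
    then show thesis using pp[of i] i j Uj nth_slot(2)[of t i] by simp
  next
    case 3
    then have "2 * r + 2 - (2 * r + 2 - k) = k" "2 * r + 2 - k \<le> r" using j by (auto simp: sl_def)
    then show thesis using ta[of i "2 * r + 2 - k"] i j Uj nth_slot(3)[of "2 * r + 2 - k" t i] by simp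
  qed
qed

lemma V_position:
  assumes "j < vl"
  obtains (z) "j < N \<or> N + 2 + nq \<le> j" "V t ! j = zz"
    | (mm) "j = N" "V t ! j = mm t"
    | (qq) b where "b < nq" "j = N + 1 + b" "V t ! j = qq b"
    | (ee) "j = N + 1 + nq" "V t ! j = ee t"
proof -
  consider "j < N" | "j = N" | "N < j" "j < N + 1 + nq" | "j = N + 1 + nq" | "N + 2 + nq \<le> j" by linarith
  then show thesis
  proof cases
    case 1
    then show thesis using z nth_V(1) by simp
  next
    case 2
    then show thesis using mm nth_V(2) by simp
  next
    case 3
    then show thesis using qq[of "j - N - 1"] nth_V(3)[of "j - N - 1" t] by simp
  next
    case 4
    then show thesis using ee nth_V(4) by simp
  next
    case 5
    define k where "k = j - (N + 2 + nq)"
    have k: "j = N + 2 + nq + k" "k < N" using 5 assms vu(7) by (auto simp: k_def)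
    show thesis using z nth_V(5)[OF k(2), of t] 5 unfolding k(1) by blast
  qed
qed

lemma kind_U: "t < T \<Longrightarrow> j < u \<Longrightarrow> U t ! j div S \<in> {3..6}"
  using set_U[of t "U t ! j"] by simp

lemma kind_V: "t \<le> T \<Longrightarrow> j < vl \<Longrightarrow> V t ! j div S \<in> {0, 7, 8, 9}"
  using set_V[of t "V t ! j"] by simp

lemma pp_bound: "t < T \<Longrightarrow> i < h \<Longrightarrow> pp (t div r * h + i) div S = 5"
  using payload(3) kind(6) by simp

text \<open>Each \<open>al t\<close>, \<open>mm t\<close> and \<open>ee t\<close> has a single place
  in \<open>Z\<close>, so two equal ones can face each other only on the main diagonal.\<close>

lemma occurrence:
  assumes "x < length Z"
  shows "Z ! x div S = 3 \<Longrightarrow> \<exists>t<T. x = A t \<and> Z ! x = al t"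
    and "Z ! x div S = 5 \<Longrightarrow> \<exists>t<T. \<exists>i<h. x = A t + (1 + (i * sl + (r + 1))) \<and> Z ! x = pp (t div r * h + i)"
    and "Z ! x div S = 8 \<Longrightarrow> \<exists>t\<le>T. x = t * wsz + N \<and> Z ! x = mm t"
    and "Z ! x div S = 9 \<Longrightarrow> \<exists>t\<le>T. x = t * wsz + (N + 1 + nq) \<and> Z ! x = ee t"
    and "Z ! x div S = 0 \<Longrightarrow> \<exists>t\<le>T. \<exists>j<vl. x = t * wsz + j \<and> (j < N \<or> N + 2 + nq \<le> j)"
proof -
  note [simp] = kind pp_bound
  show "Z ! x div S = 3 \<Longrightarrow> \<exists>t<T. x = A t \<and> Z ! x = al t"
    using assms
  proof (cases rule: Z_position)
    case (V t j)
    assume "Z ! x div S = 3"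
    then show ?thesis using V kind_V[of t j] by auto
  next
    case (U t j)
    assume "Z ! x div S = 3"
    then show ?thesis using U(1,3,4) by (cases rule: U_position[OF U(2), of t]) auto
  qed
  show "Z ! x div S = 5 \<Longrightarrow> \<exists>t<T. \<exists>i<h. x = A t + (1 + (i * sl + (r + 1))) \<and> Z ! x = pp (t div r * h + i)"
    using assms
  proof (cases rule: Z_position)
    case (V t j)
    assume "Z ! x div S = 5"
    then show ?thesis using V kind_V[of t j] by auto
  next
    case (U t j)
    assume "Z ! x div S = 5"
    then show ?thesis using U(1,3,4) by (cases rule: U_position[OF U(2), of t]) auto
  qed
  have *: False if "x = A t + j" "t < T" "j < u" "Z ! x = U t ! j" "Z ! x div S \<in> {0, 8, 9}" for t j
    using kind_U[of t j] that by auto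
  show "Z ! x div S = 8 \<Longrightarrow> \<exists>t\<le>T. x = t * wsz + N \<and> Z ! x = mm t"
    using assms
  proof (cases rule: Z_position)
    case (V t j)
    assume "Z ! x div S = 8"
    then show ?thesis using V(1,3,4) by (cases rule: V_position[OF V(2), of t]) auto
  qed (use * in auto)
  show "Z ! x div S = 9 \<Longrightarrow> \<exists>t\<le>T. x = t * wsz + (N + 1 + nq) \<and> Z ! x = ee t"
    using assms
  proof (cases rule: Z_position)
    case (V t j)
    assume "Z ! x div S = 9"
    then show ?thesis using V(1,3,4) by (cases rule: V_position[OF V(2), of t]) auto
  qed (use * in auto)
  show "Z ! x div S = 0 \<Longrightarrow> \<exists>t\<le>T. \<exists>j<vl. x = t * wsz + j \<and> (j < N \<or> N + 2 + nq \<le> j)"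
    using assms
  proof (cases rule: Z_position)
    case (V t j)
    assume "Z ! x div S = 0"
    then show ?thesis using V(1,2,3,4) by (cases rule: V_position[OF V(2), of t]) auto
  qed (use * in auto)
qed

lemma nth_XY:
  "x < length Z \<Longrightarrow> X ! x = Z ! x" "j < wsz \<Longrightarrow> X ! (length Z + j) = jj" "X ! (length Z + wsz) = hh"
  "x < length Z \<Longrightarrow> Y ! x = Z ! x" "Y ! length Z = hh" "j < wsz \<Longrightarrow> Y ! (length Z + 1 + j) = jj"
  by (simp_all add: X_def Y_def nth_append)

lemma length_XY: "length X = length Z + wsz + 1" "length Y = length Z + wsz + 1"
  by (simp_all add: X_def Y_def)

lemma kind_Z: "x < length Z \<Longrightarrow> Z ! x div S \<le> 9 \<and> Z ! x div S \<noteq> 1 \<and> Z ! x div S \<noteq> 2"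
  using set_Z[of "Z ! x"] by simp

lemma X_Z: "x < length X \<Longrightarrow> X ! x div S \<noteq> 1 \<Longrightarrow> X ! x div S \<noteq> 2 \<Longrightarrow> x < length Z"
  and X_le9: "x < length X \<Longrightarrow> X ! x div S \<le> 9"
  and X_J: "x < length X \<Longrightarrow> X ! x div S = 1 \<Longrightarrow> X ! x = jj"
  and Y_hh: "x < length X \<Longrightarrow> Y ! x = hh \<Longrightarrow> x = length Z"
proof -
  assume x: "x < length X"
  have c: "x < length Z \<or> (\<exists>j<wsz. x = length Z + j) \<or> x = length Z + wsz"
  proof (cases "x < length Z")
    case False
    then obtain j where j: "x = length Z + j" using le_Suc_ex by (metis linorder_not_less)
    then have "j < wsz \<or> j = wsz" using x length_XY by linarith
    then show ?thesis using j by auto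
  qed simp
  then have c': "x < length Z \<and> X ! x = Z ! x \<or> X ! x = jj \<or> x = length Z + wsz \<and> X ! x = hh"
    using nth_XY(1,2,3) by auto
  show "X ! x div S \<noteq> 1 \<Longrightarrow> X ! x div S \<noteq> 2 \<Longrightarrow> x < length Z" using c' kind(2,3) by auto
  show "X ! x div S \<le> 9" using c' kind_Z[of x] kind(2,3) by auto
  show "X ! x div S = 1 \<Longrightarrow> X ! x = jj" using c' kind_Z[of x] kind(2,3) by auto
  have "x < length Z \<or> x = length Z \<or> (\<exists>j<wsz. x = length Z + 1 + j)"
  proof (cases "x \<le> length Z")
    case False
    then obtain j where j: "x = length Z + 1 + j" using le_Suc_ex by (metis Suc_eq_plus1 not_less_eq_eq)
    then have "j < wsz" using x length_XY by linarith
    then show ?thesis using j by auto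
  qed auto
  then have "x < length Z \<and> Y ! x = Z ! x \<or> Y ! x = jj \<or> x = length Z" using nth_XY(4,6) by auto
  moreover have "jj \<noteq> hh" using S_pos by simp
  ultimately show "Y ! x = hh \<Longrightarrow> x = length Z" using kind_Z[of x] kind(3) by metis
qed

lemma sum_lessThan_add:
  fixes f :: "nat \<Rightarrow> int"
  shows "(\<Sum>y<a + b. f y) = (\<Sum>y<a. f y) + (\<Sum>j<b. f (a + j))"
  by (induction b) auto

lemma sum_blocks:
  fixes f :: "nat \<Rightarrow> int"
  shows "(\<Sum>y<a + m * w. f y) = (\<Sum>y<a. f y) + (\<Sum>t<m. \<Sum>j<w. f (a + t * w + j))"
proof (induction m)
  case (Suc m)
  have "(\<Sum>y<a + Suc m * w. f y) = (\<Sum>y<(a + m * w) + w. f y)" by (simp add: algebra_simps)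
  also have "\<dots> = (\<Sum>y<a + m * w. f y) + (\<Sum>j<w. f (a + m * w + j))" by (rule sum_lessThan_add)
  finally show ?case using Suc by simp
qed simp

lemma strict_mono_gap:
  fixes F :: "nat \<Rightarrow> nat"
  assumes "\<And>i j. i < j \<Longrightarrow> j < m \<Longrightarrow> F i < F j" "i + d < m"
  shows "F i + d \<le> F (i + d)"
  using assms(2)
proof (induction d)
  case (Suc d)
  then have "F (i + d) < F (i + Suc d)" by (intro assms(1)) auto
  with Suc show ?case by simp
qed simp

end

section \<open>Locating the turn of a cheap alignment\<close>

locale cheap_matching = gadget +
  fixes g :: "nat \<Rightarrow> nat option"
  assumes g: "matching (length X) (length Y) g"
    and cost: "(\<Sum>y<length Y. column wi X Y g y) + (\<Sum>x\<in>deleted (length X) g. wi (Some (X ! x)) None) < K * Den"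
begin

text \<open>\<open>X\<close> and \<open>Y\<close> have the same length, so there are as many
  deletions as insertions. One unit for a deletion is charged to each insertion; the lower bound can
  then be collected along \<open>Y\<close> alone.\<close>

definition "ch y = column wi X Y g y + (if g y = None then Den else 0)"

lemma g_bound: "g y = Some x \<Longrightarrow> y < length Y \<and> x < length X"
  using g unfolding matching_def by blast

lemma g_mono: "g y = Some x \<Longrightarrow> g y' = Some x' \<Longrightarrow> y < y' \<longleftrightarrow> x < x'"
  using g unfolding matching_def by (metis linorder_neqE_nat less_asym option.inject less_irrefl_nat)

lemma g_inj: "g y = Some x \<Longrightarrow> g y' = Some x \<Longrightarrow> y = y'"
  using g_mono[of y x y' x] g_mono[of y' x y x] by auto

lemma column_nonneg: "0 \<le> column wi X Y g y"
  by (simp add: column_def wi_nonneg)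

lemma ch_nonneg: "0 \<le> ch y"
  using column_nonneg[of y] Den by (simp add: ch_def)

lemma ch_None: "g y = None \<Longrightarrow> ch y = wi None (Some (Y ! y)) + Den"
  by (simp add: ch_def column_def)

lemma ch_Some: "g y = Some x \<Longrightarrow> ch y = wi (Some (X ! x)) (Some (Y ! y))"
  by (simp add: ch_def column_def)

lemma ch_ge: "(\<And>x. g y = Some x \<Longrightarrow> X ! x \<noteq> Y ! y) \<Longrightarrow> Den \<le> ch y"
  using wi_ge[of None "Some (Y ! y)"] wi_ge[of "Some _" "Some (Y ! y)"] Den
  by (cases "g y") (auto simp: ch_None ch_Some)

lemma finite_deleted: "finite (deleted (length X) g)"
  by (simp add: deleted_def)

lemma sum_ch: "(\<Sum>y<length Y. ch y) < K * Den"
proof -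
  define I where "I = {y. y < length Y \<and> g y = None}"
  define J where "J = {y. y < length Y \<and> g y \<noteq> None}"
  have J: "(\<lambda>y. the (g y)) ` J = {x. x < length X \<and> Some x \<in> range g}"
    using g_bound by (auto simp: J_def image_iff) (metis option.sel)+
  have "card {x. x < length X \<and> Some x \<in> range g} = card J"
    unfolding J[symmetric] by (rule card_image) (use g_inj in \<open>auto simp: inj_on_def J_def\<close>)
  moreover have "card {x. x < length X \<and> Some x \<in> range g} + card (deleted (length X) g) = length X"
  proof -
    have "{..<length X} = {x. x < length X \<and> Some x \<in> range g} \<union> deleted (length X) g" by (auto simp: deleted_def)
    moreover have "{x. x < length X \<and> Some x \<in> range g} \<inter> deleted (length X) g = {}" by (auto simp: deleted_def)
    ultimately show ?thesis using card_Un_disjoint[of "{x. x < length X \<and> Some x \<in> range g}" "deleted (length X) g"]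
      by (simp add: finite_deleted) (metis card_lessThan)
  qed
  moreover have "card J + card I = length Y"
  proof -
    have "{..<length Y} = J \<union> I" "J \<inter> I = {}" by (auto simp: J_def I_def)
    then show ?thesis using card_Un_disjoint[of J I] by (simp add: J_def I_def) (metis card_lessThan)
  qed
  ultimately have "card (deleted (length X) g) = card I" using length_XY by simp
  moreover have "Den * int (card (deleted (length X) g)) \<le> (\<Sum>x\<in>deleted (length X) g. wi (Some (X ! x)) None)"
    using sum_bounded_below[of "deleted (length X) g" Den "\<lambda>x. wi (Some (X ! x)) None"] wi_ge by (simp add: mult.commute)
  moreover have "(\<Sum>y<length Y. if g y = None then Den else 0) = Den * int (card I)"
    by (simp add: sum.If_cases I_def Int_def)
  ultimately show ?thesis using cost by (simp add: ch_def sum.distrib)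
qed

lemma column_less: "y < length Y \<Longrightarrow> column wi X Y g y < BIG"
proof -
  assume "y < length Y"
  then have "column wi X Y g y \<le> (\<Sum>y<length Y. column wi X Y g y)"
    by (intro member_le_sum) (auto simp: column_nonneg)
  moreover have "0 \<le> (\<Sum>x\<in>deleted (length X) g. wi (Some (X ! x)) None)"
    by (intro sum_nonneg wi_nonneg)
  ultimately show ?thesis using cost by (simp add: BIG_def)
qed

lemma not_deleted: "x < length X \<Longrightarrow> X ! x div S \<in> {1..6} \<Longrightarrow> \<exists>y. g y = Some x"
proof (rule ccontr)
  assume x: "x < length X" "X ! x div S \<in> {1..6}" and "\<nexists>y. g y = Some x"
  then have "x \<in> deleted (length X) g" by (auto simp: deleted_def)
  then have "wi (Some (X ! x)) None \<le> (\<Sum>x\<in>deleted (length X) g. wi (Some (X ! x)) None)"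
    by (intro member_le_sum) (auto simp: wi_nonneg finite_deleted)
  moreover have "wi (Some (X ! x)) None = BIG" using x(2) by (simp add: wi_delete)
  moreover have "0 \<le> (\<Sum>y<length Y. column wi X Y g y)" by (intro sum_nonneg column_nonneg)
  ultimately show False using cost by (simp add: BIG_def)
qed

lemma not_inserted: "y < length Y \<Longrightarrow> Y ! y div S \<noteq> 1 \<Longrightarrow> Y ! y div S \<noteq> 7 \<Longrightarrow> \<exists>x. g y = Some x"
  using column_less[of y] by (cases "g y") (auto simp: column_def wi_insert)

lemma match_less: "g y = Some x \<Longrightarrow> wi (Some (X ! x)) (Some (Y ! y)) < BIG"
  using column_less[of y] g_bound[of y x] by (simp add: column_def)

lemma match_allowed: "g y = Some x \<Longrightarrow> X ! x \<noteq> Y ! y \<Longrightarrow> allowed (X ! x div S) (Y ! y div S)"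
  using match_less g_bound X_le9 allowed by blast

text \<open>The marker of \<open>X\<close> can neither be deleted nor be substituted by another
  symbol, and \<open>Y\<close> contains it once.\<close>

lemma hash: "g (length Z) = Some (length Z + wsz)"
proof -
  have "length Z + wsz < length X" by (simp add: length_XY)
  moreover have k: "X ! (length Z + wsz) div S = 2" using nth_XY(3) kind(3) by simp
  ultimately obtain y where y: "g y = Some (length Z + wsz)" using not_deleted by fastforce
  have "\<not> allowed 2 (Y ! y div S)" by (simp add: allowed_def)
  then have "Y ! y = hh" using match_allowed[OF y] k nth_XY(3) by metis
  then have "y = length Z" using Y_hh[of y] g_bound[OF y] by (simp add: length_XY)
  with y show ?thesis by simp
qed

lemma inserted_tail: "j < wsz \<Longrightarrow> ch (length Z + 1 + j) = 2 * Den"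
proof -
  assume j: "j < wsz"
  have "g (length Z + 1 + j) = None"
  proof (cases "g (length Z + 1 + j)")
    case (Some x)
    then have "length Z + wsz < x" using g_mono[OF hash Some] by simp
    then show ?thesis using g_bound[OF Some] by (simp add: length_XY)
  qed
  then show ?thesis using nth_XY(6)[OF j] kind(2) by (simp add: ch_None wi_insert)
qed

text \<open>No junk of \<open>X\<close> can be deleted, and it precedes the marker, so it takes
  \<open>wsz\<close> distinct positions of \<open>Y\<close> before the marker. From the first of
  these on, partners lie at or behind the first junk symbol.\<close>

lemma junk: "wsz \<le> length Z \<and> (\<forall>y x. length Z - wsz \<le> y \<longrightarrow> g y = Some x \<longrightarrow> length Z \<le> x)"
proof -
  have "\<exists>y. g y = Some (length Z + j)" if "j < wsz" for j
    by (rule not_deleted) (use that nth_XY(2) kind(2) in \<open>auto simp: length_XY\<close>)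
  then obtain G where G: "\<And>j. j < wsz \<Longrightarrow> g (G j) = Some (length Z + j)" by metis
  have mono: "G i < G j" if "i < j" "j < wsz" for i j
    using g_mono[OF G G, of i j] that by simp
  have w: "0 < wsz" using vu by simp
  have "G 0 + (wsz - 1) \<le> G (0 + (wsz - 1))"
    by (rule strict_mono_gap[OF mono]) (use w in auto)
  moreover have "G (wsz - 1) < length Z" using g_mono[OF G hash, of "wsz - 1"] w by simp
  ultimately have G0: "G 0 + wsz \<le> length Z" using w by simp
  have "length Z \<le> x" if "length Z - wsz \<le> y" "g y = Some x" for y x
  proof (cases "y = G 0")
    case True
    then show ?thesis using G[OF w] that by simp
  next
    case False
    then have "G 0 < y" using G0 that(1) by simp
    then show ?thesis using g_mono[OF G[OF w] that(2)] by simp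
  qed
  then show ?thesis using G0 by auto
qed

text \<open>The junk needs a whole period of \<open>Z\<close>, longer than \<open>V 0\<close> alone.
  This settles the case \<open>r = 0\<close>.\<close>

lemma T_pos: "0 < T"
  using junk vu by (cases "T = 0") (auto simp: length_Z)

lemma A_last: "A (T - 1) = length Z - wsz" "A (T - 1) + wsz = length Z"
  using A_T(2)[of "T - 1"] A_T(1) T_pos by auto

lemma tail: "j < wsz \<Longrightarrow> Den \<le> ch (A (T - 1) + j)"
proof (rule ch_ge)
  fix x assume j: "j < wsz" and x: "g (A (T - 1) + j) = Some x"
  have y: "A (T - 1) + j < length Z" using A_last j by simp
  have "length Z - wsz \<le> A (T - 1) + j" using A_last by simp
  then have "length Z \<le> x" using junk x by blast
  moreover have "x < length Z + wsz" using g_mono[OF x hash] y by simp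
  ultimately have "X ! x = jj" using nth_XY(2)[of "x - length Z"] by simp
  moreover have "Y ! (A (T - 1) + j) div S \<noteq> 1" using kind_Z[OF y] nth_XY(4)[OF y] by simp
  ultimately show "X ! x \<noteq> Y ! (A (T - 1) + j)" using kind(2) by auto
qed

lemma A_Z: "t < T \<Longrightarrow> j < wsz \<Longrightarrow> A t + j < length Z"
  using A_bound[of t] by simp

lemma Y_al: "t < T \<Longrightarrow> Y ! (A t) = al t" "t < T \<Longrightarrow> X ! (A t) = al t"
  using nth_XY(1,4)[OF A_Z[of t 0]] nth_Z_A[of t 0] nth_U(1) vu by auto

lemma al_match: "t + 1 < T \<Longrightarrow> \<exists>t'<T. g (A t) = Some (A t')"
proof -
  assume t: "t + 1 < T"
  have k: "Y ! A t div S = 3" using Y_al(1)[of t] kind(4)[of t] t by simp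
  have b: "A t < length Y" using A_Z[of t 0] t vu by (simp add: length_XY)
  then obtain x where x: "g (A t) = Some x" using not_inserted k by fastforce
  have xb: "x < length X" using g_bound[OF x] by simp
  have "X ! x div S = 3"
  proof (cases "X ! x = Y ! A t")
    case False
    then have "allowed (X ! x div S) 3" using match_allowed[OF x] k by simp
    then have "X ! x div S = 1 \<or> X ! x div S = 3" by (auto simp: allowed_def)
    moreover have False if "X ! x div S = 1"
      using match_less[OF x] X_J[OF xb that] Y_al(1)[of t] wi_J_al[of t] t by simp
    ultimately show ?thesis by blast
  qed (use k in simp)
  moreover from this have xZ: "x < length Z" using X_Z[OF xb] by simp
  ultimately have "Z ! x div S = 3" using nth_XY(1)[OF xZ] by simp
  from occurrence(1)[OF xZ this] show ?thesis using x by blast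
qed

text \<open>The turn: the first period whose landmark leaves the main diagonal.\<close>

definition "s = (LEAST t. g (A t) \<noteq> Some (A t))"

lemma last_unmatched: "g (A (T - 1)) \<noteq> Some (A (T - 1))"
proof
  assume "g (A (T - 1)) = Some (A (T - 1))"
  then have "length Z \<le> A (T - 1)" using junk A_last by auto
  then show False using A_last vu by simp
qed

lemma s: "s < T" "g (A s) \<noteq> Some (A s)" "t < s \<Longrightarrow> g (A t) = Some (A t)"
proof -
  have "s \<le> T - 1" unfolding s_def by (rule Least_le) (fact last_unmatched)
  then show "s < T" using T_pos by simp
  show "g (A s) \<noteq> Some (A s)" unfolding s_def by (rule LeastI) (fact last_unmatched)
  show "t < s \<Longrightarrow> g (A t) = Some (A t)" unfolding s_def using not_less_Least by blast
qed

text \<open>At \<open>s\<close> the partner cannot lie earlier, since the preceding landmark is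
  still on the main diagonal. Afterwards strict monotonicity keeps the lead.\<close>

lemma shifted: "s \<le> t \<Longrightarrow> t + 1 < T \<Longrightarrow> \<exists>t'<T. t < t' \<and> g (A t) = Some (A t')"
proof (induction t)
  case 0
  then obtain t' where t': "t' < T" "g (A 0) = Some (A t')" using al_match by blast
  moreover have "s = 0" using 0 by simp
  ultimately have "t' \<noteq> 0" using s(2) by auto
  with t' show ?case by auto
next
  case (Suc t)
  then obtain t' where t': "t' < T" "g (A (Suc t)) = Some (A t')" using al_match by blast
  have "Suc t < t'"
  proof (cases "s = Suc t")
    case True
    then have "g (A t) = Some (A t)" using s(3)[of t] by simp
    from g_mono[OF this t'(2)] have "t < t'" by simp
    moreover have "t' \<noteq> Suc t" using s(2) True t' by auto
    ultimately show ?thesis by simp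
  next
    case False
    then obtain t'' where "t < t''" "g (A t) = Some (A t'')" using Suc by auto
    then show ?thesis using g_mono[of "A t" "A t''", OF _ t'(2)] by simp
  qed
  with t' show ?case by auto
qed

lemma later: "s \<le> t \<Longrightarrow> t + 1 < T \<Longrightarrow> A t \<le> y \<Longrightarrow> g y = Some x \<Longrightarrow> A (t + 1) \<le> x"
proof -
  assume t: "s \<le> t" "t + 1 < T" "A t \<le> y" "g y = Some x"
  obtain t' where t': "t < t'" "g (A t) = Some (A t')" using shifted t by blast
  have "A (t + 1) \<le> A t'" using t'(1) by (cases "t + 1 = t'") (auto intro: less_imp_le)
  moreover have "A t' \<le> x" using g_mono[OF t'(2) t(4)] t(3,4) t'(2) by (cases "y = A t") auto
  ultimately show ?thesis by simp
qed

lemma U_partner: "j < u \<Longrightarrow> \<exists>y. g y = Some (A s + j)"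
proof (rule not_deleted)
  assume j: "j < u"
  then have "A s + j < length Z" using A_Z[of s j] s vu by simp
  then show "A s + j < length X" "X ! (A s + j) div S \<in> {1..6}"
    using nth_XY(1) nth_Z_A[of s j] kind_U[of s j] j s by (auto simp: length_XY)
qed

definition "G j = (SOME y. g y = Some (A s + j))"
definition "F j = G j - s * wsz"

lemma G: "j < u \<Longrightarrow> g (G j) = Some (A s + j)"
  unfolding G_def by (rule someI_ex) (rule U_partner)

lemma G_mono: "i < j \<Longrightarrow> j < u \<Longrightarrow> G i < G j"
  using g_mono[OF G G, of i j] by simp

text \<open>From \<open>A s\<close> on, the positions of \<open>Y\<close> have partners in later
  periods of \<open>X\<close> or at or behind the junk, never in \<open>U s\<close>.\<close>

lemma G_less: "j < u \<Longrightarrow> G j < A s"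
proof (rule ccontr)
  assume j: "j < u" and "\<not> G j < A s"
  then have ge: "A s \<le> G j" by simp
  show False
  proof (cases "s + 1 < T")
    case True
    then have "A (s + 1) \<le> A s + j" using later[OF _ _ ge G[OF j]] by simp
    then show False using j vu A_T(2)[of s] by simp
  next
    case False
    then have "s = T - 1" using s by simp
    then have "length Z \<le> A s + j" using junk G[OF j] ge A_last by auto
    then show False using \<open>s = T - 1\<close> A_last j vu by simp
  qed
qed

text \<open>The earlier \<open>al\<close> symbols of \<open>Y\<close> face their own copies, so
  \<open>al s\<close> of \<open>X\<close> faces a filler. It lies behind the landmark of period
  \<open>s - 1\<close>, and the next fillers are those of \<open>V s\<close>.\<close>

lemma G_start: "s * wsz \<le> G 0"
proof -
  have u0: "0 < u" using vu by simp
  have lt: "G 0 < A s" using G_less[OF u0] .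
  then have lz: "G 0 < length Z" using A_Z[of s 0] s vu by simp
  have ks: "X ! A s div S = 3" using Y_al(2)[OF s(1)] kind(4)[of s] s by simp
  have g0: "g (G 0) = Some (A s)" using G[OF u0] by simp
  have "Y ! G 0 div S \<noteq> 3"
  proof
    assume "Y ! G 0 div S = 3"
    then obtain t where t: "t < T" "G 0 = A t" using occurrence(1)[OF lz] nth_XY(4)[OF lz] by auto
    then have "t < s" using lt by simp
    then have "g (A t) = Some (A t)" using s by blast
    then show False using g0 t \<open>t < s\<close> by simp
  qed
  then have "X ! A s \<noteq> Y ! G 0" using ks by auto
  then have "allowed 3 (Y ! G 0 div S)" using match_allowed[OF g0] ks by simp
  then have "Y ! G 0 div S = 0" using \<open>Y ! G 0 div S \<noteq> 3\<close> by (auto simp: allowed_def)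
  then obtain t j where t: "t \<le> T" "j < vl" "G 0 = t * wsz + j"
    using occurrence(5)[OF lz] nth_XY(4)[OF lz] by auto
  have "\<not> t < s"
  proof
    assume "t < s"
    then obtain s' where s': "s = s' + 1" "t \<le> s'" by (metis add.commute less_iff_Suc_add plus_1_eq_Suc le_add1 add_Suc_right Suc_eq_plus1)
    then have "A s' < G 0" using g_mono[OF s(3)[of s'] g0] by simp
    moreover have "G 0 < A t" using t by (simp add: A_def)
    moreover have "A t \<le> A s'" using s'(2) by (cases "t = s'") (auto intro: less_imp_le)
    ultimately show False by simp
  qed
  then have "s * wsz \<le> t * wsz" by (intro mult_le_mono1) simp
  then show ?thesis using t by linarith
qed

lemma G_F: "j < u \<Longrightarrow> G j = s * wsz + F j" and F_less: "j < u \<Longrightarrow> F j < vl"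
proof -
  assume j: "j < u"
  have "G 0 \<le> G j" using G_mono[of 0 j] j by (cases "j = 0") (auto intro: less_imp_le)
  then show "G j = s * wsz + F j" using G_start by (simp add: F_def)
  then show "F j < vl" using G_less[OF j] by (simp add: A_def)
qed

lemma F_mono: "i < j \<Longrightarrow> j < u \<Longrightarrow> F i < F j"
  using G_mono[of i j] G_F[of i] G_F[of j] by simp

end

section \<open>Substituting symbols of \<open>V s\<close> for \<open>U s\<close>\<close>

context cheap_matching begin

lemma UV:
  assumes "j < u"
  shows "X ! (A s + j) = U s ! j" "Y ! G j = V s ! F j"
    "ch (s * wsz + F j) = wi (Some (U s ! j)) (Some (V s ! F j))"
    "wi (Some (U s ! j)) (Some (V s ! F j)) < BIG"
    "Den \<le> wi (Some (U s ! j)) (Some (V s ! F j))"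
    "allowed (U s ! j div S) (V s ! F j div S)"
proof -
  have xZ: "A s + j < length Z" using A_Z[of s j] s assms vu by simp
  then show X: "X ! (A s + j) = U s ! j" using nth_XY(1) nth_Z_A[of s j] s assms by simp
  have sT: "s \<le> T" using s by simp
  have "G j < length Z" using G_less[OF assms] A_Z[of s 0] s vu by simp
  then show Y: "Y ! G j = V s ! F j"
    using nth_XY(4) nth_Z(1)[OF sT F_less[OF assms]] G_F[OF assms] by simp
  note g' = G[OF assms]
  show "ch (s * wsz + F j) = wi (Some (U s ! j)) (Some (V s ! F j))"
    using ch_Some[OF g'] X Y G_F[OF assms] by simp
  show "wi (Some (U s ! j)) (Some (V s ! F j)) < BIG" using match_less[OF g'] X Y by simp
  have ne: "U s ! j \<noteq> V s ! F j" using kind_U[of s j] kind_V[of s "F j"] s F_less[OF assms] assms by auto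
  then show "Den \<le> wi (Some (U s ! j)) (Some (V s ! F j))" by (intro wi_ge) simp
  show "allowed (U s ! j div S) (V s ! F j div S)" using match_allowed[OF g'] X Y ne by simp
qed

lemma F_gap: "i + d < u \<Longrightarrow> F i + d \<le> F (i + d)"
  by (rule strict_mono_gap[OF F_mono])

lemma F_less_iff: "i < u \<Longrightarrow> j < u \<Longrightarrow> F i < F j \<longleftrightarrow> i < j"
  using F_mono[of i j] F_mono[of j i] by (cases i j rule: linorder_cases) auto

lemma F_inj: "inj_on F {..<u}"
  using F_less_iff by (intro inj_onI) (metis lessThan_iff less_irrefl linorder_neqE_nat)

text \<open>The first symbol of \<open>U s\<close> faces a filler, and the right block of fillers
  has one place too few for all of \<open>U s\<close>.\<close>

lemma F_first: "F 0 < N"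
proof -
  have u0: "0 < u" using vu by simp
  have al: "allowed 3 (V s ! F 0 div S)" using UV(6)[OF u0] nth_U(1)[of s] kind(4)[of s] s by simp
  have sT: "s \<le> T" using s by simp
  have "F 0 < N \<or> N + 2 + nq \<le> F 0"
    using F_less[OF u0] al kind sT by (cases rule: V_position[OF F_less[OF u0], of s]) (auto simp: allowed_def)
  moreover have "F 0 + N < vl" using F_gap[of 0 N] F_less[of N] vu by simp
  ultimately show ?thesis using vu by linarith
qed

lemma U_last: "U s ! N = ta (h - 1) 0"
proof -
  have h: "0 < h" by (simp add: h_def)
  then have "N = 1 + ((h - 1) * sl + (2 * r + 2))" by (cases h) (simp_all add: N_def sl_def)
  then show ?thesis using nth_U(2)[of "h - 1" "2 * r + 2" s] nth_slot(3)[of 0 s "h - 1"] h by (simp add: sl_def)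
qed

text \<open>The last symbol of \<open>U s\<close> has \<open>N\<close> symbols before it and so lies
  beyond the left fillers. It is a \<open>ta\<close> with \<open>a = 0\<close>, which may face
  neither \<open>mm s\<close> nor a candidate.\<close>

lemma F_last: "N + 1 + nq \<le> F N"
proof -
  have Nu: "N < u" using vu by simp
  have h: "h - 1 < h" by (simp add: h_def)
  have sT: "s \<le> T" using s by simp
  have N: "N \<le> F N" using F_gap[of 0 N] vu by simp
  have lt: "wi (Some (ta (h - 1) 0)) (Some (V s ! F N)) < BIG" using UV(4)[OF Nu] U_last by simp
  show ?thesis using F_less[OF Nu]
  proof (cases rule: V_position[of _ s])
    case z
    then show ?thesis using N by simp
  next
    case mm
    then show ?thesis using lt wi_ta_mm[OF h _ sT, of 0] by simp
  next
    case (qq b)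
    then show ?thesis using lt wi_ta_qq[OF h _ qq(1), of 0] by simp
  next
    case ee
    then show ?thesis by simp
  qed
qed

lemma F_surj:
  assumes "F 0 < k" "k \<le> F N" "g (s * wsz + k) = Some x"
  shows "\<exists>j<u. F j = k"
proof -
  have u0: "0 < u" "N < u" using vu by auto
  have "G 0 < s * wsz + k" using G_F[OF u0(1)] assms(1) by simp
  then have 1: "A s < x" using g_mono[OF G[OF u0(1)] assms(3)] by simp
  have 2: "x \<le> A s + N"
  proof (cases "k = F N")
    case True
    then show ?thesis using assms(3) G[OF u0(2)] G_F[OF u0(2)] by simp
  next
    case False
    then have "s * wsz + k < G N" using G_F[OF u0(2)] assms(2) by simp
    then show ?thesis using g_mono[OF assms(3) G[OF u0(2)]] by simp
  qed
  define j where "j = x - A s"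
  have j: "x = A s + j" "j < u" using 1 2 vu by (auto simp: j_def)
  have "G j = s * wsz + k" using g_inj[OF G[OF j(2)]] assms(3) j(1) by simp
  then show ?thesis using G_F[OF j(2)] j(2) by auto
qed

lemma V_matched: "k < vl \<Longrightarrow> V s ! k div S \<noteq> 7 \<Longrightarrow> \<exists>x. g (s * wsz + k) = Some x"
proof (rule not_inserted)
  assume k: "k < vl" "V s ! k div S \<noteq> 7"
  have sT: "s \<le> T" using s by simp
  have "s * wsz + k < A s" using k by (simp add: A_def)
  then have l: "s * wsz + k < length Z" using A_Z[of s 0] s vu by simp
  then show "s * wsz + k < length Y" by (simp add: length_XY)
  have "Y ! (s * wsz + k) = V s ! k" using nth_XY(4)[OF l] nth_Z(1)[OF sT k(1)] by simp
  then show "Y ! (s * wsz + k) div S \<noteq> 1" "Y ! (s * wsz + k) div S \<noteq> 7"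
    using k kind_V[OF sT k(1)] by auto
qed

definition "v = s mod r"
definition "L = r - v"

lemma r_pos: "0 < r" using T_pos unfolding T_def by (cases r) auto

lemma v: "v < r" using r_pos by (simp add: v_def)

text \<open>\<open>mm s\<close> and \<open>ee s\<close> cannot be inserted, and only symbols with
  \<open>a = v\<close> may face them. If these were in different slots, the \<open>ta i 0\<close>
  closing the first of the slots would have to face a candidate.\<close>

lemma slot_choice:
  obtains i where "i < h" "F (1 + (i * sl + v)) = N" "F (1 + (i * sl + (2 * r + 2 - v))) = N + 1 + nq"
proof -
  have u0: "N < u" using vu by auto
  have sT: "s \<le> T" using s by simp
  have b: "N < vl" "N + 1 + nq < vl" using vu by auto
  have "\<exists>x. g (s * wsz + N) = Some x" by (rule V_matched) (use b kind(9)[OF sT] nth_V(2) in auto)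
  then obtain j1 where j1: "j1 < u" "F j1 = N" using F_surj[of N] F_first F_last by auto
  have "\<exists>x. g (s * wsz + (N + 1 + nq)) = Some x"
    by (rule V_matched) (use b kind(10)[OF sT] nth_V(4) in auto)
  then obtain j2 where j2: "j2 < u" "F j2 = N + 1 + nq" using F_surj[of "N + 1 + nq"] F_first F_last by auto
  have j12: "j1 < j2" using F_less_iff[OF j1(1) j2(1)] j1 j2 by simp
  obtain i where i: "i < h" "j1 = 1 + (i * sl + v)"
    using j1(1)
  proof (cases rule: U_position[of _ s])
    case al
    then show thesis using UV(6)[OF j1(1)] j1(2) nth_V(2)[of s] kind(4)[OF sT] kind(9)[OF sT] by (simp add: allowed_def)
  next
    case (sg i a)
    have "a = v"
      using UV(4)[OF j1(1)] j1(2) nth_V(2)[of s] sg wi_sg_mm[OF sg(2) sT] by (auto simp: v_def split: if_splits)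
    then show thesis using that sg by simp
  next
    case (pp i)
    then show thesis using UV(6)[OF j1(1)] j1(2) nth_V(2)[of s] pp_bound[OF s(1) pp(1)] kind(9)[OF sT] by (simp add: allowed_def)
  next
    case (ta i a)
    then show thesis using UV(4)[OF j1(1)] j1(2) nth_V(2)[of s] wi_ta_mm[OF ta(1,2) sT] by simp
  qed
  obtain i2 where i2: "i2 < h" "j2 = 1 + (i2 * sl + (2 * r + 2 - v))"
    using j2(1)
  proof (cases rule: U_position[of _ s])
    case al
    then show thesis using UV(6)[OF j2(1)] j2(2) nth_V(4)[of s] kind(4)[OF sT] kind(10)[OF sT] by (simp add: allowed_def)
  next
    case (sg i a)
    then show thesis using UV(6)[OF j2(1)] j2(2) nth_V(4)[of s] kind(5)[OF sg(2)] kind(10)[OF sT] by (simp add: allowed_def)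
  next
    case (pp i)
    then show thesis using UV(6)[OF j2(1)] j2(2) nth_V(4)[of s] pp_bound[OF s(1) pp(1)] kind(10)[OF sT] by (simp add: allowed_def)
  next
    case (ta i a)
    have "a = v"
      using UV(4)[OF j2(1)] j2(2) nth_V(4)[of s] ta wi_ta_ee[OF ta(1,2) sT] by (auto simp: v_def split: if_splits)
    then show thesis using that ta by simp
  qed
  have "i2 = i"
  proof (rule ccontr)
    assume "i2 \<noteq> i"
    moreover have "\<not> i2 < i"
    proof
      assume "i2 < i"
      then have "(i2 + 1) * sl \<le> i * sl" by (intro mult_le_mono1) simp
      then show False using j12 i(2) i2(2) by (simp add: sl_def)
    qed
    ultimately have lt: "i < i2" by simp
    define j where "j = 1 + (i * sl + (2 * r + 2))"
    have "(i + 1) * sl \<le> i2 * sl" using lt by (intro mult_le_mono1) simp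
    then have j: "j1 < j" "j < j2" using i(2) i2(2) v by (auto simp: j_def sl_def)
    then have ju: "j < u" using j2 by simp
    have "N < F j" "F j < N + 1 + nq" using F_less_iff[OF j1(1) ju] F_less_iff[OF ju j2(1)] j j1 j2 by auto
    then have b: "F j - N - 1 < nq" "F j = N + 1 + (F j - N - 1)" by auto
    have "U s ! j = ta i 0" using nth_U(2)[of i "2 * r + 2" s] nth_slot(3)[of 0 s i] i(1) by (simp add: j_def sl_def)
    moreover have "V s ! F j = qq (F j - N - 1)" using nth_V(3)[OF b(1), of s] b(2) by simp
    ultimately show False using UV(4)[OF ju] wi_ta_qq[OF i(1) _ b(1), of 0] by simp
  qed
  then show thesis using that i i2 j1 j2 by simp
qed

text \<open>Only the \<open>2 * L + 1\<close> symbols between the partners of \<open>mm s\<close>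
  and \<open>ee s\<close> can face candidates. Every other candidate is inserted, which costs
  \<open>2 * Den\<close> with the charge for a deletion.\<close>

lemma turn_window: "(\<Sum>x<u. wi (Some (U s ! x)) (Some (V s ! F x))) + 2 * Den * (int nq - (2 * int L + 1))
  \<le> (\<Sum>j<vl. ch (s * wsz + j))"
proof -
  obtain i where i: "i < h" "F (1 + (i * sl + v)) = N" "F (1 + (i * sl + (2 * r + 2 - v))) = N + 1 + nq"
    by (rule slot_choice)
  define j1 j2 where "j1 = 1 + (i * sl + v)" and "j2 = 1 + (i * sl + (2 * r + 2 - v))"
  have Lv: "L + v = r" using v by (simp add: L_def)
  have "(i + 1) * sl \<le> h * sl" using i(1) by (intro mult_le_mono1) simp
  then have j: "j1 < j2" "j2 < u" "j1 < u" "j2 = j1 + 1 + (2 * L + 1)"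
    using v Lv by (auto simp: j1_def j2_def u_def sl_def)
  define Q where "Q = {N+1..<N+1+nq} - F ` {..<u}"
  have "F ` {..<u} \<inter> {N+1..<N+1+nq} \<subseteq> F ` {j1+1..<j2}"
  proof
    fix k assume "k \<in> F ` {..<u} \<inter> {N+1..<N+1+nq}"
    then obtain x where x: "x < u" "k = F x" "N < F x" "F x < N + 1 + nq" by auto
    then have "j1 < x" "x < j2" using F_less_iff[OF j(3) x(1)] F_less_iff[OF x(1) j(2)] i by (auto simp: j1_def j2_def)
    then show "k \<in> F ` {j1+1..<j2}" using x by auto
  qed
  then have "card (F ` {..<u} \<inter> {N+1..<N+1+nq}) \<le> card {j1+1..<j2}"
    by (meson card_image_le card_mono finite_atLeastLessThan finite_imageI order_trans)
  also have "\<dots> = 2 * L + 1" using j by simp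
  finally have "card {N+1..<N+1+nq} - (2 * L + 1) \<le> card Q"
    unfolding Q_def using card_Diff_subset_Int[of "{N+1..<N+1+nq}" "F ` {..<u}"] by (simp add: Int_commute)
  then have cQ: "int nq - (2 * int L + 1) \<le> int (card Q)" by simp
  have Q: "ch (s * wsz + k) = 2 * Den" if "k \<in> Q" for k
  proof -
    have k: "N < k" "k < N + 1 + nq" "k \<notin> F ` {..<u}" using that by (auto simp: Q_def)
    have "g (s * wsz + k) = None"
    proof (cases "g (s * wsz + k)")
      case (Some x)
      then have "\<exists>j<u. F j = k" using F_surj[of k] F_first F_last k by simp
      then show ?thesis using k by auto
    qed
    moreover have "Y ! (s * wsz + k) = qq (k - N - 1)" "k - N - 1 < nq"
    proof -
      have "s * wsz + k < A s" using k vu by (simp add: A_def)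
      then have l: "s * wsz + k < length Z" using A_Z[of s 0] s vu by simp
      show lt: "k - N - 1 < nq" using k by simp
      then show "Y ! (s * wsz + k) = qq (k - N - 1)"
        using nth_XY(4)[OF l] nth_Z(1)[of s k] s k vu nth_V(3)[OF lt, of s] by simp
    qed
    ultimately show ?thesis using kind(8)[of "k - N - 1"] by (simp add: ch_None wi_insert)
  qed
  have "(\<Sum>x<u. wi (Some (U s ! x)) (Some (V s ! F x))) = (\<Sum>x<u. ch (s * wsz + F x))"
    using UV(3) by simp
  also have "\<dots> = (\<Sum>k\<in>F ` {..<u}. ch (s * wsz + k))" by (simp add: sum.reindex[OF F_inj])
  finally have 1: "(\<Sum>x<u. wi (Some (U s ! x)) (Some (V s ! F x))) = (\<Sum>k\<in>F ` {..<u}. ch (s * wsz + k))" .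
  have "2 * Den * (int nq - (2 * int L + 1)) \<le> 2 * Den * int (card Q)"
    by (rule mult_left_mono[OF cQ]) (use Den in simp)
  also have "\<dots> = (\<Sum>k\<in>Q. ch (s * wsz + k))" using Q by simp
  finally have "(\<Sum>x<u. wi (Some (U s ! x)) (Some (V s ! F x))) + 2 * Den * (int nq - (2 * int L + 1))
      \<le> (\<Sum>k\<in>F ` {..<u} \<union> Q. ch (s * wsz + k))"
    unfolding 1 by (subst sum.union_disjoint) (auto simp: Q_def)
  also have "\<dots> \<le> (\<Sum>j<vl. ch (s * wsz + j))"
    by (rule sum_mono2) (use F_less vu ch_nonneg in \<open>auto simp: Q_def\<close>)
  finally show ?thesis .
qed

text \<open>Behind the turn all partners come from later periods. Hence \<open>al t\<close>,
  \<open>mm (t + 1)\<close> and \<open>ee (t + 1)\<close> miss their only copies, and at a change of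
  group so do all \<open>pp\<close>. The sets \<open>J\<close> and \<open>P\<close> hold the offsets
  of these symbols.\<close>

lemma block:
  assumes t: "s \<le> t" "t + 1 < T"
  shows "Den * D t \<le> (\<Sum>j<wsz. ch (A t + j))"
proof -
  define P where "P = (\<lambda>k. 1 + (k * sl + (r + 1))) ` {..<h}"
  define J where "J = {0, u + N, u + (N + 1 + nq)}"
  have Pu: "1 \<le> j \<and> j < u" if "j \<in> P" for j
  proof -
    obtain k where k: "k < h" "j = 1 + (k * sl + (r + 1))" using \<open>j \<in> P\<close> by (auto simp: P_def)
    have "(k + 1) * sl \<le> h * sl" using k(1) by (intro mult_le_mono1) simp
    then show ?thesis using k by (simp add: u_def sl_def)
  qed
  have "inj_on (\<lambda>k. 1 + (k * sl + (r + 1))) {..<h}" by (simp add: inj_on_def sl_def)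
  then have cP: "card P = h" by (simp add: P_def card_image)
  have cJ: "card J = 3" using vu by (simp add: J_def)
  have JP: "J \<inter> P = {}" using Pu by (force simp: J_def)
  have sub: "J \<subseteq> {..<wsz}" "P \<subseteq> {..<wsz}" using vu Pu by (force simp: J_def)+
  have val: "A t + j < length Z" "Y ! (A t + j) = Z ! (A t + j)" if "j < wsz" for j
    using A_Z[of t j] nth_XY(4) t that by auto
  have part: "A (t + 1) \<le> x" "x < length Z" "X ! x = Z ! x" if "g (A t + j) = Some x" "X ! x = Y ! (A t + j)" "j < wsz" for x j
  proof -
    show "A (t + 1) \<le> x" using later[OF t _ that(1)] by simp
    have "X ! x div S \<noteq> 1 \<and> X ! x div S \<noteq> 2" using kind_Z[OF val(1)[OF that(3)]] val(2)[OF that(3)] that(2) by simp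
    then show "x < length Z" using X_Z[of x] g_bound[OF that(1)] by simp
    then show "X ! x = Z ! x" by (rule nth_XY(1))
  qed
  have Vpos: "A t + (u + k) = (t + 1) * wsz + k" for k using vu by (simp add: A_def)
  have J: "Den \<le> ch (A t + j)" if "j \<in> J" for j
  proof (rule ch_ge)
    fix x assume x: "g (A t + j) = Some x"
    have jw: "j < wsz" using that sub by auto
    show "X ! x \<noteq> Y ! (A t + j)"
    proof
      assume eq: "X ! x = Y ! (A t + j)"
      note p = part[OF x eq jw]
      have Zx: "Z ! x = Z ! (A t + j)" using p eq val(2)[OF jw] by simp
      have "t + 1 \<le> T" using t by simp
      from that consider "j = 0" | "j = u + N" | "j = u + (N + 1 + nq)" by (auto simp: J_def)
      then show False
      proof cases
        case 1
        then have "Z ! x = al t" using Zx nth_Z_A[of t 0] nth_U(1) t vu by simp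
        then obtain t' where "t' < T" "x = A t'" "al t' = al t" using occurrence(1)[OF p(2)] kind(4)[of t] t by auto
        then show False using p(1) vu by (simp add: al_def A_def)
      next
        case 2
        have "Z ! x = Z ! ((t + 1) * wsz + N)" unfolding Zx 2 Vpos ..
        also have "\<dots> = mm (t + 1)" using nth_Z(1)[OF \<open>t + 1 \<le> T\<close> vu(5)] nth_V(2) by simp
        finally have "Z ! x = mm (t + 1)" .
        with occurrence(3)[OF p(2)] kind(9)[OF \<open>t + 1 \<le> T\<close>]
        obtain t' where t': "x = t' * wsz + N" "mm t' = mm (t + 1)" by metis
        then show False using p(1) vu by (simp add: mm_def A_def)
      next
        case 3
        have "Z ! x = Z ! ((t + 1) * wsz + (N + 1 + nq))" unfolding Zx 3 Vpos ..
        also have "\<dots> = ee (t + 1)" using nth_Z(1)[OF \<open>t + 1 \<le> T\<close> vu(6)] nth_V(4)[of "t + 1"] by simp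
        finally have "Z ! x = ee (t + 1)" .
        with occurrence(4)[OF p(2)] kind(10)[OF \<open>t + 1 \<le> T\<close>]
        obtain t' where t': "x = t' * wsz + (N + 1 + nq)" "ee t' = ee (t + 1)" by metis
        then show False using p(1) vu by (simp add: ee_def A_def)
      qed
    qed
  qed
  have P: "Den \<le> ch (A t + j)" if "j \<in> P" and ne: "(t + 1) div r \<noteq> t div r" for j
  proof (rule ch_ge)
    fix x assume x: "g (A t + j) = Some x"
    have jw: "j < wsz" using that sub by auto
    obtain k where k: "k < h" "j = 1 + (k * sl + (r + 1))" using \<open>j \<in> P\<close> by (auto simp: P_def)
    show "X ! x \<noteq> Y ! (A t + j)"
    proof
      assume eq: "X ! x = Y ! (A t + j)"
      note p = part[OF x eq jw]
      have "Z ! x = U t ! j" using p eq val(2)[OF jw] nth_Z_A[of t j] t Pu[OF that(1)] by simp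
      also have "\<dots> = pp (t div r * h + k)" using nth_U(2)[of k "r + 1" t] nth_slot(2)[of t k] k by (simp add: sl_def)
      finally have Zx: "Z ! x = pp (t div r * h + k)" .
      then obtain t' k' where t': "t' < T" "k' < h" "x = A t' + (1 + (k' * sl + (r + 1)))" "Z ! x = pp (t' div r * h + k')"
        using occurrence(2)[OF p(2)] pp_bound[of t k] k t by auto
      have "t' div r * h + k' = t div r * h + k" using t'(4) Zx by (simp add: pp_def)
      then have "t' div r = t div r" using t'(2) k(1)
        by (metis add_cancel_right_right div_less div_mult_self3 gr_implies_not0)
      moreover have "t + 1 \<le> t'"
      proof (rule ccontr)
        assume "\<not> t + 1 \<le> t'"
        then have "A t' \<le> A t" by (cases "t' = t") (auto intro: less_imp_le)
        moreover have "1 + (k' * sl + (r + 1)) \<in> P" using t'(2) by (auto simp: P_def)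
        ultimately show False using p(1) t'(3) Pu[of "1 + (k' * sl + (r + 1))"] A_T(2)[of t] vu by simp
      qed
      ultimately show False using ne div_le_mono[of "t + 1" t' r] div_le_mono[of t "t + 1" r] by linarith
    qed
  qed
  have finite: "finite P" by (simp add: P_def)
  have sJ: "Den * 3 \<le> (\<Sum>j\<in>J. ch (A t + j))"
    using sum_bounded_below[of J Den "\<lambda>j. ch (A t + j)"] J cJ by (simp add: mult.commute)
  show ?thesis
  proof (cases "(t + 1) div r = t div r")
    case True
    have "(\<Sum>j\<in>J. ch (A t + j)) \<le> (\<Sum>j<wsz. ch (A t + j))" by (rule sum_mono2) (use sub ch_nonneg in auto)
    then show ?thesis using sJ True by (simp add: D_def)
  next
    case False
    then have "(t + 1) div r = t div r + 1" using div_Suc[of t r] by (auto split: if_splits)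
    then have D: "D t = 3 + int h" by (simp add: D_def)
    have "Den * int h \<le> (\<Sum>j\<in>P. ch (A t + j))"
      using sum_bounded_below[of P Den "\<lambda>j. ch (A t + j)"] P[OF _ False] cP by (simp add: mult.commute)
    then have "Den * D t \<le> (\<Sum>j\<in>J \<union> P. ch (A t + j))"
      unfolding D using sJ JP finite by (subst sum.union_disjoint) (auto simp: J_def distrib_left)
    also have "\<dots> \<le> (\<Sum>j<wsz. ch (A t + j))" by (rule sum_mono2) (use sub ch_nonneg in auto)
    finally show ?thesis .
  qed
qed

text \<open>Adds the turn, the shifted periods, one unit per position of the last period and two per
  inserted junk symbol. What precedes the turn, as well as the marker, is bounded below by
  0.\<close>

lemma total: "(\<Sum>x<u. wi (Some (U s ! x)) (Some (V s ! F x))) + 2 * Den * (int nq - (2 * int L + 1))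
    + Den * (3 * (int T - 1 - int s) + int h * (int r - 1 - int (s div r)) + 3 * int wsz) < K * Den"
proof -
  define m where "m = T - 1 - s"
  have T: "T = s + (m + 1)" using s by (simp add: m_def)
  have lenZ: "length Z = A s + (m + 1) * wsz"
    using A_T(1) T by (simp add: A_def distrib_right)
  have lenY: "length Y = (length Z + 1) + wsz" by (simp add: length_XY)
  have "(T - 1) div r = r - 1"
  proof -
    have "T - 1 = (r - 1) * r + (r - 1)" unfolding T_def using r_pos by (cases r) simp_all
    then show ?thesis using r_pos div_mult_self3[of r "r - 1" "r - 1"] by (simp only:) simp
  qed
  then have sm: "int ((s + m) div r) = int r - 1" using T r_pos by simp
  have sumD: "(\<Sum>k<m'. D (s + k)) = 3 * int m' + int h * (int ((s + m') div r) - int (s div r))" for m'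
    by (induction m') (simp_all add: D_def algebra_simps)
  have "(\<Sum>y<length Y. ch y) = (\<Sum>y<length Z. ch y) + ch (length Z) + (\<Sum>j<wsz. ch (length Z + 1 + j))"
    unfolding lenY sum_lessThan_add by simp
  also have "(\<Sum>j<wsz. ch (length Z + 1 + j)) = 2 * Den * int wsz"
    using inserted_tail by simp
  also have "(\<Sum>y<length Z. ch y) = (\<Sum>y<A s. ch y) + (\<Sum>k<m + 1. \<Sum>j<wsz. ch (A (s + k) + j))"
  proof -
    have "A s + k * wsz = A (s + k)" for k by (simp add: A_def distrib_right)
    then show ?thesis unfolding lenZ sum_blocks by simp
  qed
  also have "(\<Sum>y<A s. ch y) = (\<Sum>y<s * wsz. ch y) + (\<Sum>j<vl. ch (s * wsz + j))"
    unfolding A_def sum_lessThan_add ..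
  also have "(\<Sum>k<m + 1. \<Sum>j<wsz. ch (A (s + k) + j)) =
      (\<Sum>k<m. \<Sum>j<wsz. ch (A (s + k) + j)) + (\<Sum>j<wsz. ch (A (T - 1) + j))"
    using T by simp
  finally have eq: "(\<Sum>y<length Y. ch y) = (\<Sum>y<s * wsz. ch y) + (\<Sum>j<vl. ch (s * wsz + j)) +
      ((\<Sum>k<m. \<Sum>j<wsz. ch (A (s + k) + j)) + (\<Sum>j<wsz. ch (A (T - 1) + j))) + ch (length Z) + 2 * Den * int wsz" .
  have 1: "0 \<le> (\<Sum>y<s * wsz. ch y)" by (intro sum_nonneg ch_nonneg)
  have 2: "Den * (\<Sum>k<m. D (s + k)) \<le> (\<Sum>k<m. \<Sum>j<wsz. ch (A (s + k) + j))"
    unfolding sum_distrib_left by (intro sum_mono block) (use T in auto)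
  have 3: "Den * int wsz \<le> (\<Sum>j<wsz. ch (A (T - 1) + j))"
    using sum_bounded_below[of "{..<wsz}" Den "\<lambda>j. ch (A (T - 1) + j)"] tail by (simp add: mult.commute)
  have m: "int m = int T - 1 - int s" using T by simp
  have "(\<Sum>k<m. D (s + k)) = 3 * (int T - 1 - int s) + int h * (int r - 1 - int (s div r))"
    unfolding sumD sm m ..
  then show ?thesis
    using sum_ch 1 2 3 turn_window ch_nonneg[of "length Z"] unfolding eq by (simp add: distrib_left)
qed

text \<open>After cancelling all whole units against the budget, \<open>\<Delta> * E\<close> and the
  graph terms have a negative sum. This forces \<open>E = 0\<close>, and then all columns speak of
  the same candidate \<open>\<beta>\<close>.\<close>

lemma negative: "\<exists>p<sP. \<exists>q<sQ. \<exists>w<r. PQ p q + QR q w + RP w p < 0"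
proof -
  obtain i where i: "i < h" "F (1 + (i * sl + v)) = N" "F (1 + (i * sl + (2 * r + 2 - v))) = N + 1 + nq"
    by (rule slot_choice)
  define C where "C = (\<lambda>x. wi (Some (U s ! x)) (Some (V s ! F x)))"
  define j1 where "j1 = 1 + (i * sl + v)"
  define rest where "rest = u - (j1 + 2 * L + 3)"
  define x where "x = s div r * h + i"
  \<comment> \<open>The candidate facing \<open>p\<close>. Next, \<open>\<gamma> l\<close> and
    \<open>\<delta> l\<close> are the candidates that would face it if, starting from the
    \<open>l\<close>-th \<open>sg\<close> or \<open>ta\<close>, the candidates up to
    \<open>p\<close> were consecutive.\<close>
  define \<beta> where "\<beta> = int (F (j1 + 1 + L)) - int (N + 1)"
  define \<gamma> where "\<gamma> = (\<lambda>l. int (F (j1 + 1 + l)) - int (N + 1) + int L - int l)"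
  define \<delta> where "\<delta> = (\<lambda>l. int (F (j1 + 1 + L + 1 + l)) - int (N + 1) - int l - 1)"
  have sT: "s \<le> T" using s by simp
  have Lv: "v + L = r" "0 < L" using v by (auto simp: L_def)
  have isl: "(i + 1) * sl \<le> h * sl" using i(1) by (intro mult_le_mono1) simp
  then have j2: "1 + (i * sl + (2 * r + 2 - v)) = j1 + 1 + (2 * L + 1)" "j1 + 2 * L + 3 \<le> u"
    using v Lv by (auto simp: j1_def u_def sl_def)
  then have u: "u = j1 + (1 + ((L + (1 + L)) + (1 + rest)))" by (simp add: rest_def)
  have xb: "x < r * h" unfolding x_def by (rule payload(3)) (use s i in auto)
  have Uo: "U s ! (1 + (i * sl + k)) = slot s i ! k" if "k < sl" for k using nth_U(2) i(1) that by simp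
  have Fj: "F j1 = N" "F (j1 + 1 + (2 * L + 1)) = N + 1 + nq"
    using i(2) i(3)[unfolded j2(1)] by (simp_all only: j1_def)
  have mid: "N < F j" "F j - N - 1 < nq" "V s ! F j = qq (F j - N - 1)" if "j1 < j" "j < j1 + 1 + (2 * L + 1)" for j
  proof -
    have ju: "j < u" "j1 < u" "j1 + 1 + (2 * L + 1) < u" using that j2(2) by auto
    have "F j1 < F j" "F j < F (j1 + 1 + (2 * L + 1))" using F_less_iff ju that by auto
    then show 1: "N < F j" "F j - N - 1 < nq" unfolding Fj by linarith+
    show "V s ! F j = qq (F j - N - 1)" using nth_V(3)[OF 1(2), of s] 1(1) by simp
  qed
  have CD: "Den \<le> C j" if "j < u" for j unfolding C_def using UV(5) that by blast
  have C1: "C j1 = Den * (1 + 3 * (int s + 1) + int h * (int (s div r) + 1))"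
    using Uo[of v] nth_slot(1)[of v s i] v i(2) nth_V(2)[of s] wi_sg_mm[of v s] sT
    by (simp add: C_def j1_def v_def sl_def)
  have C2: "C (j1 + 1 + (2 * L + 1)) = 2 * Den + RPx (int v) (int x)"
    using Uo[of "2 * r + 2 - v"] nth_slot(3)[of v s i] v Fj(2) nth_V(4)[of s] wi_ta_ee[of i v s] sT i(1)
    unfolding C_def Fj j2(1) by (simp add: v_def sl_def x_def)
  have Cp: "C (j1 + 1 + L) = 2 * Den + PQx (int x) \<beta>"
  proof -
    have e: "j1 + 1 + L = 1 + (i * sl + (r + 1))" using Lv by (simp add: j1_def)
    have "U s ! (j1 + 1 + L) = pp x" using Uo[of "r + 1"] nth_slot(2)[of s i] unfolding e by (simp add: sl_def x_def)
    moreover have "int (F (j1 + 1 + L) - N - 1) = \<beta>" using mid(1)[of "j1 + 1 + L"] Lv by (simp add: \<beta>_def)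
    ultimately show ?thesis using mid[of "j1 + 1 + L"] wi_pp_qq[OF xb, of "F (j1 + 1 + L) - N - 1"] Lv by (simp add: C_def)
  qed
  have Cs: "C (j1 + 1 + l) = 4 * Den - \<Delta> * \<gamma> l + (QRx (int (v + l)) (\<gamma> l) - QRx (int (v + l) + 1) (\<gamma> l))" if "l < L" for l
  proof -
    have e: "j1 + 1 + l = 1 + (i * sl + (v + 1 + l))" by (simp add: j1_def)
    have a: "v + 1 + l \<le> r" using that Lv by simp
    have "U s ! (j1 + 1 + l) = sg (v + 1 + l)"
      using Uo[of "v + 1 + l"] nth_slot(1)[OF a, of s i] a unfolding e by (simp add: sl_def)
    moreover have g: "int (F (j1 + 1 + l) - N - 1) + int r + 1 - int (v + 1 + l) = \<gamma> l"
      "int (v + 1 + l) - 1 = int (v + l)" "int (v + 1 + l) = int (v + l) + 1"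
      using mid(1)[of "j1 + 1 + l"] Lv that by (auto simp: \<gamma>_def)
    moreover have "1 \<le> v + 1 + l" by simp
    ultimately show ?thesis unfolding C_def
      using mid(2,3)[of "j1 + 1 + l"] wi_sg_qq[OF a, of "F (j1 + 1 + l) - N - 1"] that by (simp only:) simp
  qed
  have Ct: "C (j1 + 1 + (L + 1 + l)) = 2 * Den + \<Delta> * \<delta> l" if "l < L" for l
  proof -
    have e: "j1 + 1 + (L + 1 + l) = 1 + (i * sl + (2 * r + 2 - (r - l)))" using Lv that by (simp add: j1_def)
    have a: "r - l \<le> r" "1 \<le> r - l" using that Lv by auto
    have "U s ! (j1 + 1 + (L + 1 + l)) = ta i (r - l)"
      using Uo[of "2 * r + 2 - (r - l)"] nth_slot(3)[OF a(1), of s i] a unfolding e by (simp add: sl_def)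
    moreover have "int (F (j1 + 1 + (L + 1 + l)) - N - 1) - (int r + 1 - int (r - l)) = \<delta> l"
      using mid(1)[of "j1 + 1 + (L + 1 + l)"] Lv that by (simp add: \<delta>_def of_nat_diff add.assoc)
    ultimately show ?thesis
      using mid[of "j1 + 1 + (L + 1 + l)"] wi_ta_qq[OF i(1) a(1), of "F (j1 + 1 + (L + 1 + l)) - N - 1"] that a(2)
      by (simp add: C_def)
  qed
  have \<gamma>: "\<gamma> l \<le> \<beta>" if "l < L" for l
  proof -
    have "F (j1 + 1 + l) + (L - l) \<le> F (j1 + 1 + l + (L - l))" by (rule F_gap) (use that u in simp)
    then show ?thesis using that by (simp add: \<gamma>_def \<beta>_def)
  qed
  have \<delta>: "\<beta> \<le> \<delta> l" if "l < L" for l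
  proof -
    have "F (j1 + 1 + L) + (1 + l) \<le> F (j1 + 1 + L + (1 + l))" by (rule F_gap) (use that u in simp)
    then show ?thesis by (simp add: \<delta>_def \<beta>_def add.assoc)
  qed
  \<comment> \<open>The total excess over consecutive candidates; both brackets are nonnegative
    because \<open>F\<close> is strictly increasing.\<close>
  define E where "E = (\<Sum>l<L. (\<beta> - \<gamma> l) + (\<delta> l - \<beta>))"
  define q where "q = (\<Sum>l<L. QRx (int (v + l)) (\<gamma> l) - QRx (int (v + l) + 1) (\<gamma> l))"
  have "(\<Sum>x<u. C x) = (\<Sum>x<j1. C x) + (C j1 + ((\<Sum>l<L. C (j1 + 1 + l)) + (C (j1 + 1 + L) + (\<Sum>l<L. C (j1 + 1 + (L + 1 + l))))
      + (C (j1 + 1 + (2 * L + 1)) + (\<Sum>l<rest. C (j1 + 1 + (2 * L + 1) + 1 + l)))))"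
    by (subst u) (simp only: sum_lessThan_add, simp add: add.assoc mult_2)
  moreover have "Den * int j1 \<le> (\<Sum>x<j1. C x)"
    using sum_bounded_below[of "{..<j1}" Den C] CD u by (simp add: mult.commute)
  moreover have "Den * int rest \<le> (\<Sum>l<rest. C (j1 + 1 + (2 * L + 1) + 1 + l))"
    using sum_bounded_below[of "{..<rest}" Den "\<lambda>l. C (j1 + 1 + (2 * L + 1) + 1 + l)"] CD u by (simp add: mult.commute)
  moreover have "(\<Sum>l<L. C (j1 + 1 + l)) + (\<Sum>l<L. C (j1 + 1 + (L + 1 + l))) = 6 * Den * int L + \<Delta> * E + q"
  proof -
    have "(\<Sum>l<L. C (j1 + 1 + l)) + (\<Sum>l<L. C (j1 + 1 + (L + 1 + l))) =
      (\<Sum>l<L. 6 * Den + \<Delta> * ((\<beta> - \<gamma> l) + (\<delta> l - \<beta>)) + (QRx (int (v + l)) (\<gamma> l) - QRx (int (v + l) + 1) (\<gamma> l)))"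
      unfolding sum.distrib[symmetric]
      by (rule sum.cong[OF refl]) (simp only: lessThan_iff Cs Ct, simp add: algebra_simps)
    also have "\<dots> = 6 * Den * int L + \<Delta> * E + q"
    proof -
      have "(\<Sum>l<L. 6 * Den + \<Delta> * e l + d l) = 6 * Den * int L + \<Delta> * (\<Sum>l<L. e l) + (\<Sum>l<L. d l)" for e d
        by (simp add: sum.distrib sum_distrib_left)
      then show ?thesis unfolding E_def q_def .
    qed
    finally show ?thesis .
  qed
  moreover have uj: "int u = int j1 + int rest + 2 * int L + 3" using u by simp
  ultimately have "Den * (int u - 2 * int L - 3) + Den * (1 + 3 * (int s + 1) + int h * (int (s div r) + 1))
      + (6 * Den * int L + \<Delta> * E + q) + (2 * Den + PQx (int x) \<beta>) + (2 * Den + RPx (int v) (int x)) \<le> (\<Sum>x<u. C x)"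
    unfolding uj C1 C2 Cp by (simp add: algebra_simps)
  then have small: "\<Delta> * E + q + PQx (int x) \<beta> + RPx (int v) (int x) < 0"
    using total unfolding C_def K_def by (simp add: algebra_simps)
  have PQ2: "\<bar>PQx (int x) \<beta>\<bar> \<le> 2 * W" and RP1: "\<bar>RPx (int v) (int x)\<bar> \<le> W" by (auto intro: PQx RPx)
  have qb: "\<bar>q\<bar> \<le> 2 * W * int L"
  proof -
    have "\<bar>q\<bar> \<le> (\<Sum>l<L. \<bar>QRx (int (v + l)) (\<gamma> l) - QRx (int (v + l) + 1) (\<gamma> l)\<bar>)" unfolding q_def by (rule sum_abs)
    also have "\<dots> \<le> (\<Sum>l<L. 2 * W)"
    proof (rule sum_mono)
      fix l
      show "\<bar>QRx (int (v + l)) (\<gamma> l) - QRx (int (v + l) + 1) (\<gamma> l)\<bar> \<le> 2 * W"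
        using QRx[of "int (v + l)" "\<gamma> l"] QRx[of "int (v + l) + 1" "\<gamma> l"] by linarith
    qed
    finally show ?thesis by (simp add: mult.commute)
  qed
  \<comment> \<open>A positive integer \<open>E\<close> would contribute at least
    \<open>\<Delta>\<close>, more than all graph terms can offset.\<close>
  have E0: "E = 0"
  proof (rule ccontr)
    assume "E \<noteq> 0"
    moreover have "0 \<le> E" unfolding E_def by (rule sum_nonneg) (use \<gamma> \<delta> in fastforce)
    ultimately have "\<Delta> * 1 \<le> \<Delta> * E" by (intro mult_left_mono) (use \<Delta> in auto)
    moreover have "2 * W * int L \<le> 2 * W * int r" using Lv W by (intro mult_left_mono) auto
    ultimately show False using small PQ2 RP1 qb \<Delta>(1) by (simp add: algebra_simps)
  qed
  have "\<gamma> l = \<beta>" if "l < L" for l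
  proof -
    have "(\<beta> - \<gamma> l) + (\<delta> l - \<beta>) = 0"
      using E0 unfolding E_def by (subst (asm) sum_nonneg_eq_0_iff) (use \<gamma> \<delta> that in fastforce)+
    then show ?thesis using \<gamma>[OF that] \<delta>[OF that] by simp
  qed
  then have "q = (\<Sum>l<L. QRx (int (v + l)) \<beta> - QRx (int (v + Suc l)) \<beta>)"
    unfolding q_def by (intro sum.cong) (auto simp: add.commute)
  also have "\<dots> = QRx (int v) \<beta> - QRx (int r) \<beta>"
    using sum_lessThan_telescope'[of "\<lambda>l. QRx (int (v + l)) \<beta>" L] Lv by simp
  also have "QRx (int r) \<beta> = 0" by (simp add: QRx_def)
  finally have neg: "QRx (int v) \<beta> + PQx (int x) \<beta> + RPx (int v) (int x) < 0" using small E0 by simp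
  have "\<bar>QRx (int v) \<beta>\<bar> \<le> W" by (rule QRx) simp
  \<comment> \<open>Otherwise \<open>PQx\<close> has its default \<open>2 * W\<close>, and the sum
    is not negative.\<close>
  then have cond: "int x < int sP \<and> int r \<le> \<beta> \<and> \<beta> < int r + int sQ"
    using neg RP1 by (auto simp: PQx_def split: if_splits)
  define q' where "q' = nat (\<beta> - int r)"
  have "q' < sQ" "x < sP" using cond by (auto simp: q'_def)
  moreover have "PQ x q' + QR q' v + RP v x < 0"
    using neg cond v by (simp add: PQx_def QRx_def RPx_def q'_def)
  ultimately show ?thesis using v by blast
qed

end

context gadget begin

theorem weighted_ed_iff:
  "cheap wi X Y (K * Den - 1) \<longleftrightarrow> (\<exists>p<sP. \<exists>q<sQ. \<exists>w<r. PQ p q + QR q w + RP w p < 0)"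
proof
  assume "cheap wi X Y (K * Den - 1)"
  then obtain A where A: "A \<in> alignments X Y" "icost wi A \<le> K * Den - 1" by (auto simp: cheap_def)
  obtain g where "matching (length X) (length Y) g"
    "icost wi A = (\<Sum>y<length Y. column wi X Y g y) + (\<Sum>x\<in>deleted (length X) g. wi (Some (X ! x)) None)"
    using matching_of_alignment[OF A(1)] by blast
  then interpret cheap_matching n r sP sQ PQ QR RP W g
    by unfold_locales (use A in auto)
  show "\<exists>p<sP. \<exists>q<sQ. \<exists>w<r. PQ p q + QR q w + RP w p < 0" by (rule negative)
qed (use cheap_negative in blast)

end

section \<open>The program\<close>

text \<open>Total correctness with an upper bound on the time: the exact time is hidden, and bounds
  add up under composition.\<close>

definition wpt :: "int \<Rightarrow> com \<Rightarrow> nat \<Rightarrow> (ram_state \<Rightarrow> bool) \<Rightarrow> ram_state \<Rightarrow> bool" where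
  "wpt B c k Q s \<longleftrightarrow> (\<exists>t s'. exec B c s t s' \<and> t \<le> k \<and> Q s')"

fun block :: "com list \<Rightarrow> com" where
  "block [] = Skip"
| "block (c # cs) = Seq c (block cs)"

lemma state_simps [simp]:
  "regs (set_reg x v s) y = (if y = x then v else regs s y)" "arrs (set_reg x v s) = arrs s"
  "regs (set_arr a i v s) = regs s"
  "arrs (set_arr a i v s) b j = (if b = a \<and> j = i then v else arrs s b j)"
  by (auto simp: set_reg_def set_arr_def)

lemma wpt_mono: "wpt B c k Q s \<Longrightarrow> k \<le> k' \<Longrightarrow> (\<And>s'. Q s' \<Longrightarrow> Q' s') \<Longrightarrow> wpt B c k' Q' s"
  unfolding wpt_def by (meson order_trans)

lemma wpt_Nil: "Q s \<Longrightarrow> wpt B (block []) 1 Q s"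
  unfolding wpt_def block.simps by (meson exec.Skip order_refl)

lemma wpt_Cons: "wpt B c k1 (wpt B (block cs) k2 Q) s \<Longrightarrow> wpt B (block (c # cs)) (k1 + k2) Q s"
  unfolding wpt_def block.simps by (meson exec.Seq add_mono)

text \<open>The worst case of a loop-free program. The value for a loop is a placeholder; loops are
  handled by \<open>wpt_While\<close>.\<close>

fun steps :: "com \<Rightarrow> nat" where
  "steps (Seq c1 c2) = steps c1 + steps c2"
| "steps (IfLess x y c1 c2) = 1 + max (steps c1) (steps c2)"
| "steps (WhileLess x y c) = 0"
| "steps _ = 1"

definition wp :: "int \<Rightarrow> com \<Rightarrow> (ram_state \<Rightarrow> bool) \<Rightarrow> ram_state \<Rightarrow> bool" where
  "wp B c Q s = wpt B c (steps c) Q s"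

lemma wpt_wp: "wp B c Q s \<Longrightarrow> steps c \<le> k \<Longrightarrow> wpt B c k Q s"
  unfolding wp_def by (rule wpt_mono)

lemma wp_mono: "wp B c Q s \<Longrightarrow> (\<And>s'. Q s' \<Longrightarrow> Q' s') \<Longrightarrow> wp B c Q' s"
  unfolding wp_def by (erule wpt_mono) auto

lemma wp_Const: "\<bar>v\<bar> \<le> B \<Longrightarrow> Q (set_reg x v s) \<Longrightarrow> wp B (Const x v) Q s"
  unfolding wp_def wpt_def steps.simps by (meson exec.Const order_refl)

lemma wp_Arith:
  assumes "\<And>v. v = apply_op f (regs s y) (regs s z) \<Longrightarrow> \<bar>v\<bar> \<le> B"
    "\<And>v. v = apply_op f (regs s y) (regs s z) \<Longrightarrow> Q (set_reg x v s)"
  shows "wp B (Arith f x y z) Q s"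
  unfolding wp_def wpt_def steps.simps using assms by (meson exec.Arith order_refl)

lemma wp_Load:
  assumes "\<And>v. v = arrs s a (regs s y) \<Longrightarrow> \<bar>v\<bar> \<le> B" "\<And>v. v = arrs s a (regs s y) \<Longrightarrow> Q (set_reg x v s)"
  shows "wp B (Load x a y) Q s"
  unfolding wp_def wpt_def steps.simps using assms by (meson exec.Load order_refl)

lemma wp_Store:
  assumes "\<And>v. v = regs s z \<Longrightarrow> \<bar>v\<bar> \<le> B"
    "\<And>i v. i = regs s y \<Longrightarrow> v = regs s z \<Longrightarrow> Q (set_arr a i v s)"
  shows "wp B (Store a y z) Q s"
  unfolding wp_def wpt_def steps.simps using assms by (meson exec.Store order_refl)

lemma wp_Nil: "Q s \<Longrightarrow> wp B (block []) Q s"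
  unfolding wp_def by (simp add: wpt_Nil[simplified])

lemma wp_Cons: "wp B c (wp B (block cs) Q) s \<Longrightarrow> wp B (block (c # cs)) Q s"
  unfolding wp_def using wpt_Cons[of B c "steps c" cs "steps (block cs)" Q s] by (simp add: wp_def[abs_def])

lemma wp_IfLess:
  assumes "regs s x < regs s y \<Longrightarrow> wp B c1 Q s" "\<not> regs s x < regs s y \<Longrightarrow> wp B c2 Q s"
  shows "wp B (IfLess x y c1 c2) Q s"
proof (cases "regs s x < regs s y")
  case True
  then obtain t s' where *: "exec B c1 s t s'" "t \<le> steps c1" "Q s'" using assms(1) by (auto simp: wp_def wpt_def)
  moreover have "1 + t \<le> steps (IfLess x y c1 c2)" using * by simp
  ultimately show ?thesis unfolding wp_def wpt_def using exec.IfTrue[OF True] by blast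
next
  case False
  then obtain t s' where *: "exec B c2 s t s'" "t \<le> steps c2" "Q s'" using assms(2) by (auto simp: wp_def wpt_def)
  moreover have "1 + t \<le> steps (IfLess x y c1 c2)" using * by simp
  ultimately show ?thesis unfolding wp_def wpt_def using exec.IfFalse[OF False] by blast
qed

definition IfEq :: "nat \<Rightarrow> nat \<Rightarrow> com \<Rightarrow> com \<Rightarrow> com" where
  "IfEq x y c1 c2 = IfLess x y c2 (IfLess y x c2 c1)"

lemma wp_IfEq:
  assumes "regs s x = regs s y \<Longrightarrow> wp B c1 Q s" "regs s x \<noteq> regs s y \<Longrightarrow> wp B c2 Q s"
  shows "wp B (IfEq x y c1 c2) Q s"
  unfolding IfEq_def by (intro wp_IfLess) (use assms in auto)

abbreviation IfConst :: "nat \<Rightarrow> int \<Rightarrow> com \<Rightarrow> com \<Rightarrow> com" where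
  "IfConst x v c1 c2 \<equiv> block [Const 49 v, IfEq x 49 c1 c2]"

text \<open>The invariant counts rounds, so the number of iterations is exact; each round pays one
  more step for its test.\<close>

lemma wpt_While:
  assumes body: "\<And>j s. j < n \<Longrightarrow> I j s \<Longrightarrow> wpt B c k (I (Suc j)) s"
    and guard: "\<And>j s. I j s \<Longrightarrow> regs s x < regs s y \<longleftrightarrow> j < n"
    and init: "I 0 s"
  shows "wpt B (WhileLess x y c) (n * (k + 1) + 1) (I n) s"
proof -
  have "j \<le> n \<Longrightarrow> I (n - j) s \<Longrightarrow> wpt B (WhileLess x y c) (j * (k + 1) + 1) (I n) s" for j s
  proof (induction j arbitrary: s)
    case 0
    then have "\<not> regs s x < regs s y" using guard by auto
    from exec.WhileFalse[OF this] 0 show ?case unfolding wpt_def by (intro exI conjI) auto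
  next
    case (Suc j)
    then have lt: "regs s x < regs s y" using guard by auto
    have "wpt B c k (I (Suc (n - Suc j))) s" using Suc.prems by (intro body) auto
    moreover have "Suc (n - Suc j) = n - j" using Suc.prems by simp
    ultimately obtain t1 s1 where 1: "exec B c s t1 s1" "t1 \<le> k" "I (n - j) s1" by (auto simp: wpt_def)
    then obtain t2 s2 where 2: "exec B (WhileLess x y c) s1 t2 s2" "t2 \<le> j * (k + 1) + 1" "I n s2"
      using Suc.IH[of s1] Suc.prems by (auto simp: wpt_def)
    have "exec B (WhileLess x y c) s (1 + t1 + t2) s2" using exec.WhileTrue[OF lt 1(1) 2(1)] .
    moreover have "1 + t1 + t2 \<le> Suc j * (k + 1) + 1" using 1 2 by simp
    ultimately show ?case unfolding wpt_def using 2(3) by blast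
  qed
  from this[of n] show ?thesis using init by simp
qed

lemmas wp_intros = wp_Cons wp_Nil wp_Arith wp_Load wp_Store wp_Const wp_IfLess wp_IfEq

text \<open>Registers 10 to 29 hold the parameters; from 30 on scratch, with results in register 38.\<close>

context gadget begin

text \<open>The measure for the numbers that the program handles. Two factors \<open>S\<close>
  suffice for products of indices and for \<open>Den\<close> times the surcharge of
  \<open>mm\<close>.\<close>

definition "scale = int S * int S * Den"
definition "M = 10 * S + 1"

definition par :: "ram_state \<Rightarrow> bool" where
  "par s \<longleftrightarrow> regs s 10 = int r \<and> regs s 11 = int sP \<and> regs s 12 = int sQ \<and> regs s 13 = int h \<and> regs s 14 = int nq
    \<and> regs s 15 = int N \<and> regs s 16 = int wsz \<and> regs s 17 = int T \<and> regs s 18 = int S \<and> regs s 19 = Den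
    \<and> regs s 20 = BIG \<and> regs s 21 = \<Delta> \<and> regs s 22 = 2 * W \<and> regs s 23 = 1 \<and> regs s 24 = int r + 1
    \<and> regs s 25 = int sl \<and> regs s 26 = int vl \<and> regs s 28 = 0 \<and> regs s 29 = int M"

text \<open>The third matrix is read from array 6, a copy, because array 2 receives the output
  numerators while the input is still being read.\<close>

definition inp :: "ram_state \<Rightarrow> bool" where
  "inp s \<longleftrightarrow> (\<forall>p<sP. \<forall>q<sQ. arrs s 0 (int (p * sQ + q)) = PQ p q)
    \<and> (\<forall>q<sQ. \<forall>v<r. arrs s 1 (int (q * r + v)) = QR q v)
    \<and> (\<forall>v<r. \<forall>p<sP. arrs s 6 (int (v * sP + p)) = RP v p)"

text \<open>What the routines for one weight preserve: below 38 lie the parameters, the counter 32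
  and the kinds and payloads of the two symbols.\<close>

definition frame :: "ram_state \<Rightarrow> ram_state \<Rightarrow> bool" where
  "frame s s' \<longleftrightarrow> (\<forall>x<38. regs s' x = regs s x) \<and> arrs s' = arrs s"

lemma par_set [simp]: "x < 10 \<or> 30 \<le> x \<Longrightarrow> par (set_reg x v s) = par s" "par (set_arr a i v s) = par s"
  by (auto simp: par_def)

lemma parD:
  assumes "par s"
  shows "regs s 10 = int r" "regs s 11 = int sP" "regs s 12 = int sQ" "regs s 13 = int h" "regs s 14 = int nq"
    "regs s 15 = int N" "regs s 16 = int wsz" "regs s 17 = int T" "regs s 18 = int S" "regs s 19 = Den"
    "regs s 20 = BIG" "regs s 21 = \<Delta>" "regs s 22 = 2 * W" "regs s 23 = 1" "regs s 24 = int r + 1"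
    "regs s 25 = int sl" "regs s 26 = int vl" "regs s 28 = 0" "regs s 29 = int M"
  using assms by (simp_all add: par_def)

lemma frame_set [simp]: "38 \<le> y \<Longrightarrow> frame s (set_reg y v s') = frame s s'"
  by (auto simp: frame_def)

lemma frame_set_left [simp]: "38 \<le> y \<Longrightarrow> frame (set_reg y v s) s' = frame s s'"
  by (auto simp: frame_def)

lemma frame_refl [simp]: "frame s s"
  by (simp add: frame_def)

definition frame45 :: "ram_state \<Rightarrow> ram_state \<Rightarrow> bool" where
  "frame45 s s' \<longleftrightarrow> (\<forall>x. x < 45 \<or> 47 < x \<longrightarrow> regs s' x = regs s x) \<and> arrs s' = arrs s"

lemma frame45_set [simp]: "45 \<le> y \<Longrightarrow> y \<le> 47 \<Longrightarrow> frame45 s (set_reg y v s') = frame45 s s'" "frame45 s s"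
  by (auto simp: frame45_def)

text \<open>Rewrites the final state of a lookup as three explicit updates, so that simplification
  can continue with arbitrary contents of the scratch registers.\<close>

lemma frame45D:
  assumes "frame45 s s'"
  shows "s' = set_reg 47 (regs s' 47) (set_reg 46 (regs s' 46) (set_reg 45 (regs s' 45) s))"
proof -
  have "regs s' = (regs s)(45 := regs s' 45, 46 := regs s' 46, 47 := regs s' 47)"
  proof
    fix x :: nat
    have "x < 45 \<or> 47 < x \<or> x = 45 \<or> x = 46 \<or> x = 47" by arith
    then show "regs s' x = ((regs s)(45 := regs s' 45, 46 := regs s' 46, 47 := regs s' 47)) x"
      using assms by (auto simp: frame45_def)
  qed
  then show ?thesis using assms by (simp add: frame45_def set_reg_def)
qed

lemma inp_set [simp]: "inp (set_reg x v s) = inp s"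
  by (simp add: inp_def)

lemma scale: "int S * int S \<le> scale" "int S * Den \<le> scale" "Den \<le> scale" "int S \<le> scale" "1 \<le> scale"
proof -
  have S: "1 \<le> int S" using S_pos by simp
  have SS: "int S * 1 \<le> int S * int S" by (rule mult_left_mono) (use S in auto)
  have "int S * int S * 1 \<le> int S * int S * Den" by (rule mult_left_mono) (use Den in auto)
  then show 1: "int S * int S \<le> scale" by (simp add: scale_def)
  have "int S * Den \<le> int S * int S * Den" by (rule mult_right_mono) (use SS Den in auto)
  then show 2: "int S * Den \<le> scale" by (simp add: scale_def)
  have "1 * Den \<le> int S * Den" by (rule mult_right_mono) (use S Den in auto)
  then show "Den \<le> scale" using 2 by simp
  show "int S \<le> scale" using 1 SS by simp
  then show "1 \<le> scale" using S by simp
qed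

lemma size_bounds:
  "r \<le> S" "sP \<le> S" "sQ \<le> S" "h \<le> S" "nq \<le> S" "u \<le> 3 * S" "sl \<le> S" "N \<le> 3 * S" "vl \<le> 8 * S" "wsz \<le> 11 * S" "T + 3 \<le> S" "h * r \<le> S" "n + 1 \<le> S"
proof -
  show "r \<le> S" "sP \<le> S" "sQ \<le> S" "h \<le> S" "nq \<le> S" "sl \<le> S" "T + 3 \<le> S" "n + 1 \<le> S"
    using r sP sQ rr le_trans[OF div_le_dividend[of n r], of "3 + 3 * n"] by (auto simp: S_def h_def nq_def sl_def T_def)
  show hr: "h * r \<le> S" using hr_le r by (simp add: S_def mult.commute)
  have "h * sl = 2 * (h * r) + 3 * h" by (simp add: sl_def distrib_left mult.commute)
  moreover have "h * r \<le> 2 * n" using hr_le r by (simp add: mult.commute)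
  moreover have "h \<le> n + 1" by (simp add: h_def)
  ultimately have "h * sl \<le> 7 * n + 3" by linarith
  then show u: "u \<le> 3 * S" by (simp add: u_def S_def)
  then show "N \<le> 3 * S" by (simp add: u_def N_def)
  then show vl: "vl \<le> 8 * S" using \<open>nq \<le> S\<close> S_def by (simp add: vl_def)
  show "wsz \<le> 11 * S" using u vl by (simp add: wsz_def)
qed

lemma K_bound: "K \<le> 50 * int S"
proof -
  have "3 * wsz + u + 2 * nq + 3 * T + h * r \<le> 50 * S" using size_bounds by linarith
  then have "int (3 * wsz + u + 2 * nq + 3 * T + h * r) \<le> int (50 * S)" by (rule of_nat_mono)
  then show ?thesis unfolding K_def by simp
qed

lemma BIG_bound: "BIG \<le> 50 * scale" "0 \<le> BIG"
proof -
  have "K * Den \<le> 50 * int S * Den" by (rule mult_right_mono) (use K_bound Den in auto)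
  then show "BIG \<le> 50 * scale" using scale(2) by (simp add: BIG_def)
  show "0 \<le> BIG" using BIG Den by simp
qed

end

section \<open>Computing one weight\<close>

locale machine = gadget +
  fixes B :: int
  assumes B: "1000 * scale \<le> B"
begin

lemma bounds:
  "int r \<le> int S" "int sP \<le> int S" "int sQ \<le> int S" "int h \<le> int S" "int nq \<le> int S" "int sl \<le> int S"
  "int N \<le> 3 * int S" "int vl \<le> 8 * int S" "int wsz \<le> 11 * int S" "int T + 3 \<le> int S" "int S \<le> scale" "int M = 10 * int S + 1" "2 * W \<le> Den" "1 \<le> W" "\<Delta> \<le> Den" "1 \<le> \<Delta>" "Den \<le> scale"
  "BIG \<le> 50 * scale" "0 \<le> BIG" "1 \<le> scale" "1 \<le> Den" "1000 * scale \<le> B"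
  using size_bounds scale Den W \<Delta> BIG_bound B by (simp_all add: M_def mult.commute)

definition "den_code = Arith Add 38 19 28"
definition "big_code = Arith Add 38 20 28"

lemma den_code: "par s \<Longrightarrow> Q (set_reg 38 Den s) \<Longrightarrow> wp B den_code Q s"
  unfolding den_code_def using bounds by (intro wp_Arith) (auto simp: par_def)

lemma big_code: "par s \<Longrightarrow> Q (set_reg 38 BIG s) \<Longrightarrow> wp B big_code Q s"
  unfolding big_code_def using bounds by (intro wp_Arith) (auto simp: par_def)

definition "mm_code = IfConst 33 4 (block [Arith Div 41 36 10, Arith Mul 43 41 10, Arith Sub 42 36 43,
  IfEq 34 42 (block [Arith Add 43 36 23, Const 44 3, Arith Mul 43 43 44, Arith Add 43 43 23, Arith Add 44 41 23,
    Arith Mul 44 44 13, Arith Add 43 43 44, Arith Mul 38 43 19]) big_code]) big_code"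

text \<open>This includes \<open>r = 0\<close>, where the quotient is 0. The last two bounds concern
  the weight of \<open>mm\<close> in the shape in which it arises from
  \<open>mm_code\<close>.\<close>

lemma kappa_bound:
  assumes "0 \<le> q" "q < int S"
  shows "0 \<le> q div int r" "q div int r \<le> q" "0 \<le> q div int r * int r" "q div int r * int r \<le> q" "0 \<le> q mod int r" "q mod int r \<le> q"
    "0 \<le> (q div int r + 1) * int h" "(q div int r + 1) * int h \<le> scale"
    "0 \<le> (4 + q * 3 + (q div int r + 1) * int h) * Den" "(4 + q * 3 + (q div int r + 1) * int h) * Den \<le> B"
proof -
  show 1: "0 \<le> q div int r" using assms by (cases "r = 0") (auto simp: pos_imp_zdiv_nonneg_iff)
  show m: "0 \<le> q mod int r" using assms by (cases "r = 0") auto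
  show "0 \<le> q div int r * int r" using 1 by simp
  show "q div int r * int r \<le> q" using m div_mult_mod_eq[of q "int r"] by linarith
  then show "q mod int r \<le> q" using 1 div_mult_mod_eq[of q "int r"] by (metis add_increasing order_refl mult_nonneg_nonneg of_nat_0_le_iff)
  show 2: "q div int r \<le> q" using assms zdiv_mono2[of q 1 "int r"] by (cases "r = 0") auto
  have "(q div int r + 1) * int h \<le> int S * int S"
    by (rule mult_mono) (use 1 2 assms bounds in auto)
  then show le: "(q div int r + 1) * int h \<le> scale" using scale(1) by simp
  show ge: "0 \<le> (q div int r + 1) * int h" using 1 by simp
  have 3: "1 + 3 * (q + 1) + int h * (q div int r + 1) \<le> 8 * (int S * int S)"
  proof -
    define x e where "x = int S * int S" and "e = int h * (q div int r + 1)"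
    have "int S * 1 \<le> x" unfolding x_def by (rule mult_left_mono) (use S_pos in auto)
    then have "int S \<le> x" by (simp only: mult_1_right)
    moreover have "1 \<le> int S" using S_pos by simp
    moreover have "e \<le> x"
      using \<open>(q div int r + 1) * int h \<le> int S * int S\<close> by (simp only: e_def x_def mult.commute)
    ultimately have "1 + 3 * (q + 1) + e \<le> 8 * x" using assms(2) by simp
    then show ?thesis by (simp only: e_def x_def)
  qed
  have eq: "(4 + q * 3 + (q div int r + 1) * int h) * Den = Den * (1 + 3 * (q + 1) + int h * (q div int r + 1))"
    by (simp add: algebra_simps)
  have "Den * (1 + 3 * (q + 1) + int h * (q div int r + 1)) \<le> Den * (8 * (int S * int S))"
    by (rule mult_left_mono[OF 3]) (use Den in auto)
  also have "\<dots> = 8 * scale" by (simp add: scale_def)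
  finally show "(4 + q * 3 + (q div int r + 1) * int h) * Den \<le> B" using bounds unfolding eq by simp
  show "0 \<le> (4 + q * 3 + (q div int r + 1) * int h) * Den"
    by (rule mult_nonneg_nonneg) (use Den ge assms in auto)
qed

lemma mm_code:
  assumes s: "par s" "regs s 33 = k" "regs s 34 = p" "regs s 36 = q" and q: "0 \<le> q" "q < int S"
  shows "wp B mm_code (\<lambda>s'. frame s s' \<and> regs s' 38 =
    (if k = 4 \<and> p = q mod int r then Den * (1 + 3 * (q + 1) + int h * (q div int r + 1)) else BIG)) s"
proof -
  note [simp] = parD[OF s(1)] s
  show ?thesis
    unfolding mm_code_def
    apply (intro wp_intros big_code)
    apply (simp_all add: minus_div_mult_eq_mod)
    using bounds(11,20,22) q kappa_bound[OF q]
    apply (simp_all only: abs_of_nonneg abs_le_iff)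
    by (linarith+)?
qed

lemma inpD:
  assumes "inp s"
  shows "0 \<le> x \<Longrightarrow> x < int sP \<Longrightarrow> int r \<le> b \<Longrightarrow> b < int r + int sQ \<Longrightarrow> arrs s 0 (x * int sQ + (b - int r)) = PQx x b"
    and "0 \<le> a \<Longrightarrow> a < int r \<Longrightarrow> int r \<le> g \<Longrightarrow> g < int r + int sQ \<Longrightarrow> arrs s 1 ((g - int r) * int r + a) = QRx a g"
    and "0 \<le> v \<Longrightarrow> v < int r \<Longrightarrow> 0 \<le> x \<Longrightarrow> x < int sP \<Longrightarrow> arrs s 6 (v * int sP + x) = RPx v x"
proof -
  have e: "int (nat x * m + nat y) = x * int m + y" if "0 \<le> x" "0 \<le> y" for x y m using that by simp
  show "arrs s 0 (x * int sQ + (b - int r)) = PQx x b" if "0 \<le> x" "x < int sP" "int r \<le> b" "b < int r + int sQ"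
  proof -
    have "nat x < sP" "nat (b - int r) < sQ" using that by auto
    then have "arrs s 0 (int (nat x * sQ + nat (b - int r))) = PQ (nat x) (nat (b - int r))"
      using assms unfolding inp_def by blast
    then show ?thesis using that e[of x "b - int r" sQ] by (simp add: PQx_def)
  qed
  show "arrs s 1 ((g - int r) * int r + a) = QRx a g" if "0 \<le> a" "a < int r" "int r \<le> g" "g < int r + int sQ"
  proof -
    have "nat a < r" "nat (g - int r) < sQ" using that by auto
    then have "arrs s 1 (int (nat (g - int r) * r + nat a)) = QR (nat (g - int r)) (nat a)"
      using assms unfolding inp_def by blast
    then show ?thesis using that e[of "g - int r" a r] by (simp add: QRx_def)
  qed
  show "arrs s 6 (v * int sP + x) = RPx v x" if "0 \<le> v" "v < int r" "0 \<le> x" "x < int sP"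
  proof -
    have "nat v < r" "nat x < sP" using that by auto
    then have "arrs s 6 (int (nat v * sP + nat x)) = RP (nat v) (nat x)"
      using assms unfolding inp_def by blast
    then show ?thesis using that e[of v x sP] by (simp add: RPx_def)
  qed
qed

lemma index_bound:
  assumes "0 \<le> x" "x < int S" "0 \<le> m" "m \<le> int S" "0 \<le> y" "y \<le> 2 * int S"
  shows "\<bar>x * m\<bar> \<le> B" "\<bar>x * m + y\<bar> \<le> B"
proof -
  have "x * m \<le> int S * int S" by (rule mult_mono) (use assms in auto)
  moreover have "0 \<le> x * m" using assms by simp
  ultimately show "\<bar>x * m\<bar> \<le> B" "\<bar>x * m + y\<bar> \<le> B" using scale(1) bounds(11,20,22) assms by linarith+
qed

definition "rp_code = IfLess 42 10 (IfLess 43 11 (block [Arith Mul 45 42 11, Arith Add 45 45 43, Load 45 6 45,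
  Arith Add 38 19 19, Arith Add 38 38 45]) (Arith Add 38 19 19)) (Arith Add 38 19 19)"

lemma rp_code:
  assumes s: "par s" "inp s" "regs s 42 = v" "regs s 43 = x" "0 \<le> v" "0 \<le> x"
    and Q: "\<And>s'. frame s s' \<Longrightarrow> regs s' 38 = 2 * Den + RPx v x \<Longrightarrow> Q s'"
  shows "wp B rp_code Q s"
proof -
  note [simp] = parD[OF s(1)] s inpD[OF s(2)]
  have w: "\<bar>RPx v x\<bar> \<le> W" using s by (intro RPx) auto
  have i: "\<bar>v * int sP\<bar> \<le> B \<and> \<bar>v * int sP + x\<bar> \<le> B" if "v < int r" "x < int sP"
  proof -
    have "0 \<le> v" "v < int S" "0 \<le> int sP" "int sP \<le> int S" "0 \<le> x" "x \<le> 2 * int S"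
      using that s(5,6) bounds(1,2,11) by linarith+
    then show ?thesis using index_bound by blast
  qed
  have z: "\<not> (v < int r \<and> x < int sP) \<Longrightarrow> RPx v x = 0" by (auto simp: RPx_def)
  show ?thesis
    unfolding rp_code_def
    apply (intro wp_intros)
    apply (simp_all add: Q z i i[THEN conjunct1, THEN abs_le_D1] i[THEN conjunct2, THEN abs_le_D1])
    using bounds(13,14,17,20,21,22) w by linarith+
qed

definition "ee_code = IfConst 33 6 (block [Arith Div 41 36 10, Arith Mul 43 41 10, Arith Sub 42 36 43,
  Arith Div 44 34 24, Arith Mul 45 44 24, Arith Sub 45 34 45,
  IfEq 45 42 (block [Arith Mul 43 41 13, Arith Add 43 43 44, rp_code]) big_code]) big_code"

lemma div_bounds:
  assumes "0 \<le> p" "p < int S"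
  shows "0 \<le> p div (int r + 1)" "p div (int r + 1) \<le> p" "0 \<le> p div (int r + 1) * (int r + 1)" "p div (int r + 1) * (int r + 1) \<le> p"
    "0 \<le> p mod (int r + 1)" "p mod (int r + 1) \<le> p" "p mod (int r + 1) \<le> int r"
proof -
  show 1: "0 \<le> p div (int r + 1)" using assms by (simp add: pos_imp_zdiv_nonneg_iff)
  show 2: "0 \<le> p mod (int r + 1)" by simp
  show "p mod (int r + 1) \<le> int r" using pos_mod_bound[of "int r + 1" p] by linarith
  show 3: "0 \<le> p div (int r + 1) * (int r + 1)" using 1 by simp
  show "p div (int r + 1) * (int r + 1) \<le> p" using 2 div_mult_mod_eq[of p "int r + 1"] by linarith
  show "p mod (int r + 1) \<le> p" using 3 div_mult_mod_eq[of p "int r + 1"] by linarith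
  show "p div (int r + 1) \<le> p" using zdiv_mono2[of p 1 "int r + 1"] assms by simp
qed

lemma ee_code:
  assumes s: "par s" "inp s" "regs s 33 = k" "regs s 34 = p" "regs s 36 = q" and q: "0 \<le> q" "q < int S" and p: "0 \<le> p" "p < int S"
  shows "wp B ee_code (\<lambda>s'. frame s s' \<and> regs s' 38 =
    (if k = 6 \<and> p mod (int r + 1) = q mod int r
     then 2 * Den + RPx (q mod int r) (q div int r * int h + p div (int r + 1)) else BIG)) s"
proof -
  note [simp] = parD[OF s(1)] s
  have k: "0 \<le> q div int r * int h" "q div int r * int h \<le> scale"
    using kappa_bound(1,7,8)[OF q] by (auto simp: distrib_right)
  show ?thesis
    unfolding ee_code_def
    apply (intro wp_intros big_code rp_code)
    apply (simp_all add: minus_div_mult_eq_mod)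
    using bounds(11,20,22) q p kappa_bound(1-6)[OF q] div_bounds[OF p] k
    apply (simp_all only: abs_of_nonneg abs_le_iff)
    by (linarith+)?
qed

text \<open>The registers are parameters because a weight of \<open>sg\<close> needs two lookups for
  one candidate, with adjacent vertices of \<open>R\<close>.\<close>

definition "qr_code x y = IfLess x 10 (IfLess y 10 (Const 45 0) (block [Arith Add 46 10 12, IfLess y 46
  (block [Arith Sub 47 y 10, Arith Mul 47 47 10, Arith Add 47 47 x, Load 45 1 47]) (Const 45 0)])) (Const 45 0)"

lemma qr_code_frame:
  assumes s: "par s" "inp s" "regs s x = a" "regs s y = g" "0 \<le> a" and xy: "x < 45" "y < 45"
    and Q: "\<And>s'. frame45 s s' \<Longrightarrow> regs s' 45 = QRx a g \<Longrightarrow> Q s'"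
  shows "wp B (qr_code x y) Q s"
proof -
  note [simp] = parD[OF s(1)] s inpD[OF s(2)] inpD(2)[OF s(2), unfolded One_nat_def]
  have w: "\<bar>QRx a g\<bar> \<le> W" using s by (intro QRx) auto
  have i: "\<bar>(g - int r) * int r\<bar> \<le> B \<and> \<bar>(g - int r) * int r + a\<bar> \<le> B" if "int r \<le> g" "g < int r + int sQ" "a < int r"
  proof -
    have "0 \<le> g - int r" "g - int r < int S" "0 \<le> int r" "int r \<le> int S" "0 \<le> a" "a \<le> 2 * int S"
      using that s(5) bounds(1,3,11) by linarith+
    then show ?thesis using index_bound by blast
  qed
  have z: "\<not> (a < int r \<and> int r \<le> g \<and> g < int r + int sQ) \<Longrightarrow> QRx a g = 0" by (auto simp: QRx_def)
  show ?thesis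
    unfolding qr_code_def
    apply (intro wp_intros)
    using xy
    apply (simp_all add: Q z i i[THEN conjunct1, THEN abs_le_D1] i[THEN conjunct2, THEN abs_le_D1])
    using bounds(1,3,11,13,14,17,20,21,22) w by (linarith+)?
qed

lemma qr_code:
  assumes "par s" "inp s" "0 \<le> regs s x" "x < 45" "y < 45"
    "\<And>a b. Q (set_reg 47 b (set_reg 46 a (set_reg 45 (QRx (regs s x) (regs s y)) s)))"
  shows "wp B (qr_code x y) Q s"
  by (rule qr_code_frame[OF assms(1,2) refl refl assms(3-5)]) (metis assms(6) frame45D)

definition "pq_code = IfLess 34 11 (IfLess 36 10 (Arith Add 45 22 28) (block [Arith Add 46 10 12, IfLess 36 46
  (block [Arith Mul 45 34 12, Arith Sub 46 36 10, Arith Add 45 45 46, Load 45 0 45]) (Arith Add 45 22 28)])) (Arith Add 45 22 28)"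

lemma pq_code_frame:
  assumes s: "par s" "inp s" "regs s 34 = p" "regs s 36 = q" "0 \<le> p" "0 \<le> q"
    and Q: "\<And>s'. frame45 s s' \<Longrightarrow> regs s' 45 = PQx p q \<Longrightarrow> Q s'"
  shows "wp B pq_code Q s"
proof -
  note [simp] = parD[OF s(1)] s inpD[OF s(2)]
  have w: "\<bar>PQx p q\<bar> \<le> 2 * W" using s by (intro PQx) auto
  have i: "\<bar>p * int sQ\<bar> \<le> B \<and> \<bar>p * int sQ + (q - int r)\<bar> \<le> B" if "int r \<le> q" "q < int r + int sQ" "p < int sP"
  proof -
    have "0 \<le> p" "p < int S" "0 \<le> int sQ" "int sQ \<le> int S" "0 \<le> q - int r" "q - int r \<le> 2 * int S"
      using that s(5) bounds(1,2,3,11) by linarith+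
    then show ?thesis using index_bound by blast
  qed
  have z: "\<not> (p < int sP \<and> int r \<le> q \<and> q < int r + int sQ) \<Longrightarrow> PQx p q = 2 * W" by (auto simp: PQx_def)
  show ?thesis
    unfolding pq_code_def
    apply (intro wp_intros)
    apply (simp_all add: Q z i i[THEN conjunct1, THEN abs_le_D1] i[THEN conjunct2, THEN abs_le_D1])
    using bounds(1,3,11,13,14,17,20,21,22) w by (linarith+)?
qed

lemma pq_code:
  assumes "par s" "inp s" "0 \<le> regs s 34" "0 \<le> regs s 36"
    "\<And>a b. Q (set_reg 47 b (set_reg 46 a (set_reg 45 (PQx (regs s 34) (regs s 36)) s)))"
  shows "wp B pq_code Q s"
  by (rule pq_code_frame[OF assms(1,2) refl refl assms(3,4)]) (metis assms(5) frame45D)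

definition "sg_code = IfLess 28 34 (block [Arith Add 43 36 24, Arith Sub 43 43 34, Arith Mul 44 21 43,
  Arith Add 38 19 19, Arith Add 38 38 38, Arith Sub 38 38 44, Arith Sub 44 34 23, qr_code 44 43, Arith Add 38 38 45,
  qr_code 34 43, Arith Sub 38 38 45]) big_code"

lemma Delta_bound: "\<bar>x\<bar> \<le> 2 * int S \<Longrightarrow> \<bar>\<Delta> * x\<bar> \<le> Den"
proof -
  assume "\<bar>x\<bar> \<le> 2 * int S"
  then have "\<Delta> * \<bar>x\<bar> \<le> \<Delta> * int (2 * S)" by (intro mult_left_mono) (use \<Delta> in auto)
  then show "\<bar>\<Delta> * x\<bar> \<le> Den" using \<Delta> by (simp add: Den_def abs_mult)
qed

lemma sg_code:
  assumes s: "par s" "inp s" "regs s 34 = p" "regs s 36 = q" and q: "0 \<le> q" "q < int S" and p: "0 \<le> p" "p < int S"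
  shows "wp B sg_code (\<lambda>s'. frame s s' \<and> regs s' 38 =
    (if 1 \<le> p then 4 * Den - \<Delta> * (q + int r + 1 - p)
      + (QRx (p - 1) (q + int r + 1 - p) - QRx p (q + int r + 1 - p)) else BIG)) s"
proof -
  note [simp] = parD[OF s(1)] s
  define g where "g = q + int r + 1 - p"
  have rS: "int r + 2 \<le> int S" using r by (simp add: S_def)
  have "\<bar>g\<bar> \<le> 2 * int S" using p q rS unfolding g_def by linarith
  then have D: "\<bar>\<Delta> * g\<bar> \<le> Den" "\<bar>g\<bar> \<le> 2 * int S" using Delta_bound by auto
  have w: "\<bar>QRx p g\<bar> \<le> W" "0 < p \<longrightarrow> \<bar>QRx (p - 1) g\<bar> \<le> W" using p by (auto intro!: QRx)
  have g: "q + (int r + 1) - p = g" "q + int r + 1 - p = g" by (simp_all add: g_def)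
  show ?thesis
    unfolding sg_code_def
    apply (intro wp_intros big_code qr_code)
    apply (simp_all add: g)
    using w D bounds(1,11,13,14,17,20,21,22) p q
    apply simp_all
    by (linarith+)?
qed

definition "qq_code = IfConst 33 4 sg_code (IfConst 33 5
  (block [pq_code, Arith Add 38 19 19, Arith Add 38 38 45])
  (IfConst 33 6 (block [Arith Div 44 34 24, Arith Mul 45 44 24, Arith Sub 45 34 45,
    IfLess 28 45 (block [Arith Sub 43 24 45, Arith Sub 43 36 43, Arith Mul 43 21 43, Arith Add 38 19 19,
      Arith Add 38 38 43]) big_code]) big_code))"

lemma qq_code:
  assumes s: "par s" "inp s" "regs s 33 = k" "regs s 34 = p" "regs s 36 = q" and q: "0 \<le> q" "q < int S" and p: "0 \<le> p" "p < int S"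
  shows "wp B qq_code (\<lambda>s'. frame s s' \<and> regs s' 38 =
    (if k = 4 \<and> 1 \<le> p then 4 * Den - \<Delta> * (q + int r + 1 - p)
      + (QRx (p - 1) (q + int r + 1 - p) - QRx p (q + int r + 1 - p))
     else if k = 5 then 2 * Den + PQx p q
     else if k = 6 \<and> 1 \<le> p mod (int r + 1) then 2 * Den + \<Delta> * (q - (int r + 1 - p mod (int r + 1)))
     else BIG)) s"
proof -
  note [simp] = parD[OF s(1)] s
  define g where "g = q - (int r + 1 - p mod (int r + 1))"
  have rS: "int r + 2 \<le> int S" using r by (simp add: S_def)
  have "\<bar>g\<bar> \<le> 2 * int S" using p q rS div_bounds(5,7)[OF p] unfolding g_def by linarith
  then have D: "\<bar>\<Delta> * g\<bar> \<le> Den" "\<bar>g\<bar> \<le> 2 * int S" using Delta_bound by auto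
  have w: "\<bar>PQx p q\<bar> \<le> 2 * W" using p by (intro PQx)
  have g: "q - (int r + 1 - p mod (int r + 1)) = g" by (simp add: g_def)
  show ?thesis
    unfolding qq_code_def
    apply (intro wp_intros big_code pq_code wp_mono[OF sg_code])
    apply (simp_all add: minus_div_mult_eq_mod g)
    using w D bounds(1,11,13,14,17,20,21,22) p q div_bounds[OF p]
    apply (simp_all only: abs_of_nonneg abs_le_iff)
    by (linarith | (intro conjI; linarith) | force split: if_splits)+
qed

definition "wn_code = IfConst 35 (-1) (IfConst 33 0 den_code (block [Const 49 6, IfLess 49 33 den_code big_code]))
  (IfConst 33 (-1) (IfConst 35 1 den_code (IfConst 35 7 den_code big_code))
  (IfConst 33 1 (IfConst 35 3 (block [Arith Sub 39 17 23, IfEq 36 39 den_code big_code]) den_code)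
  (IfConst 35 0 (block [Const 49 2, IfLess 49 33 (block [Const 49 7, IfLess 33 49 den_code big_code]) big_code])
  (IfEq 33 35 (IfConst 33 3 den_code (IfConst 33 5 den_code (block [Const 49 7, IfLess 49 33 den_code big_code])))
  (IfConst 35 8 mm_code (IfConst 35 9 ee_code (IfConst 35 7 qq_code big_code)))))))"

lemma wn_code:
  assumes s: "par s" "inp s" "regs s 33 = k" "regs s 34 = p" "regs s 35 = l" "regs s 36 = q"
    and q: "0 \<le> q" "q < int S" and p: "0 \<le> p" "p < int S"
  shows "wp B wn_code (\<lambda>s'. frame s s' \<and> regs s' 38 = wn k p l q) s"
proof -
  note [simp] = parD[OF s(1)] s
  show ?thesis
    unfolding wn_code_def
    apply (intro wp_intros big_code den_code wp_mono[OF mm_code] wp_mono[OF ee_code] wp_mono[OF qq_code])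
    apply (simp_all add: q p wn_def)
    using bounds(10,11,20,22)
    by (linarith+)?
qed

end

section \<open>The weight matrix\<close>

context machine begin

lemma frameD:
  "frame s s' \<Longrightarrow> par s' = par s \<and> arrs s' = arrs s \<and> regs s' 32 = regs s 32 \<and> regs s' 5 = regs s 5"
  by (simp add: frame_def par_def)

lemma M_bound: "int (M * M) \<le> B" "int (M * M) + 1 \<le> B"
proof -
  have "int (M * M) = 100 * (int S * int S) + 20 * int S + 1" by (simp add: M_def algebra_simps)
  then show "int (M * M) \<le> B" "int (M * M) + 1 \<le> B" using scale(1) bounds(11,20,22) by linarith+
qed

lemma wn_le:
  assumes "0 \<le> p" "p < int S" "0 \<le> q" "q < int S"
  shows "\<bar>wn k p l q\<bar> \<le> B"
proof -
  have 1: "\<bar>Den * (1 + 3 * (q + 1) + int h * (q div int r + 1))\<bar> \<le> B"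
  proof -
    have "(4 + q * 3 + (q div int r + 1) * int h) * Den = Den * (1 + 3 * (q + 1) + int h * (q div int r + 1))"
      by (simp add: algebra_simps)
    then show ?thesis using kappa_bound(9,10)[OF assms(3,4)] by (simp only: abs_of_nonneg)
  qed
  have 2: "\<bar>2 * Den + RPx (q mod int r) (q div int r * int h + p div (int r + 1))\<bar> \<le> B"
  proof -
    have "0 \<le> q div int r * int h + p div (int r + 1)" using kappa_bound(1)[OF assms(3,4)] div_bounds(1)[OF assms(1,2)] by simp
    then have "\<bar>RPx (q mod int r) (q div int r * int h + p div (int r + 1))\<bar> \<le> W"
      using kappa_bound(5)[OF assms(3,4)] by (intro RPx)
    then show ?thesis using bounds(13,14,17,20,21,22) by linarith
  qed
  have rS: "int r + 2 \<le> int S" using r by (simp add: S_def)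
  have 3: "\<bar>4 * Den - \<Delta> * (q + int r + 1 - p)
           + (QRx (p - 1) (q + int r + 1 - p) - QRx p (q + int r + 1 - p))\<bar> \<le> B" if "1 \<le> p"
  proof -
    have "\<bar>q + int r + 1 - p\<bar> \<le> 2 * int S" using assms rS by linarith
    from Delta_bound[OF this] show ?thesis
      using QRx[of "p - 1" "q + int r + 1 - p"] QRx[of p "q + int r + 1 - p"] that bounds(13,14,17,20,21,22)
      by linarith
  qed
  have 4: "\<bar>2 * Den + PQx p q\<bar> \<le> B"
    using PQx[of p q] assms bounds(13,14,17,20,21,22) by linarith
  have 5: "\<bar>2 * Den + \<Delta> * (q - (int r + 1 - p mod (int r + 1)))\<bar> \<le> B"
  proof -
    have "\<bar>q - (int r + 1 - p mod (int r + 1))\<bar> \<le> 2 * int S" using assms rS div_bounds(5,7)[OF assms(1,2)] by linarith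
    from Delta_bound[OF this] show ?thesis using bounds(13,14,17,20,21,22) by linarith
  qed
  have 6: "\<bar>Den\<bar> \<le> B" "\<bar>BIG\<bar> \<le> B" using bounds by auto
  show ?thesis
  proof (cases "1 \<le> p")
    case True
    show ?thesis unfolding wn_def
      by (simp only: 1 2 3[OF True] 4 5 6 simp_thms split: if_split)
  next
    case False
    then show ?thesis unfolding wn_def
      by (simp only: 1 2 4 5 6 simp_thms split: if_split)
  qed
qed

text \<open>The matrix as a linear array. Its row length \<open>M\<close> exceeds the alphabet size
  by one, for the empty string.\<close>

definition "wcode i = (if i div M = i mod M then 0 else
  wn ((int (i div M) - 1) div int S) ((int (i div M) - 1) mod int S)
     ((int (i mod M) - 1) div int S) ((int (i mod M) - 1) mod int S))"

lemma wcode: "a < M \<Longrightarrow> b < M \<Longrightarrow> wcode (a * M + b) = (if a = b then 0 else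
  wn ((int a - 1) div int S) ((int a - 1) mod int S) ((int b - 1) div int S) ((int b - 1) mod int S))"
  by (simp add: wcode_def)

definition "entry_code = block [Arith Div 30 32 29, Arith Mul 31 30 29, Arith Sub 31 32 31,
  Arith Sub 34 30 23, Arith Div 33 34 18, Arith Mul 35 33 18, Arith Sub 34 34 35,
  Arith Sub 36 31 23, Arith Div 35 36 18, Arith Mul 37 35 18, Arith Sub 36 36 37,
  IfEq 30 31 (Const 38 0) wn_code]"

lemma entry_code:
  assumes s: "par s" "inp s" "regs s 32 = int i" "i < M * M"
  shows "wp B entry_code (\<lambda>s'. par s' \<and> arrs s' = arrs s \<and> regs s' 32 = int i \<and> regs s' 5 = regs s 5
    \<and> regs s' 38 = wcode i) s"
proof -
  note [simp] = parD[OF s(1)] s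
  define a b where "a = int i div int M" and "b = int i mod int M"
  have M: "0 < M" by (simp add: M_def)
  have ab: "0 \<le> a" "a < int M" "0 \<le> b" "b < int M" "0 \<le> a * int M" "a * int M \<le> int i"
  proof -
    have "i div M < M" using s(4) M by (simp add: div_less_iff_less_mult)
    then show "a < int M" unfolding a_def by (simp flip: zdiv_int)
    show "0 \<le> a" "0 \<le> b" "b < int M" using M by (simp_all add: a_def b_def pos_imp_zdiv_nonneg_iff)
    then show "0 \<le> a * int M" by simp
    show "a * int M \<le> int i" using \<open>0 \<le> b\<close> div_mult_mod_eq[of "int i" "int M"] unfolding a_def b_def by linarith
  qed
  have eqs: "int i div int M = a" "int i - a * int M = b" by (simp_all add: a_def b_def minus_div_mult_eq_mod)
  have iM: "int i < int (M * M)" using s(4) by (simp only: of_nat_less_iff)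
  \<comment> \<open>At \<open>x = 0\<close>, the empty string, the quotient is -1 and its product
    with \<open>S\<close> is \<open>- S\<close>; the bounds allow for this.\<close>
  have d: "\<bar>(x - 1) div int S\<bar> \<le> x + 1" "\<bar>(x - 1) div int S * int S\<bar> \<le> x + int S" "0 \<le> (x - 1) mod int S" "(x - 1) mod int S < int S"
    if "0 \<le> x" for x
  proof -
    have m: "0 \<le> (x - 1) mod int S" "(x - 1) mod int S < int S" using S_pos by auto
    then show "0 \<le> (x - 1) mod int S" "(x - 1) mod int S < int S" by auto
    have e: "(x - 1) div int S * int S = x - 1 - (x - 1) mod int S" by (simp add: minus_mod_eq_div_mult)
    then show "\<bar>(x - 1) div int S * int S\<bar> \<le> x + int S" using m that by linarith
    have "-1 \<le> (x - 1) div int S" using zdiv_mono1[of "-1" "x - 1" "int S"] S_pos that by (simp add: div_eq_minus1)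
    moreover have "(x - 1) div int S \<le> x" if "x \<noteq> 0"
      using zdiv_mono2[of "x - 1" 1 "int S"] S_pos that \<open>0 \<le> x\<close> by simp
    moreover have "x = 0 \<Longrightarrow> (x - 1) div int S = -1" using S_pos by (simp add: div_eq_minus1)
    ultimately show "\<bar>(x - 1) div int S\<bar> \<le> x + 1" using that by linarith
  qed
  have e: "(x - 1) - (x - 1) div int S * int S = (x - 1) mod int S" for x by (simp add: minus_div_mult_eq_mod)
  have ai: "wcode i = (if a = b then 0 else wn ((a - 1) div int S) ((a - 1) mod int S) ((b - 1) div int S) ((b - 1) mod int S))"
  proof -
    have "int (i div M) = a" "int (i mod M) = b" by (simp_all add: a_def b_def zdiv_int zmod_int)
    moreover from this have "i div M = i mod M \<longleftrightarrow> a = b" by linarith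
    ultimately show ?thesis unfolding wcode_def by simp
  qed
  have x: "\<bar>x - 1\<bar> \<le> B" "\<bar>(x - 1) div int S\<bar> \<le> B" "\<bar>(x - 1) div int S * int S\<bar> \<le> B" "(x - 1) mod int S \<le> B" "x \<le> B"
    if "0 \<le> x" "x < int M" for x
    using d[OF that(1)] that bounds(11,12,20,22) by linarith+
  show ?thesis
    unfolding entry_code_def
    apply (intro wp_intros wp_mono[OF wn_code])
    apply (simp_all add: eqs e d ab ai x S_pos)
    using ab(6) iM M_bound(1) bounds(20,22) d(3,4)[OF ab(1)] d(3,4)[OF ab(3)]
    by (linarith | (auto dest!: frameD; fail))+
qed

lemma inp_arr [simp]: "a \<notin> {0, 1, 6} \<Longrightarrow> inp (set_arr a i v s) = inp s"
  by (auto simp: inp_def)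

definition "matrix_code = WhileLess 32 5 (block [entry_code, Store 2 32 38, Store 3 32 19, Arith Add 32 32 23])"

lemma matrix_code:
  assumes s: "par s" "inp s" "regs s 32 = 0" "regs s 5 = int (M * M)"
  shows "wpt B matrix_code (M * M * 201 + 1)
    (\<lambda>s'. par s' \<and> (\<forall>i<M * M. arrs s' 2 (int i) = wcode i \<and> arrs s' 3 (int i) = Den)) s"
proof -
  define I where "I = (\<lambda>j s. par s \<and> inp s \<and> regs s 32 = int j \<and> regs s 5 = int (M * M) \<and>
    (\<forall>i<j. arrs s 2 (int i) = wcode i \<and> arrs s 3 (int i) = Den))"
  have "wpt B matrix_code (M * M * (200 + 1) + 1) (I (M * M)) s"
    unfolding matrix_code_def
  proof (rule wpt_While)
    fix j s assume j: "j < M * M" and I: "I j s"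
    have s: "par s" "inp s" "regs s 32 = int j" "regs s 5 = int (M * M)"
      "\<forall>i<j. arrs s 2 (int i) = wcode i \<and> arrs s 3 (int i) = Den" using I by (auto simp: I_def)
    have w: "\<bar>wcode j\<bar> \<le> B" using wn_le S_pos bounds(20,22) by (simp add: wcode_def)
    have jB: "\<bar>int j + 1\<bar> \<le> B"
      using j M_bound(1) by (metis abs_of_nonneg of_nat_Suc add.commute of_nat_0_le_iff Suc_leI of_nat_le_iff order_trans)
    have D: "\<bar>Den\<bar> \<le> B" using bounds by simp
    show "wpt B (block [entry_code, Store 2 32 38, Store 3 32 19, Arith Add 32 32 23]) 200 (I (Suc j)) s"
    proof (rule wpt_wp)
      have step: "wp B (block [Store 2 32 38, Store 3 32 19, Arith Add 32 32 23]) (I (Suc j)) s'"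
        if post: "par s'" "arrs s' = arrs s" "regs s' 32 = int j" "regs s' 5 = regs s 5" "regs s' 38 = wcode j" for s'
      proof -
        have "inp s'" using s(2) post(2) by (simp add: inp_def)
        moreover have "arrs s' 2 (int i) = wcode i \<and> arrs s' 3 (int i) = Den" if "i < j" for i
          using s(5) post(2) that by simp
        ultimately show ?thesis
          using s(4) post jB w D parD(10,14)[OF post(1)]
          by (intro wp_intros) (simp_all add: I_def less_Suc_eq add.commute)
      qed
      show "wp B (block [entry_code, Store 2 32 38, Store 3 32 19, Arith Add 32 32 23]) (I (Suc j)) s"
        by (rule wp_Cons, rule wp_mono[OF entry_code[OF s(1-3) j]], rule step) blast+
      show "steps (block [entry_code, Store 2 32 38, Store 3 32 19, Arith Add 32 32 23]) \<le> 200"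
        unfolding entry_code_def wn_code_def mm_code_def ee_code_def qq_code_def sg_code_def qr_code_def pq_code_def
          rp_code_def den_code_def big_code_def IfEq_def
        by simp
    qed
  next
    fix j s assume "I j s"
    then show "regs s 32 < regs s 5 \<longleftrightarrow> j < M * M" unfolding I_def by (simp only: of_nat_less_iff)
  next
    show "I 0 s" using s by (simp add: I_def)
  qed
  then show ?thesis by (rule wpt_mono) (auto simp: I_def)
qed

definition "copy_code = WhileLess 32 5 (block [Load 38 2 32, Store 6 32 38, Arith Add 32 32 23])"

lemma row_major: "p < rows \<Longrightarrow> q < cols \<Longrightarrow> row_major rows cols m (int (p * cols + q)) = m p q"
proof -
  assume a: "p < rows" "q < cols"
  have "p * cols + q < (p + 1) * cols" using a by simp
  also have "\<dots> \<le> rows * cols" using a by (intro mult_le_mono1) simp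
  finally have "int (p * cols + q) < int rows * int cols" by (metis of_nat_less_iff of_nat_mult)
  then have c: "0 \<le> int (p * cols + q) \<and> int (p * cols + q) < int rows * int cols" by simp
  show ?thesis unfolding row_major_def if_P[OF c] nat_int using a by simp
qed

lemma copy_code:
  assumes s: "par s" "arrs s 0 = row_major sP sQ PQ" "arrs s 1 = row_major sQ r QR" "arrs s 2 = row_major r sP RP"
    and r32: "regs s 32 = 0" "regs s 5 = int (r * sP)"
  shows "wpt B copy_code (r * sP * 11 + 1) (\<lambda>s'. par s' \<and> inp s') s"
proof -
  define I where "I = (\<lambda>j s. par s \<and> regs s 32 = int j \<and> regs s 5 = int (r * sP) \<and>
    arrs s 0 = row_major sP sQ PQ \<and> arrs s 1 = row_major sQ r QR \<and> arrs s 2 = row_major r sP RP \<and>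
    (\<forall>i<j. arrs s 6 (int i) = row_major r sP RP (int i)))"
  have "r * sP \<le> S * S" using size_bounds by (intro mult_le_mono)
  then have rs: "int (r * sP) \<le> int S * int S" by (metis of_nat_mult of_nat_le_iff)
  have "wpt B copy_code (r * sP * (10 + 1) + 1) (I (r * sP)) s"
    unfolding copy_code_def
  proof (rule wpt_While)
    fix j s assume j: "j < r * sP" and I: "I j s"
    have sP0: "0 < sP" using j by (cases sP) auto
    have "j = (j div sP) * sP + j mod sP" by simp
    moreover have "j div sP < r" using j sP0 by (simp add: div_less_iff_less_mult)
    moreover have "j mod sP < sP" using sP0 by simp
    ultimately have "\<bar>row_major r sP RP (int j)\<bar> \<le> W" using row_major RP by metis
    then have w: "\<bar>row_major r sP RP (int j)\<bar> \<le> B" using bounds by linarith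
    have "int (Suc j) \<le> int (r * sP)" unfolding of_nat_le_iff using j by simp
    then have jB: "\<bar>int j + 1\<bar> \<le> B" using rs scale(1) bounds(20,22) by simp
    show "wpt B (block [Load 38 2 32, Store 6 32 38, Arith Add 32 32 23]) 10 (I (Suc j)) s"
    proof (rule wpt_wp)
      show "wp B (block [Load 38 2 32, Store 6 32 38, Arith Add 32 32 23]) (I (Suc j)) s"
        apply (intro wp_intros)
        using I w jB
        by (auto simp: I_def parD less_Suc_eq numeral_2_eq_2[symmetric])
    qed simp
  next
    fix j s assume "I j s"
    then show "regs s 32 < regs s 5 \<longleftrightarrow> j < r * sP" unfolding I_def by (simp only: of_nat_less_iff)
  next
    show "I 0 s" using s r32 by (simp add: I_def)
  qed
  then show ?thesis
  proof (rule wpt_mono)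
    fix s' assume I: "I (r * sP) s'"
    have "v * sP + p < r * sP" if "v < r" "p < sP" for v p
    proof -
      have "v * sP + p < (v + 1) * sP" using that by simp
      also have "\<dots> \<le> r * sP" using that by (intro mult_le_mono1) simp
      finally show ?thesis .
    qed
    then show "par s' \<and> inp s'" using I unfolding I_def inp_def using row_major by metis
  qed simp
qed

section \<open>Writing the strings\<close>

definition "lift_code kd x = block [Const 39 kd, Arith Mul 39 39 18, Arith Add 38 39 x]"

definition "symbol_code = block [Arith Div 30 32 16, Arith Mul 31 30 16, Arith Sub 31 32 31,
  IfLess 31 15 (Const 38 0) (block [Arith Sub 33 31 15, IfEq 33 28 (lift_code 8 30) (block [Arith Sub 33 33 23,
  IfLess 33 14 (lift_code 7 33) (IfEq 33 14 (lift_code 9 30) (IfLess 31 26 (Const 38 0)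
  (IfEq 31 26 (lift_code 3 30) (block [Arith Sub 33 31 26, Arith Sub 33 33 23, Arith Div 34 33 25, Arith Mul 35 34 25,
    Arith Sub 35 33 35, IfLess 10 35
      (IfEq 35 24 (block [Arith Div 36 30 10, Arith Mul 36 36 13, Arith Add 36 36 34, lift_code 5 36])
        (block [Arith Mul 36 34 24, Arith Add 36 36 10, Arith Add 36 36 10, Arith Add 36 36 23, Arith Add 36 36 23,
          Arith Sub 36 36 35, lift_code 6 36]))
      (lift_code 4 35)]))))])])]"

text \<open>The symbol at offset \<open>j\<close> of period \<open>t\<close> by arithmetic alone,
  with the tests of \<open>symbol_code\<close> in the same order. The \<open>ta\<close> symbols run
  backwards, so their index is \<open>2 * r + 2 - o'\<close>, spelled out as the program adds
  it.\<close>

definition zsym :: "int \<Rightarrow> int \<Rightarrow> int" where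
  "zsym t j = (if j < int N then 0 else if j = int N then 8 * int S + t
    else if j - int N - 1 < int nq then 7 * int S + (j - int N - 1)
    else if j - int N - 1 = int nq then 9 * int S + t
    else if j < int vl then 0 else if j = int vl then 3 * int S + t
    else let i = (j - int vl - 1) div int sl; o' = (j - int vl - 1) mod int sl in
      if int r < o' then if o' = int r + 1 then 5 * int S + (t div int r * int h + i)
        else 6 * int S + (i * (int r + 1) + int r + int r + 1 + 1 - o') else 4 * int S + o')"

lemma zsym_U: "zsym t (int vl) = 3 * int S + t"
  "0 \<le> m \<Longrightarrow> zsym t (int vl + 1 + m) = (let i = m div int sl; o' = m mod int sl in
      if int r < o' then if o' = int r + 1 then 5 * int S + (t div int r * int h + i)
        else 6 * int S + (i * (int r + 1) + int r + int r + 1 + 1 - o') else 4 * int S + o')"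
proof -
  have v: "int vl = 2 * int N + 2 + int nq" by (simp add: vl_def)
  show "zsym t (int vl) = 3 * int S + t" by (simp add: zsym_def v)
  assume m: "0 \<le> m"
  have "\<not> int vl + 1 + m < int N" "int vl + 1 + m \<noteq> int N" "\<not> int vl + 1 + m - int N - 1 < int nq"
    "int vl + 1 + m - int N - 1 \<noteq> int nq" "\<not> int vl + 1 + m < int vl" "int vl + 1 + m \<noteq> int vl"
    "int vl + 1 + m - int vl - 1 = m" using m v by linarith+
  then show "zsym t (int vl + 1 + m) = (let i = m div int sl; o' = m mod int sl in
      if int r < o' then if o' = int r + 1 then 5 * int S + (t div int r * int h + i)
        else 6 * int S + (i * (int r + 1) + int r + int r + 1 + 1 - o') else 4 * int S + o')"
    unfolding zsym_def by (simp only: if_False)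
qed

lemma zsym: "x < length Z \<Longrightarrow> int (Z ! x) = zsym (int x div int wsz) (int x mod int wsz)"
proof -
  assume x: "x < length Z"
  have dm: "int (t * wsz + j) div int wsz = int t" "int (t * wsz + j) mod int wsz = int j" if "j < wsz" for t j
    using that by (simp_all flip: zdiv_int zmod_int)
  have dms: "int (i * sl + k) div int sl = int i" "int (i * sl + k) mod int sl = int k" if "k < sl" for i k
    using that by (simp_all flip: zdiv_int zmod_int)
  from x show ?thesis
  proof (cases rule: Z_position)
    case (V t j)
    have z: "zsym (int t) (int j) = int (V t ! j)"
      using V(2)
    proof (cases rule: V_position[of _ t])
      case z
      then show ?thesis using V(2) vu by (auto simp: zsym_def)
    next
      case mm
      then show ?thesis by (simp add: zsym_def mm_def)
    next
      case (qq b)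
      then show ?thesis by (simp add: zsym_def qq_def)
    next
      case ee
      then show ?thesis by (simp add: zsym_def ee_def)
    qed
    have "j < wsz" using V(2) vu by simp
    show ?thesis unfolding V(4) z[symmetric] by (simp only: V(3) dm[OF \<open>j < wsz\<close>])
  next
    case (U t j)
    have z: "zsym (int t) (int (vl + j)) = int (U t ! j)"
      using U(2)
    proof (cases rule: U_position[of _ t])
      case al
      then show ?thesis by (simp add: zsym_U(1) al_def)
    next
      case (sg i a)
      define m where "m = int (i * sl + a)"
      have "m div int sl = int i" "m mod int sl = int a"
        using dms[of a i] sg(2) by (simp_all only: m_def) (simp_all add: sl_def)
      moreover have m: "0 \<le> m" "int (vl + j) = int vl + 1 + m" using sg(3) by (simp_all add: m_def)
      ultimately show ?thesis unfolding m(2) zsym_U(2)[OF m(1)] using sg(2,4) by (simp add: sg_def)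
    next
      case (pp i)
      define m where "m = int (i * sl + (r + 1))"
      have "m div int sl = int i" "m mod int sl = int r + 1"
        using dms[of "r + 1" i] by (simp_all only: m_def) (simp_all add: sl_def)
      moreover have m: "0 \<le> m" "int (vl + j) = int vl + 1 + m" using pp(2) by (simp_all add: m_def)
      ultimately show ?thesis unfolding m(2) zsym_U(2)[OF m(1)] using pp(3) by (simp add: pp_def zdiv_int)
    next
      case (ta i a)
      define m where "m = int (i * sl + (2 * r + 2 - a))"
      have "m div int sl = int i" "m mod int sl = int (2 * r + 2 - a)"
        using dms[of "2 * r + 2 - a" i] by (simp_all only: m_def) (simp_all add: sl_def)
      moreover have m: "0 \<le> m" "int (vl + j) = int vl + 1 + m" using ta(3) by (simp_all add: m_def)
      ultimately show ?thesis unfolding m(2) zsym_U(2)[OF m(1)] using ta(2,4) by (simp add: ta_def of_nat_diff distrib_left Let_def)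
    qed
    have "vl + j < wsz" "x = t * wsz + (vl + j)" using U(2,3) vu by (simp_all add: A_def)
    then show ?thesis unfolding U(4) z[symmetric] by (simp only: dm)
  qed
qed

lemma symbol_code:
  assumes s: "par s" "regs s 32 = int x" "x < length Z"
  shows "wp B symbol_code (\<lambda>s'. par s' \<and> arrs s' = arrs s \<and> regs s' 32 = int x \<and> regs s' 5 = regs s 5
    \<and> regs s' 38 = int (Z ! x)) s"
proof -
  note [simp] = parD[OF s(1)]
  define t j where "t = int x div int wsz" and "j = int x mod int wsz"
  have e: "int x div int wsz = t" "int x - t * int wsz = j" by (simp_all add: t_def j_def minus_div_mult_eq_mod)
  define i k where "i = (j - int vl - 1) div int sl" and "k = (j - int vl - 1) mod int sl"
  have e2: "(j - int vl - 1) div int sl = i" "j - int vl - 1 - i * int sl = k" by (simp_all add: i_def k_def minus_div_mult_eq_mod)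
  have w: "0 < wsz" using vu by simp
  have "x div wsz < S"
  proof -
    have "x < (T + 1) * wsz" using s(3) vu by (simp add: length_Z)
    then have "x div wsz < T + 1" using w by (simp add: div_less_iff_less_mult)
    then show ?thesis using size_bounds by simp
  qed
  then have t: "0 \<le> t" "t < int S" by (simp_all add: t_def flip: zdiv_int)
  have j: "0 \<le> j" "j < int wsz" using w by (simp_all add: j_def)
  have tw: "0 \<le> t * int wsz" "t * int wsz \<le> int x"
  proof -
    show "0 \<le> t * int wsz" using t by simp
    have "t * int wsz + j = int x" unfolding t_def j_def by (rule div_mult_mod_eq)
    then show "t * int wsz \<le> int x" using j by linarith
  qed
  have "int x < B"
  proof -
    have "x < (T + 1) * wsz" using s(3) vu by (simp add: length_Z)
    also have "\<dots> \<le> S * (11 * S)" by (rule mult_le_mono) (use size_bounds in auto)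
    finally have "int x < int (S * (11 * S))" by (simp only: of_nat_less_iff)
    then show ?thesis using scale(1) bounds(20,22) by simp
  qed
  have sl: "0 < int sl" "int r + 1 \<le> int sl" by (simp_all add: sl_def)
  have k: "0 \<le> k" "k < int sl" using sl by (simp_all add: k_def)
  have i: "0 \<le> i" "0 \<le> i * int sl" "i * int sl \<le> j" "i * (int r + 1) \<le> j" "0 \<le> i * (int r + 1)" "i \<le> j" if "int vl < j"
  proof -
    show i0: "0 \<le> i" unfolding i_def using that sl by (simp add: pos_imp_zdiv_nonneg_iff)
    then show "0 \<le> i * int sl" "0 \<le> i * (int r + 1)" by simp_all
    have "i * int sl + k = j - int vl - 1" unfolding i_def k_def by (rule div_mult_mod_eq)
    then show 1: "i * int sl \<le> j" using k by simp
    have "i * (int r + 1) \<le> i * int sl" by (rule mult_left_mono) (use i0 sl in auto)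
    then show 2: "i * (int r + 1) \<le> j" using 1 by linarith
    have "i * 1 \<le> i * (int r + 1)" by (rule mult_left_mono) (use i0 in auto)
    then show "i \<le> j" using 2 by linarith
  qed
  have i2: "0 \<le> i \<and> 0 \<le> i * int sl \<and> i * int sl \<le> j \<and> i * (int r + 1) \<le> j \<and> 0 \<le> i * (int r + 1) \<and> i \<le> j"
    if "\<not> j < int vl" "j \<noteq> int vl" using that i by simp
  have th: "0 \<le> t div int r" "t div int r \<le> t" "0 \<le> t div int r * int h" "t div int r * int h \<le> scale"
  proof -
    show 1: "0 \<le> t div int r" "t div int r \<le> t" using kappa_bound(1,2)[OF t] by auto
    then show "0 \<le> t div int r * int h" by simp
    have "(t div int r + 1) * int h \<le> scale" using kappa_bound(8)[OF t] .
    then show "t div int r * int h \<le> scale" by (simp add: distrib_right)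
  qed
  show ?thesis
    unfolding symbol_code_def lift_code_def
    apply (intro wp_intros)
    apply (simp_all add: s zsym[OF s(3)] t_def[symmetric] j_def[symmetric] e e2 zsym_def i_def[symmetric] k_def[symmetric] Let_def)
    using t j tw k th bounds(1,4,5,6,7,8,9,11,20,22) \<open>int x < B\<close>
    apply -
    by (linarith | (frule (1) i2, elim conjE, linarith))+
qed

end

text \<open>The value is supplied explicitly, which keeps register contents folded into named
  parameters and avoids nested arithmetic.\<close>

lemma wp_step:
  "apply_op f (regs s y) (regs s z) = v \<Longrightarrow> \<bar>v\<bar> \<le> B \<Longrightarrow> wp B (block cs) Q (set_reg x v s) \<Longrightarrow>
    wp B (block (Arith f x y z # cs)) Q s"
  by (rule wp_Cons, rule wp_Arith) auto

lemma wp_const_step: "\<bar>v\<bar> \<le> B \<Longrightarrow> wp B (block cs) Q (set_reg x v s) \<Longrightarrow> wp B (block (Const x v # cs)) Q s"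
  by (rule wp_Cons, rule wp_Const)

lemma wpt_seq:
  "wpt B c k1 P s \<Longrightarrow> (\<And>s'. P s' \<Longrightarrow> wpt B (block cs) k2 Q s') \<Longrightarrow> wpt B (block (c # cs)) (k1 + k2) Q s"
  by (rule wpt_Cons) (auto elim: wpt_mono)

lemma set_reg_self: "set_reg x (regs s x) s = s"
  by (simp add: set_reg_def)

text \<open>The bound \<open>W = (3 * n) ^ c\<close> must be computed from the input; as
  \<open>c\<close> is fixed, unrolled multiplications suffice.\<close>

lemma wp_power:
  assumes "regs s 22 = x ^ a" "regs s 36 = x" "\<And>i. i \<le> a + m \<Longrightarrow> \<bar>x ^ i\<bar> \<le> B"
  shows "wp B (block (replicate m (Arith Mul 22 22 36))) (\<lambda>s'. s' = set_reg 22 (x ^ (a + m)) s) s"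
  using assms
proof (induction m arbitrary: a s)
  case 0
  show ?case unfolding replicate_0 by (rule wp_Nil) (use "0.prems"(1) set_reg_self[of 22 s] in simp)
next
  case (Suc m)
  have "wp B (block (replicate m (Arith Mul 22 22 36))) (\<lambda>s'. s' = set_reg 22 (x ^ (Suc a + m)) (set_reg 22 (x ^ Suc a) s)) (set_reg 22 (x ^ Suc a) s)"
    by (rule Suc.IH) (use Suc.prems in auto)
  then have "wp B (block (replicate m (Arith Mul 22 22 36))) (\<lambda>s'. s' = set_reg 22 (x ^ (a + Suc m)) s) (set_reg 22 (x ^ Suc a) s)"
    by (rule wp_mono) (simp add: set_reg_def)
  moreover have "\<bar>x ^ Suc a\<bar> \<le> B" by (rule Suc.prems(3)) simp
  moreover have "apply_op Mul (regs s 22) (regs s 36) = x ^ Suc a" using Suc.prems(1,2) by (simp add: mult.commute)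
  ultimately show ?case unfolding replicate_Suc by (intro wp_step)
qed

lemma set_arr_other [simp]: "b \<noteq> a \<Longrightarrow> arrs (set_arr a i v s) b = arrs s b"
  by (simp add: set_arr_def)

context machine begin

lemma length_bound: "length Z + wsz + 1 \<le> 40 * (S * S)" "int (length Z) + int wsz + 1 \<le> B"
proof -
  have "1 \<le> wsz" by (simp add: wsz_def u_def)
  moreover have "(T + 3) * wsz = T * wsz + wsz + wsz + wsz" by (simp add: distrib_right)
  moreover have "length Z \<le> T * wsz + wsz" using vu by (simp add: length_Z)
  ultimately have "length Z + wsz + 1 \<le> (T + 3) * wsz" by linarith
  also have "\<dots> \<le> S * (11 * S)" by (rule mult_le_mono) (use size_bounds in auto)
  finally have 1: "length Z + wsz + 1 \<le> 11 * (S * S)" by simp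
  then show "length Z + wsz + 1 \<le> 40 * (S * S)" by simp
  have "int (length Z + wsz + 1) \<le> int (11 * (S * S))" using 1 by (simp only: of_nat_le_iff)
  then show "int (length Z) + int wsz + 1 \<le> B" using scale(1) bounds(20,22) by simp
qed

lemma symbol_bound: "x < 10 * S \<Longrightarrow> \<bar>int x\<bar> \<le> B"
  using bounds(11,20,22) by simp

text \<open>The common prefix goes to both output arrays. This overwrites the first two input
  matrices, so the weights have to be complete before.\<close>

definition "string_code = WhileLess 32 5 (block [symbol_code, Store 0 32 38, Store 1 32 38, Arith Add 32 32 23])"

lemma string_code:
  assumes s: "par s" "regs s 32 = 0" "regs s 5 = int (length Z)"
  shows "wpt B string_code (length Z * 101 + 1) (\<lambda>s'. par s' \<and> arrs s' 2 = arrs s 2 \<and> arrs s' 3 = arrs s 3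
    \<and> regs s' 32 = int (length Z) \<and> regs s' 5 = int (length Z)
    \<and> (\<forall>i<length Z. arrs s' 0 (int i) = int (Z ! i) \<and> arrs s' 1 (int i) = int (Z ! i))) s"
proof -
  define I where "I = (\<lambda>j s'. par s' \<and> arrs s' 2 = arrs s 2 \<and> arrs s' 3 = arrs s 3
    \<and> regs s' 32 = int j \<and> regs s' 5 = int (length Z)
    \<and> (\<forall>i<j. arrs s' 0 (int i) = int (Z ! i) \<and> arrs s' 1 (int i) = int (Z ! i)))"
  have "wpt B string_code (length Z * (100 + 1) + 1) (I (length Z)) s"
    unfolding string_code_def
  proof (rule wpt_While)
    fix j s1 assume j: "j < length Z" and I: "I j s1"
    have s1: "par s1" "regs s1 32 = int j" using I by (auto simp: I_def)
    have "Z ! j \<in> set X" using nth_mem[OF j] by (simp add: X_def)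
    then have "Z ! j < 10 * S" using set_XY(1) by auto
    then have w: "\<bar>int (Z ! j)\<bar> \<le> B" by (rule symbol_bound)
    have jB: "int j + 1 \<le> B" using j length_bound(2) by linarith
    show "wpt B (block [symbol_code, Store 0 32 38, Store 1 32 38, Arith Add 32 32 23]) 100 (I (Suc j)) s1"
    proof (rule wpt_wp)
      have step: "wp B (block [Store 0 32 38, Store 1 32 38, Arith Add 32 32 23]) (I (Suc j)) s'"
        if post: "par s'" "arrs s' = arrs s1" "regs s' 32 = int j" "regs s' 5 = regs s1 5" "regs s' 38 = int (Z ! j)" for s'
      proof -
        have "arrs s' 2 = arrs s 2" "arrs s' 3 = arrs s 3" "regs s' 5 = int (length Z)"
          using I post(2,4) by (auto simp: I_def)
        moreover have "arrs s' 0 (int i) = int (Z ! i) \<and> arrs s' 1 (int i) = int (Z ! i)" if "i < j" for i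
          using I post(2) that by (simp add: I_def)
        ultimately show ?thesis
          using post jB w parD(14)[OF post(1)]
          by (intro wp_intros) (auto simp: I_def less_Suc_eq add.commute)
      qed
      show "wp B (block [symbol_code, Store 0 32 38, Store 1 32 38, Arith Add 32 32 23]) (I (Suc j)) s1"
        by (rule wp_Cons, rule wp_mono[OF symbol_code[OF s1 j]], rule step) blast+
      show "steps (block [symbol_code, Store 0 32 38, Store 1 32 38, Arith Add 32 32 23]) \<le> 100"
        by (simp add: symbol_code_def lift_code_def IfEq_def)
    qed
  next
    fix j s assume "I j s"
    then show "regs s 32 < regs s 5 \<longleftrightarrow> j < length Z" unfolding I_def by (simp only: of_nat_less_iff)
  next
    show "I 0 s" using s by (simp add: I_def)
  qed
  then show ?thesis by (rule wpt_mono) (auto simp: I_def)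
qed

text \<open>The junk of \<open>Y\<close> lies one place further right, behind its marker. That
  marker is stored before this loop, the one of \<open>X\<close> after it.\<close>

definition "tail_code = WhileLess 32 5 (block [Store 0 32 18, Arith Add 34 32 23, Store 1 34 18, Arith Add 32 32 23])"

lemma tail_code:
  assumes s: "par s" "regs s 32 = int (length Z)" "regs s 5 = int (length Z + wsz)" "regs s 33 = 2 * int S"
    "\<And>i. i < length Z \<Longrightarrow> arrs s 0 (int i) = int (X ! i)" "\<And>i. i < length Z + 1 \<Longrightarrow> arrs s 1 (int i) = int (Y ! i)"
  shows "wpt B tail_code (wsz * 11 + 1) (\<lambda>s'. par s' \<and> arrs s' 2 = arrs s 2 \<and> arrs s' 3 = arrs s 3
    \<and> regs s' 32 = int (length Z + wsz) \<and> regs s' 33 = 2 * int S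
    \<and> (\<forall>i<length Z + wsz. arrs s' 0 (int i) = int (X ! i)) \<and> (\<forall>i<length Z + 1 + wsz. arrs s' 1 (int i) = int (Y ! i))) s"
proof -
  define I where "I = (\<lambda>j s'. par s' \<and> arrs s' 2 = arrs s 2 \<and> arrs s' 3 = arrs s 3
    \<and> regs s' 32 = int (length Z + j) \<and> regs s' 5 = int (length Z + wsz) \<and> regs s' 33 = 2 * int S
    \<and> (\<forall>i<length Z + j. arrs s' 0 (int i) = int (X ! i)) \<and> (\<forall>i<length Z + 1 + j. arrs s' 1 (int i) = int (Y ! i)))"
  have "wpt B tail_code (wsz * (10 + 1) + 1) (I wsz) s"
    unfolding tail_code_def
  proof (rule wpt_While)
    fix j s1 assume j: "j < wsz" and I: "I j s1"
    have jB: "int (length Z) + int j + 1 \<le> B" using j length_bound(2) by linarith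
    have SB: "int S \<le> B" using bounds(11,20,22) by linarith
    have p: "par s1" using I by (simp add: I_def)
    note [simp] = parD(9,14)[OF p]
    have XY: "X ! (length Z + j) = S" "Y ! (length Z + 1 + j) = S" using nth_XY(2,6)[OF j] by auto
    have E: "jj = Y ! i" if "int i = 1 + (int j + int (length Z))" for i
    proof -
      have "i = length Z + 1 + j" using that by linarith
      then show ?thesis using XY(2) by simp
    qed
    have 0: "\<forall>i<length Z + Suc j. (if int i = int (length Z + j) then int S else arrs s1 0 (int i)) = int (X ! i)"
      using I XY(1) by (auto simp: I_def less_Suc_eq)
    have 1: "\<forall>i<length Z + 1 + Suc j. (if int i = int (length Z + j) + 1 then int S else arrs s1 1 (int i)) = int (Y ! i)"
      using I XY(2) by (auto simp: I_def less_Suc_eq)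
    show "wpt B (block [Store 0 32 18, Arith Add 34 32 23, Store 1 34 18, Arith Add 32 32 23]) 10 (I (Suc j)) s1"
    proof (rule wpt_wp)
      show "wp B (block [Store 0 32 18, Arith Add 34 32 23, Store 1 34 18, Arith Add 32 32 23]) (I (Suc j)) s1"
        using I jB SB 0 1 E by (intro wp_intros) (simp_all add: I_def add.commute)
    qed simp
  next
    fix j s assume "I j s"
    then show "regs s 32 < regs s 5 \<longleftrightarrow> j < wsz" unfolding I_def by (simp only: of_nat_less_iff nat_add_left_cancel_less)
  next
    show "I 0 s" using s by (simp add: I_def)
  qed
  then show ?thesis by (rule wpt_mono) (auto simp: I_def)
qed

definition "param_code1 = block [Const 23 1, Const 28 0, Arith Add 10 3 28, Arith Add 11 1 28, Arith Add 12 2 28,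
  Arith Mul 17 10 10, Arith Div 13 0 10, Arith Add 13 13 23, Arith Add 24 10 23, Arith Add 14 0 10, Arith Add 14 14 10,
  Arith Add 25 10 10, Const 36 3, Arith Add 25 25 36, Arith Mul 15 13 25, Arith Add 27 15 23, Arith Add 26 15 15,
  Arith Add 26 26 23, Arith Add 26 26 23, Arith Add 26 26 14, Arith Add 16 26 27, Arith Mul 18 0 36, Arith Add 18 18 36,
  Arith Add 18 18 23, Const 34 10, Arith Mul 29 34 18, Arith Add 29 29 23, Arith Mul 36 36 0, Const 22 1]"

definition "param_code2 = block [Arith Add 37 25 23, Arith Mul 21 22 37, Arith Add 22 22 22, Arith Add 37 18 18,
  Arith Mul 19 21 37, Const 36 3, Arith Mul 37 16 36, Arith Add 37 37 27, Arith Add 37 37 14, Arith Add 37 37 14,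
  Arith Mul 38 17 36, Arith Add 37 37 38, Arith Mul 38 13 10, Arith Add 37 37 38, Arith Mul 20 37 19]"

lemma nat_bounds [simp]: "int r \<le> B" "int n \<le> B" "int sP \<le> B" "int sQ \<le> B" "int T \<le> B" "int h \<le> B" "int nq \<le> B" "int sl \<le> B"
  "int N \<le> B" "int u \<le> B" "int vl \<le> B" "int wsz \<le> B" "int S \<le> B" "int M \<le> B" "1000 \<le> B"
proof -
  have "int u \<le> 3 * int S" "int n \<le> int S" using size_bounds by (simp_all add: S_def)
  then show "int r \<le> B" "int n \<le> B" "int sP \<le> B" "int sQ \<le> B" "int T \<le> B" "int h \<le> B" "int nq \<le> B" "int sl \<le> B"
  "int N \<le> B" "int u \<le> B" "int vl \<le> B" "int wsz \<le> B" "int S \<le> B" "int M \<le> B" "1000 \<le> B"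
    using bounds(1-12,20,22) by linarith+
qed

lemma param_code1:
  assumes s: "regs s 0 = int n" "regs s 1 = int sP" "regs s 2 = int sQ" "regs s 3 = int r"
  shows "wp B param_code1 (\<lambda>s'. arrs s' = arrs s \<and> regs s' 36 = 3 * int n \<and> regs s' 22 = 1 \<and> regs s' 27 = int u
    \<and> regs s' 10 = int r \<and> regs s' 11 = int sP \<and> regs s' 12 = int sQ \<and> regs s' 13 = int h \<and> regs s' 14 = int nq
    \<and> regs s' 15 = int N \<and> regs s' 16 = int wsz \<and> regs s' 17 = int T \<and> regs s' 18 = int S
    \<and> regs s' 23 = 1 \<and> regs s' 24 = int r + 1 \<and> regs s' 25 = int sl \<and> regs s' 26 = int vl \<and> regs s' 28 = 0 \<and> regs s' 29 = int M) s"
proof -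
  have le: "int n div int r \<le> int n" using zdiv_mono2[of "int n" 1 "int r"] by (cases "r = 0") auto
  have S3: "3 * int n + 4 = int S" "10 * int S + 1 = int M" by (simp_all add: S_def M_def)
  have b: "\<bar>int n div int r\<bar> \<le> B" "\<bar>2 * int r\<bar> \<le> B" "\<bar>int n + int r\<bar> \<le> B" "\<bar>2 * int N\<bar> \<le> B" "\<bar>2 * int N + 1\<bar> \<le> B" "\<bar>2 * int N + 2\<bar> \<le> B"
    "\<bar>3 * int n\<bar> \<le> B" "\<bar>3 * int n + 3\<bar> \<le> B" "\<bar>10 * int S\<bar> \<le> B" "\<bar>int r + 1\<bar> \<le> B"
  proof -
    have "int n + 1 \<le> int S" using size_bounds by linarith
    then show "\<bar>int n div int r\<bar> \<le> B" "\<bar>2 * int r\<bar> \<le> B" "\<bar>int n + int r\<bar> \<le> B" "\<bar>2 * int N\<bar> \<le> B" "\<bar>2 * int N + 1\<bar> \<le> B" "\<bar>2 * int N + 2\<bar> \<le> B"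
    "\<bar>3 * int n\<bar> \<le> B" "\<bar>3 * int n + 3\<bar> \<le> B" "\<bar>10 * int S\<bar> \<le> B" "\<bar>int r + 1\<bar> \<le> B"
      using le bounds(1-12,20,22) zdiv_int[of n r] by linarith+
  qed
  show ?thesis
    unfolding param_code1_def
    apply (rule wp_const_step, simp add: order_trans[OF _ nat_bounds(15)])
    apply (rule wp_const_step, simp add: order_trans[OF _ nat_bounds(15)])
    apply (rule wp_step[where v = "int r"], simp add: s s(2)[unfolded One_nat_def], simp)
    apply (rule wp_step[where v = "int sP"], simp add: s s(2)[unfolded One_nat_def], simp)
    apply (rule wp_step[where v = "int sQ"], simp add: s s(2)[unfolded One_nat_def], simp)
    apply (rule wp_step[where v = "int T"], simp add: T_def, simp)
    apply (rule wp_step[where v = "int n div int r"], simp add: s s(2)[unfolded One_nat_def], rule b)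
    apply (rule wp_step[where v = "int h"], simp add: h_def zdiv_int, simp)
    apply (rule wp_step[where v = "int r + 1"], simp, rule b)
    apply (rule wp_step[where v = "int n + int r"], simp add: s s(2)[unfolded One_nat_def], rule b)
    apply (rule wp_step[where v = "int nq"], simp add: nq_def, simp)
    apply (rule wp_step[where v = "2 * int r"], simp, rule b)
    apply (rule wp_const_step, simp add: order_trans[OF _ nat_bounds(15)])
    apply (rule wp_step[where v = "int sl"], simp add: sl_def, simp)
    apply (rule wp_step[where v = "int N"], simp add: N_def, simp)
    apply (rule wp_step[where v = "int u"], simp add: vu, simp)
    apply (rule wp_step[where v = "2 * int N"], simp, rule b)
    apply (rule wp_step[where v = "2 * int N + 1"], simp, rule b)
    apply (rule wp_step[where v = "2 * int N + 2"], simp, rule b)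
    apply (rule wp_step[where v = "int vl"], simp add: vl_def, simp)
    apply (rule wp_step[where v = "int wsz"], simp add: wsz_def, simp)
    apply (rule wp_step[where v = "3 * int n"], simp add: s s(2)[unfolded One_nat_def], rule b)
    apply (rule wp_step[where v = "3 * int n + 3"], simp, rule b)
    apply (rule wp_step[where v = "int S"], simp add: S_def, simp)
    apply (rule wp_const_step, simp add: order_trans[OF _ nat_bounds(15)])
    apply (rule wp_step[where v = "10 * int S"], simp, rule b)
    apply (rule wp_step[where v = "int M"], simp add: M_def, simp)
    apply (rule wp_step[where v = "3 * int n"], simp add: s s(2)[unfolded One_nat_def], rule b)
    apply (rule wp_const_step, simp add: order_trans[OF _ nat_bounds(15)])
    apply (rule wp_Nil, simp)
    done
qed

lemma param_code2:
  assumes s: "regs s 22 = W" "regs s 27 = int u" "regs s 10 = int r" "regs s 11 = int sP" "regs s 12 = int sQ"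
    "regs s 13 = int h" "regs s 14 = int nq" "regs s 15 = int N" "regs s 16 = int wsz" "regs s 17 = int T" "regs s 18 = int S"
    "regs s 23 = 1" "regs s 24 = int r + 1" "regs s 25 = int sl" "regs s 26 = int vl" "regs s 28 = 0" "regs s 29 = int M"
  shows "wp B param_code2 (\<lambda>s'. arrs s' = arrs s \<and> par s') s"
proof -
  define e where "e = 3 * int wsz"
  have hr: "int h * int r \<le> int S" using size_bounds(12) by (metis of_nat_le_iff of_nat_mult)
  have hr0: "0 \<le> int h * int r" by simp
  have uS: "int u \<le> 3 * int S" using size_bounds by linarith
  have b: "\<bar>int sl + 1\<bar> \<le> B" "\<bar>\<Delta>\<bar> \<le> B" "\<bar>2 * W\<bar> \<le> B" "\<bar>2 * int S\<bar> \<le> B" "\<bar>Den\<bar> \<le> B" "\<bar>3 * int wsz\<bar> \<le> B" "\<bar>3 * int wsz + int u\<bar> \<le> B"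
    "\<bar>3 * int wsz + int u + int nq\<bar> \<le> B" "\<bar>3 * int wsz + int u + 2 * int nq\<bar> \<le> B" "\<bar>3 * int T\<bar> \<le> B"
    "\<bar>3 * int wsz + int u + 2 * int nq + 3 * int T\<bar> \<le> B" "\<bar>int h * int r\<bar> \<le> B" "\<bar>K\<bar> \<le> B" "\<bar>BIG\<bar> \<le> B"
    using bounds hr hr0 uS K_pos K_bound by linarith+
  show ?thesis
    unfolding param_code2_def
    apply (rule wp_step[where v = "int sl + 1"], simp add: s, rule b)
    apply (rule wp_step[where v = "\<Delta>"], simp add: s \<Delta>_def sl_def, rule b)
    apply (rule wp_step[where v = "2 * W"], simp add: s, rule b)
    apply (rule wp_step[where v = "2 * int S"], simp add: s, rule b)
    apply (rule wp_step[where v = "Den"], simp add: Den_def, rule b)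
    apply (rule wp_const_step, simp add: order_trans[OF _ nat_bounds(15)])
    apply (rule wp_step[where v = "3 * int wsz"], simp add: s, rule b)
    apply (rule wp_step[where v = "3 * int wsz + int u"], simp add: s, rule b)
    apply (rule wp_step[where v = "3 * int wsz + int u + int nq"], simp add: s, rule b)
    apply (rule wp_step[where v = "3 * int wsz + int u + 2 * int nq"], simp add: s, rule b)
    apply (rule wp_step[where v = "3 * int T"], simp add: s, rule b)
    apply (rule wp_step[where v = "3 * int wsz + int u + 2 * int nq + 3 * int T"], simp add: s, rule b)
    apply (rule wp_step[where v = "int h * int r"], simp add: s, rule b)
    apply (rule wp_step[where v = "K"], simp add: K_def, rule b)
    apply (rule wp_step[where v = "BIG"], simp add: BIG_def, rule b)
    apply (rule wp_Nil, simp add: par_def s)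
    done
qed

end

lemma steps_replicate [simp]: "steps (block (replicate m (Arith f x y z))) = m + 1"
  by (induction m) auto

section \<open>The whole program\<close>

context machine begin

definition "power_code c = block (replicate c (Arith Mul 22 22 36))"
definition "copy_init = block [Arith Mul 5 10 11, Const 32 0]"
definition "matrix_init = block [Arith Mul 5 29 29, Const 32 0]"
definition "string_init = block [Arith Mul 5 17 16, Arith Add 5 5 26, Const 32 0]"
definition "tail_init = block [Arith Add 5 5 16, Arith Add 33 18 18, Store 1 32 33]"
definition "finish_code = block [Store 0 32 33, Arith Add 1 32 23, Arith Add 2 1 28, Const 34 10, Arith Mul 0 34 18,
  Arith Sub 3 20 23, Arith Add 4 19 28]"

text \<open>No parameter of the locale occurs in it, so outside the locale it is one program for all
  inputs, depending on \<open>c\<close> only.\<close>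

definition "program c = block [param_code1, power_code c, param_code2, copy_init, copy_code, matrix_init, matrix_code,
  string_init, string_code, tail_init, tail_code, finish_code]"

definition "result s \<longleftrightarrow> regs s 0 = 10 * int S \<and> regs s 1 = int (length X) \<and> regs s 2 = int (length Y)
  \<and> regs s 3 = BIG - 1 \<and> regs s 4 = Den \<and> (\<forall>i<length X. arrs s 0 (int i) = int (X ! i))
  \<and> (\<forall>i<length Y. arrs s 1 (int i) = int (Y ! i)) \<and> (\<forall>i<M * M. arrs s 2 (int i) = wcode i \<and> arrs s 3 (int i) = Den)"

lemma index_bounds: "int (r * sP) \<le> B" "int (M * M) \<le> B" "int (T * wsz) \<le> B" "int (length Z) \<le> B" "int (length Z + wsz) \<le> B"
  "r * sP \<le> S * S" "M * M \<le> 121 * (S * S)" "wsz \<le> 11 * (S * S)" "length Z \<le> 40 * (S * S)"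
proof -
  have "1 \<le> S" using S_pos by simp
  then have "M \<le> 11 * S" by (simp add: M_def)
  then have "M * M \<le> 11 * S * (11 * S)" by (intro mult_le_mono)
  then show 1: "M * M \<le> 121 * (S * S)" by simp
  show 2: "r * sP \<le> S * S" using size_bounds by (intro mult_le_mono)
  show "length Z \<le> 40 * (S * S)" using length_bound(1) by simp
  have "11 * S * 1 \<le> 11 * S * S" by (intro mult_le_mono order_refl \<open>1 \<le> S\<close>)
  then have "11 * S \<le> 11 * (S * S)" by (simp only: mult.assoc mult_1_right)
  then show "wsz \<le> 11 * (S * S)" using size_bounds(10) by (rule order_trans[rotated])
  have "int (M * M) \<le> int (121 * (S * S))" using 1 by (simp only: of_nat_le_iff)
  then show "int (M * M) \<le> B" using scale(1) bounds(20,22) by simp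
  have "int (r * sP) \<le> int (S * S)" using 2 by (simp only: of_nat_le_iff)
  then show "int (r * sP) \<le> B" using scale(1) bounds(20,22) by simp
  show "int (length Z + wsz) \<le> B" using length_bound(2) by simp
  then show "int (length Z) \<le> B" by simp
  then show "int (T * wsz) \<le> B" by (simp add: length_Z)
qed

lemma program_correct:
  assumes s: "regs s 0 = int n" "regs s 1 = int sP" "regs s 2 = int sQ" "regs s 3 = int r"
    "arrs s 0 = row_major sP sQ PQ" "arrs s 1 = row_major sQ r QR" "arrs s 2 = row_major r sP RP"
    and W: "W = (3 * int n) ^ c" and pow: "\<And>i. i \<le> c \<Longrightarrow> \<bar>(3 * int n) ^ i\<bar> \<le> B"
  shows "wpt B (program c) (30000 * (S * S) + c + 200) result s"
proof -
  let ?P1 = "\<lambda>s'. arrs s' = arrs s \<and> regs s' 36 = 3 * int n \<and> regs s' 22 = 1 \<and> regs s' 27 = int u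
    \<and> regs s' 10 = int r \<and> regs s' 11 = int sP \<and> regs s' 12 = int sQ \<and> regs s' 13 = int h \<and> regs s' 14 = int nq
    \<and> regs s' 15 = int N \<and> regs s' 16 = int wsz \<and> regs s' 17 = int T \<and> regs s' 18 = int S
    \<and> regs s' 23 = 1 \<and> regs s' 24 = int r + 1 \<and> regs s' 25 = int sl \<and> regs s' 26 = int vl \<and> regs s' 28 = 0 \<and> regs s' 29 = int M"
  let ?P2 = "\<lambda>s'. \<exists>s1. ?P1 s1 \<and> s' = set_reg 22 W s1"
  let ?P3 = "\<lambda>s'. par s' \<and> arrs s' = arrs s"
  let ?P4 = "\<lambda>s'. ?P3 s' \<and> regs s' 32 = 0 \<and> regs s' 5 = int (r * sP)"
  let ?P5 = "\<lambda>s'. par s' \<and> inp s'"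
  let ?P6 = "\<lambda>s'. ?P5 s' \<and> regs s' 32 = 0 \<and> regs s' 5 = int (M * M)"
  let ?P7 = "\<lambda>s'. par s' \<and> (\<forall>i<M * M. arrs s' 2 (int i) = wcode i \<and> arrs s' 3 (int i) = Den)"
  let ?P8 = "\<lambda>s'. ?P7 s' \<and> regs s' 32 = 0 \<and> regs s' 5 = int (length Z)"
  let ?P9 = "\<lambda>s'. ?P7 s' \<and> regs s' 32 = int (length Z) \<and> regs s' 5 = int (length Z)
    \<and> (\<forall>i<length Z. arrs s' 0 (int i) = int (X ! i) \<and> arrs s' 1 (int i) = int (Y ! i))"
  let ?P10 = "\<lambda>s'. ?P7 s' \<and> regs s' 32 = int (length Z) \<and> regs s' 5 = int (length Z + wsz) \<and> regs s' 33 = 2 * int S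
    \<and> (\<forall>i<length Z. arrs s' 0 (int i) = int (X ! i)) \<and> (\<forall>i<length Z + 1. arrs s' 1 (int i) = int (Y ! i))"
  let ?P11 = "\<lambda>s'. ?P7 s' \<and> regs s' 32 = int (length Z + wsz) \<and> regs s' 33 = 2 * int S
    \<and> (\<forall>i<length Z + wsz. arrs s' 0 (int i) = int (X ! i)) \<and> (\<forall>i<length Z + 1 + wsz. arrs s' 1 (int i) = int (Y ! i))"
  have 1: "wpt B param_code1 40 ?P1 s"
    by (rule wpt_wp, rule param_code1) (simp_all add: s s(2)[unfolded One_nat_def] param_code1_def)
  have 2: "wpt B (power_code c) (c + 1) ?P2 s'" if "?P1 s'" for s'
    unfolding power_code_def W
  proof (rule wpt_wp, rule wp_mono)
    show "wp B (block (replicate c (Arith Mul 22 22 36))) (\<lambda>s''. s'' = set_reg 22 ((3 * int n) ^ (0 + c)) s') s'"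
      by (rule wp_power) (use that pow in auto)
    show "\<exists>s1. ?P1 s1 \<and> s'' = set_reg 22 ((3 * int n) ^ c) s1" if "s'' = set_reg 22 ((3 * int n) ^ (0 + c)) s'" for s''
      using that \<open>?P1 s'\<close> by (intro exI[of _ s']) simp
  qed simp
  have 3: "wpt B param_code2 20 ?P3 s'" if "?P2 s'" for s'
    by (rule wpt_wp, rule wp_mono, rule param_code2) (use that in \<open>auto simp: param_code2_def\<close>)
  have 4: "wpt B copy_init 10 ?P4 s'" if "?P3 s'" for s'
    unfolding copy_init_def
    by (rule wpt_wp, intro wp_intros)
      (use that index_bounds(1) nat_bounds(15) parD(1,2)[of s'] in \<open>simp_all add: order_trans[OF _ nat_bounds(15)]\<close>)
  have 5: "wpt B copy_code (r * sP * 11 + 1) ?P5 s'" if "?P4 s'" for s'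
    by (rule copy_code) (use that s in auto)
  have 6: "wpt B matrix_init 10 ?P6 s'" if "?P5 s'" for s'
    unfolding matrix_init_def
    by (rule wpt_wp, intro wp_intros)
      (use that index_bounds(2) parD(19)[of s'] in \<open>simp_all add: order_trans[OF _ nat_bounds(15)]\<close>)
  have 7: "wpt B matrix_code (M * M * 201 + 1) ?P7 s'" if "?P6 s'" for s'
    by (rule matrix_code) (use that in auto)
  have 8: "wpt B string_init 10 ?P8 s'" if "?P7 s'" for s'
    unfolding string_init_def
    by (rule wpt_wp, intro wp_intros)
      (use that index_bounds(3,4) parD(7,8,17)[of s'] in \<open>simp_all add: order_trans[OF _ nat_bounds(15)] length_Z\<close>)
  have 9: "wpt B string_code (length Z * 101 + 1) ?P9 s'" if "?P8 s'" for s'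
    by (rule wpt_mono[OF string_code order_refl]) (use that nth_XY(1,4) in auto)
  have 10: "wpt B tail_init 10 ?P10 s'" if P: "?P9 s'" for s'
  proof -
    have S2: "2 * int S \<le> B" using bounds(11,20,22) by linarith
    have "\<forall>i<length Z + 1. (if int i = int (length Z) then 2 * int S else arrs s' 1 (int i)) = int (Y ! i)"
      using P nth_XY(5) by (auto simp: less_Suc_eq)
    then show ?thesis
      unfolding tail_init_def using P index_bounds(5) S2 parD(7,9)[of s']
      by (intro wpt_wp wp_intros) (auto simp del: of_nat_add simp add: of_nat_add[symmetric])
  qed
  have 11: "wpt B tail_code (wsz * 11 + 1) ?P11 s'" if "?P10 s'" for s'
    by (rule wpt_mono[OF tail_code order_refl]) (use that in auto)
  have 12: "wpt B finish_code 10 result s'" if P: "?P11 s'" for s'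
  proof -
    have b: "2 * int S \<le> B" "int (length Z + wsz + 1) \<le> B" "10 * int S \<le> B" "\<bar>Den\<bar> \<le> B" "\<bar>BIG - 1\<bar> \<le> B" "10 \<le> B"
      using bounds length_bound(2) by simp_all
    have "\<forall>i<length X. (if int i = int (length Z + wsz) then 2 * int S else arrs s' 0 (int i)) = int (X ! i)"
      using P nth_XY(3) by (auto simp: length_XY less_Suc_eq)
    moreover have "\<forall>i<length Y. arrs s' 1 (int i) = int (Y ! i)" using P by (simp add: length_XY)
    ultimately show ?thesis
      unfolding finish_code_def using P b parD[of s']
      by (intro wpt_wp wp_intros) (auto simp: result_def length_XY)
  qed
  have le: "40 + ((c + 1) + (20 + (10 + ((r * sP * 11 + 1) + (10 + ((M * M * 201 + 1) + (10 + ((length Z * 101 + 1)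
      + (10 + ((wsz * 11 + 1) + (10 + 1))))))))))) \<le> 30000 * (S * S) + c + 200"
    using index_bounds(6-9) by linarith
  show ?thesis
    unfolding program_def
    apply (rule wpt_mono[OF _ le])
    apply (rule wpt_seq[OF 1], rule wpt_seq[OF 2], assumption, rule wpt_seq[OF 3], assumption, rule wpt_seq[OF 4], assumption,
        rule wpt_seq[OF 5], assumption, rule wpt_seq[OF 6], assumption, rule wpt_seq[OF 7], assumption, rule wpt_seq[OF 8], assumption,
        rule wpt_seq[OF 9], assumption, rule wpt_seq[OF 10], assumption, rule wpt_seq[OF 11], assumption, rule wpt_seq[OF 12], assumption)
    apply (erule wpt_Nil)
    apply assumption
    done
qed

end

section \<open>The reduction\<close>

context gadget begin

definition weight :: "nat option \<Rightarrow> nat option \<Rightarrow> real" where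
  "weight a b = of_int (wi a b) / of_int Den"

definition "threshold = (of_int (BIG - 1) / of_int Den :: real)"

lemma normalized_weight: "normalized \<Sigma> weight"
proof -
  have "0 < real_of_int Den" using Den by simp
  moreover have "1 \<le> weight a b" if "a \<noteq> b" for a b
    using wi_ge[OF that] \<open>0 < real_of_int Den\<close> by (simp add: weight_def)
  ultimately show ?thesis
    unfolding normalized_def by (auto simp: weight_def wi_nonneg)
qed

lemma weighted_ed_threshold:
  "weighted_ed weight X Y \<le> threshold \<longleftrightarrow> (\<exists>p<sP. \<exists>q<sQ. \<exists>v<r. PQ p q + QR q v + RP v p < 0)"
proof -
  have D: "0 < real_of_int Den" using Den by simp
  have "alignment_cost weight As = of_int (icost wi As) / of_int Den" for As
    by (rule alignment_cost_rational) (simp add: weight_def)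
  then have "alignment_cost weight As \<le> threshold \<longleftrightarrow> icost wi As \<le> K * Den - 1" for As
    using D by (simp only: threshold_def divide_le_cancel of_int_le_iff BIG_def) simp
  then show ?thesis unfolding weighted_ed_le_iff weighted_ed_iff[symmetric] cheap_def by simp
qed

text \<open>Two edits suffice: insert the marker before the junk and delete it behind.\<close>

lemma ed_XY: "ed X Y \<le> 4"
proof -
  define f :: "nat option \<Rightarrow> nat option \<Rightarrow> int" where "f = (\<lambda>a b. if a = b then 0 else 1)"
  have keep: "cheap f x x 0" for x by (rule cheap_refl) (simp add: f_def)
  have ins: "cheap f [] [hh] (1 * int (length [hh]))" by (rule cheap_insert) (simp add: f_def)
  have del: "cheap f [hh] [] (1 * int (length [hh]))" by (rule cheap_delete) (simp add: f_def)
  have "cheap f (Z @ [] @ replicate wsz jj @ [hh]) (Z @ [hh] @ replicate wsz jj @ []) 2"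
    by (rule cheap_append[OF keep cheap_append[OF ins cheap_append[OF keep del refl] refl]]) simp
  then have "cheap f X Y 2" by (simp add: X_def Y_def)
  then obtain As where A: "As \<in> alignments X Y" "icost f As \<le> 2" by (auto simp: cheap_def)
  have "alignment_cost (\<lambda>a b. if a = b then 0 else 1) As = of_int (icost f As) / 1"
    by (rule alignment_cost_rational) (simp add: f_def)
  then show ?thesis unfolding ed_def weighted_ed_le_iff using A by (intro bexI[of _ As]) auto
qed

lemma threshold_bounds: "0 \<le> threshold" "threshold \<le> 50 * real S"
proof -
  have D: "0 < real_of_int Den" using Den by simp
  have "0 \<le> BIG - 1" using BIG(1) Den(2) by linarith
  then have "0 \<le> real_of_int (BIG - 1)" by (simp only: of_int_0_le_iff)
  then show "0 \<le> threshold" unfolding threshold_def using D by simp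
  have "threshold \<le> real_of_int (K * Den) / real_of_int Den"
    unfolding threshold_def BIG_def using D by (intro divide_right_mono) simp_all
  also have "\<dots> = real_of_int K" using D by simp
  also have "\<dots> \<le> real_of_int (50 * int S)" using K_bound by (simp only: of_int_le_iff)
  finally show "threshold \<le> 50 * real S" by simp
qed

lemma length_XY_bound: "length X \<le> (T + 3) * (11 * S)" "length Y = length X"
proof -
  have "(T + 3) * wsz \<le> (T + 3) * (11 * S)" using size_bounds(10) by (rule mult_le_mono2)
  moreover have "(T + 3) * wsz = T * wsz + wsz + wsz + wsz" by (simp add: distrib_right)
  moreover have "1 \<le> wsz" "vl < wsz" using vu by linarith+
  ultimately show "length X \<le> (T + 3) * (11 * S)" unfolding length_X by linarith
qed (simp add: length_X length_Y)

text \<open>With \<open>m = n + 1 \<ge> 2\<close>, the exponent consists of 10 for the factor 1000,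
  3 for each \<open>S\<close>, \<open>3 * c\<close> for \<open>W\<close>, 3 for
  \<open>2 * r + 4\<close> and 4 for \<open>2 * S\<close>.\<close>

lemma scale_power:
  assumes "W = (3 * int n) ^ c"
  shows "1000 * scale \<le> (int n + 1) ^ (23 + 3 * c)"
proof -
  define m where "m = int n + 1"
  have m: "2 \<le> m" using n by (simp add: m_def)
  have "4 \<le> m * m" using mult_mono[OF m m] m by simp
  then have "4 * m \<le> m * m * m" by (rule mult_right_mono) (use m in simp)
  then have m3: "4 * m \<le> m ^ 3" by (simp add: power3_eq_cube)
  have 1: "1000 \<le> m ^ 10" using power_mono[OF m, of 10] by simp
  have 2: "int S \<le> m ^ 3" using m m3 by (simp add: S_def m_def)
  have 3: "2 * int r + 4 \<le> m ^ 3" using m m3 r by (simp add: m_def)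
  have 4: "W \<le> (m ^ 3) ^ c" unfolding assms using m m3 by (intro power_mono) (simp_all add: m_def)
  have 5: "2 * int S \<le> m ^ 3 * m" using mult_mono[OF 2 m] m by (simp add: mult.commute)
  have "scale = int S * int S * (W * (2 * int r + 4) * (2 * int S))"
    by (simp add: scale_def Den_def \<Delta>_def)
  also have "\<dots> \<le> m ^ 3 * m ^ 3 * ((m ^ 3) ^ c * m ^ 3 * (m ^ 3 * m))"
    using m W by (intro mult_mono 2 3 4 5) simp_all
  finally have "1000 * scale \<le> m ^ 10 * (m ^ 3 * m ^ 3 * ((m ^ 3) ^ c * m ^ 3 * (m ^ 3 * m)))"
    using 1 scale(5) by (intro mult_mono) simp_all
  also have "\<dots> = m ^ (10 + (3 + 3 + (3 * c + 3 + (3 + 1))))"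
    by (simp only: power_add power_mult power_one_right)
  also have "10 + (3 + 3 + (3 * c + 3 + (3 + 1))) = 23 + 3 * c" by simp
  finally show ?thesis by (simp add: m_def)
qed

end

context machine begin

lemma outputs_result:
  assumes "result s"
  shows "outputs s (10 * S) weight X Y threshold"
proof -
  have D: "0 < Den" using Den by simp
  have code: "sym_code a < M" if "a \<in> ext {..<10 * S}" for a
    using that by (auto simp: ext_def M_def)
  have inj: "sym_code a = sym_code b \<longleftrightarrow> a = b" for a b
    by (cases a; cases b) auto
  have entry: "let i = int (sym_code a * (10 * S + 1) + sym_code b) in
      0 < arrs s 3 i \<and> weight a b = of_int (arrs s 2 i) / of_int (arrs s 3 i)"
    if ab: "a \<in> ext {..<10 * S}" "b \<in> ext {..<10 * S}" for a b
  proof -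
    let ?i = "sym_code a * M + sym_code b"
    have "?i < (sym_code a + 1) * M" using code[OF ab(2)] by simp
    also have "\<dots> \<le> M * M" using code[OF ab(1)] by (intro mult_le_mono1) simp
    finally have "arrs s 2 (int ?i) = wcode ?i" "arrs s 3 (int ?i) = Den"
      using assms by (auto simp: result_def)
    moreover have "wcode ?i = wi a b"
      by (simp only: wcode[OF code[OF ab(1)] code[OF ab(2)]] wi_def inj)
    ultimately show ?thesis
      using D unfolding M_def[symmetric] Let_def by (simp only: weight_def)
  qed
  show ?thesis
    unfolding outputs_def using assms D entry by (auto simp: result_def threshold_def)
qed

lemma power_bound: "W = (3 * int n) ^ c \<Longrightarrow> i \<le> c \<Longrightarrow> \<bar>(3 * int n) ^ i\<bar> \<le> B"
proof -
  assume W: "W = (3 * int n) ^ c" "i \<le> c"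
  have "(3 * int n) ^ i \<le> W" unfolding W(1) using n W(2) by (intro power_increasing) simp_all
  moreover have "W \<le> B" using bounds by linarith
  ultimately show ?thesis by simp
qed

end

text \<open>From \<open>S \<le> 7 * n\<close> the time is at most
  \<open>30000 * 49 + c + 200\<close> times \<open>n * n\<close>, which yields \<open>C\<close>. The
  smaller constants are \<open>50 * 7\<close> for the threshold and \<open>4 * 11 * 7\<close> for
  the lengths.\<close>

lemma reduction:
  fixes \<beta> :: real and c n :: nat and G :: tripartite
  defines "C \<equiv> real (1500000 + c)"
  assumes "0 \<le> \<beta>" "\<beta> \<le> 1" and n: "1 \<le> n" and G: "weights_within c G" "size_P G \<le> n" "size_Q G \<le> n"
    and R: "real (size_R G) \<le> real n powr (\<beta> / 2)"
  shows "\<exists>t s \<sigma> w X Y k.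
       exec ((int n + 1) ^ (23 + 3 * c)) (machine.program c) (input_state n G) t s \<and> real t \<le> C * real n ^ 2 \<and>
       outputs s \<sigma> w X Y k \<and>
       real \<sigma> \<le> C * real n \<and>
       normalized {..<\<sigma>} w \<and>
       set X \<subseteq> {..<\<sigma>} \<and> real (length X) \<le> C * real n powr (1 + \<beta>) \<and>
       set Y \<subseteq> {..<\<sigma>} \<and> real (length Y) \<le> C * real n powr (1 + \<beta>) \<and>
       ed X Y \<le> 4 \<and>
       0 \<le> k \<and> k \<le> C * real n \<and>
       (has_negative_triangle G \<longleftrightarrow> weighted_ed w X Y \<le> k)"
proof -
  define r where "r = size_R G"
  have "real r * real r \<le> real n powr (\<beta> / 2) * real n powr (\<beta> / 2)"
    using R by (intro mult_mono) (auto simp: r_def)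
  \<comment> \<open>Squaring the bound on \<open>R\<close> turns \<open>\<beta> / 2\<close> into
    \<open>\<beta>\<close>: the number of periods is at most \<open>n powr \<beta>\<close>.\<close>
  then have r\<beta>: "real (r * r) \<le> real n powr \<beta>" by (simp flip: powr_add)
  also have "\<dots> \<le> real n powr 1" using assms(2,3) n by (intro powr_mono) auto
  finally have "real (r * r) \<le> real n" using n by simp
  then have rr: "r * r \<le> n" by (simp only: of_nat_le_iff)
  then have "r \<le> n" by (cases r) auto
  \<comment> \<open>The graph has at most \<open>3 * n\<close> vertices, so this bounds all its
    weights, and the program can compute it.\<close>
  define W where "W = (3 * int n) ^ c"
  have W: "1 \<le> W" unfolding W_def using n by (intro one_le_power) simp
  have "num_vertices G \<le> 3 * n" using G \<open>r \<le> n\<close> by (simp add: num_vertices_def r_def)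
  then have "int (num_vertices G) ^ c \<le> W" unfolding W_def by (intro power_mono) auto
  then have wt: "\<bar>x\<bar> \<le> W" if "\<bar>x\<bar> \<le> int (num_vertices G) ^ c" for x
    using that by linarith
  interpret g: gadget n r "size_P G" "size_Q G" "wt_PQ G" "wt_QR G" "wt_RP G" W
    by unfold_locales (use G n rr W in \<open>auto intro!: wt simp: weights_within_def r_def\<close>)
  interpret g: machine n r "size_P G" "size_Q G" "wt_PQ G" "wt_QR G" "wt_RP G" W "(int n + 1) ^ (23 + 3 * c)"
    by unfold_locales (rule g.scale_power[OF W_def])
  have "wpt ((int n + 1) ^ (23 + 3 * c)) (machine.program c) (30000 * (g.S * g.S) + c + 200) g.result (input_state n G)"
    by (rule g.program_correct[OF _ _ _ _ _ _ _ W_def g.power_bound[OF W_def]]) (simp_all add: input_state_def r_def)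
  then obtain t s where ex: "exec ((int n + 1) ^ (23 + 3 * c)) (machine.program c) (input_state n G) t s"
    and t: "t \<le> 30000 * (g.S * g.S) + c + 200" and res: "g.result s"
    by (auto simp: wpt_def)
  have S: "g.S \<le> 7 * n" using n by (simp add: g.S_def)
  have SS: "g.S * g.S \<le> 49 * (n * n)" using mult_le_mono[OF S S] by simp
  have nn: "1 \<le> n * n" using n by simp
  have "t \<le> 30000 * (g.S * g.S) + (c + 200) * 1" using t by simp
  also have "\<dots> \<le> 30000 * (49 * (n * n)) + (c + 200) * (n * n)" by (intro add_mono mult_le_mono2 SS nn)
  also have "\<dots> \<le> (1500000 + c) * (n * n)" by (simp add: distrib_right)
  finally have time: "real t \<le> C * real n ^ 2"
    unfolding C_def power2_eq_square by (metis of_nat_le_iff of_nat_mult)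
  have Cn: "real x \<le> C * real n" if "x \<le> 350 * n" for x
  proof -
    have "350 * real n \<le> C * real n" by (rule mult_right_mono) (simp_all add: C_def)
    moreover have "real x \<le> real (350 * n)" using that by (simp only: of_nat_le_iff)
    ultimately show ?thesis by simp
  qed
  have n\<beta>: "1 \<le> real n powr \<beta>" using n assms(2) by (simp add: ge_one_powr_ge_zero)
  have "real (length g.X) \<le> real ((g.T + 3) * (11 * g.S))" using g.length_XY_bound(1) by (simp only: of_nat_le_iff)
  also have "\<dots> = (real (r * r) + 3) * (11 * real g.S)" by (simp add: g.T_def)
  also have "\<dots> \<le> (4 * real n powr \<beta>) * (11 * real (7 * n))"
    using r\<beta> n\<beta> S by (intro mult_mono) (simp_all del: of_nat_mult)
  also have "\<dots> = 308 * real n powr (1 + \<beta>)" using n by (simp add: powr_add)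
  also have "\<dots> \<le> C * real n powr (1 + \<beta>)" by (intro mult_right_mono) (simp_all add: C_def)
  finally have len: "real (length g.X) \<le> C * real n powr (1 + \<beta>)" .
  have "g.threshold \<le> real (50 * g.S)" using g.threshold_bounds(2) by simp
  also have "\<dots> \<le> C * real n" by (rule Cn) (use S in simp)
  finally have thr: "g.threshold \<le> C * real n" .
  have iff: "has_negative_triangle G \<longleftrightarrow> weighted_ed g.weight g.X g.Y \<le> g.threshold"
    unfolding g.weighted_ed_threshold by (simp add: has_negative_triangle_def r_def)
  have \<sigma>: "real (10 * g.S) \<le> C * real n" by (rule Cn) (use S in simp)
  show ?thesis
    by (rule exI[of _ t], rule exI[of _ s], rule exI[of _ "10 * g.S"], rule exI[of _ g.weight], rule exI[of _ g.X],
        rule exI[of _ g.Y], rule exI[of _ g.threshold])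
      (use ex time g.outputs_result[OF res] \<sigma> g.normalized_weight g.set_XY len g.length_XY_bound(2) g.ed_XY
        g.threshold_bounds(1) thr iff in simp)
qed

theorem theoremC2:
  fixes \<beta> :: real and c :: nat
  assumes "0 \<le> \<beta>" and "\<beta> \<le> 1"
  shows "\<exists>(prog :: com) (d :: nat) (C :: real). \<forall>(n :: nat) (G :: tripartite).
    1 \<le> n \<and> weights_within c G \<and>
    size_P G \<le> n \<and> size_Q G \<le> n \<and> real (size_R G) \<le> real n powr (\<beta> / 2) \<longrightarrow>
    (\<exists>t s \<sigma> w X Y k.
       exec ((int n + 1) ^ d) prog (input_state n G) t s \<and> real t \<le> C * real n ^ 2 \<and>
       outputs s \<sigma> w X Y k \<and>
       real \<sigma> \<le> C * real n \<and>
       normalized {..<\<sigma>} w \<and>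
       set X \<subseteq> {..<\<sigma>} \<and> real (length X) \<le> C * real n powr (1 + \<beta>) \<and>
       set Y \<subseteq> {..<\<sigma>} \<and> real (length Y) \<le> C * real n powr (1 + \<beta>) \<and>
       ed X Y \<le> 4 \<and>
       0 \<le> k \<and> k \<le> C * real n \<and>
       (has_negative_triangle G \<longleftrightarrow> weighted_ed w X Y \<le> k))"
  by (rule exI[of _ "machine.program c"], rule exI[of _ "23 + 3 * c"], rule exI[of _ "real (1500000 + c)"])
    (intro allI impI, elim conjE, rule reduction[OF assms])

end
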